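(* Let $T$ be a linear operator bounded on $L^2(w)$ for any $w\in A_2$ and let $b\in BMO$. Suppose further that there is a function $\varphi:[1,\infty)^3\to[0,\infty)$, increasing with respect to each component, such that \begin{equation*} \|T\|_{\mathscr{B}(L^{2}(w))} \le \varphi\Big( [w]_{A_2},[w]_{A_\infty}',[\sigma]_{A_{\infty}}'\Big). \end{equation*} Then there is a dimensional constant $c$ such that \begin{equation*} \|[b,T]\|_{\mathscr{B}(L^{2}(w))} \le c\, \varphi\Big(c\,[w]_{A_2},c\,[w]_{A_\infty}',c\,[\sigma]_{A_{\infty}}'\Big)\, \big([w]_{A_\infty}'+[\sigma]_{A_{\infty}}'\big)\, \|b\|_{BMO}, \end{equation*} or more generally \begin{equation*} \|T_b^k\|_{\mathscr{B}(L^{2}(w))} \le c\, \varphi\Big(c\,[w]_{A_2},c\,[w]_{A_\infty}',c\,[\sigma]_{A_{\infty}}'\Big)\, \big([w]_{A_\infty}'+[\sigma]_{A_{\infty}}'\big)^k\, \|b\|^k_{BMO}. \end{equation*}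
   Context: Weights on $\mathbb{R}^d$, $\sigma=w^{-1}$, suprema over all cubes $Q$. $[w]_{A_2}:=\sup_Q\big(\frac{1}{|Q|}\int_Q w\big)\big(\frac{1}{|Q|}\int_Q w^{-1}\big)$; $[w]_{A_\infty}':=\sup_Q\frac{1}{w(Q)}\int_Q M(w\chi_Q)$ with $M$ the Hardy--Littlewood maximal operator. $[b,T]f=bT(f)-T(bf)$, and $T_b^k:=[b,T_b^{k-1}]$ with $T_b^1=[b,T]$.
   Formalization: In the iterated bound the constant c may depend on k as well as on the dimension; a c independent of k is impossible (Hilbert transform, w=1, b=log|x| gives norm at least k!/(2π)). The function b is taken real-valued. *)

theory Defs
  imports "HOL-Analysis.Analysis"
begin

definition cube :: "'a::euclidean_space set \<Rightarrow> bool" where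
  "cube Q \<longleftrightarrow> (\<exists>a l. 0 < l \<and> Q = cbox a (a + l *\<^sub>R One))"

definition avg :: "'a::euclidean_space set \<Rightarrow> ('a \<Rightarrow> real) \<Rightarrow> ennreal" where
  "avg Q f = (\<integral>\<^sup>+x\<in>Q. ennreal (f x) \<partial>lebesgue) / emeasure lebesgue Q"

definition maxop :: "('a::euclidean_space \<Rightarrow> real) \<Rightarrow> 'a \<Rightarrow> ennreal" where
  "maxop g x = (SUP Q\<in>{Q. cube Q \<and> x \<in> Q}. avg Q (\<lambda>y. \<bar>g y\<bar>))"

definition weight :: "('a::euclidean_space \<Rightarrow> real) \<Rightarrow> bool" where
  "weight w \<longleftrightarrow> w \<in> borel_measurable lebesgue \<and> (AE x in lebesgue. 0 < w x)
     \<and> (\<forall>Q. cube Q \<longrightarrow> set_integrable lebesgue Q w)"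

definition dual_weight :: "('a \<Rightarrow> real) \<Rightarrow> ('a \<Rightarrow> real)" where
  "dual_weight w = (\<lambda>x. 1 / w x)"

definition A2_char :: "('a::euclidean_space \<Rightarrow> real) \<Rightarrow> ennreal" where
  "A2_char w = (SUP Q\<in>{Q. cube Q}. avg Q w * avg Q (dual_weight w))"

definition A2 :: "('a::euclidean_space \<Rightarrow> real) \<Rightarrow> bool" where
  "A2 w \<longleftrightarrow> weight w \<and> A2_char w < \<infinity>"

text \<open>Fujii--Wilson A-infinity constant.\<close>
definition Ainf_char :: "('a::euclidean_space \<Rightarrow> real) \<Rightarrow> ennreal" where
  "Ainf_char w = (SUP Q\<in>{Q. cube Q}.
      (\<integral>\<^sup>+x\<in>Q. maxop (\<lambda>y. indicator Q y * w y) x \<partial>lebesgue) / (\<integral>\<^sup>+x\<in>Q. ennreal (w x) \<partial>lebesgue))"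

definition cube_mean :: "'a::euclidean_space set \<Rightarrow> ('a \<Rightarrow> real) \<Rightarrow> real" where
  "cube_mean Q b = (LINT x:Q|lebesgue. b x) / measure lebesgue Q"

definition bmo_norm :: "('a::euclidean_space \<Rightarrow> real) \<Rightarrow> ennreal" where
  "bmo_norm b = (SUP Q\<in>{Q. cube Q}. avg Q (\<lambda>x. \<bar>b x - cube_mean Q b\<bar>))"

definition BMO :: "('a::euclidean_space \<Rightarrow> real) \<Rightarrow> bool" where
  "BMO b \<longleftrightarrow> b \<in> borel_measurable lebesgue \<and> (\<forall>Q. cube Q \<longrightarrow> set_integrable lebesgue Q b)
     \<and> bmo_norm b < \<infinity>"

definition L2w_norm2 :: "('a::euclidean_space \<Rightarrow> real) \<Rightarrow> ('a \<Rightarrow> complex) \<Rightarrow> ennreal" where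
  "L2w_norm2 w f = (\<integral>\<^sup>+x. ennreal ((cmod (f x))\<^sup>2 * w x) \<partial>lebesgue)"

definition L2w :: "('a::euclidean_space \<Rightarrow> real) \<Rightarrow> ('a \<Rightarrow> complex) set" where
  "L2w w = {f. f \<in> borel_measurable lebesgue \<and> L2w_norm2 w f < \<infinity>}"

text \<open>Operator norm on L2(w): the least K with norm(T f) <= K norm(f) for all f in L2(w)
  (squared form; infinity if there is no such K).\<close>
definition opnorm :: "('a::euclidean_space \<Rightarrow> real) \<Rightarrow> (('a \<Rightarrow> complex) \<Rightarrow> ('a \<Rightarrow> complex)) \<Rightarrow> ennreal" where
  "opnorm w T = Inf {K. \<forall>f\<in>L2w w. L2w_norm2 w (T f) \<le> K\<^sup>2 * L2w_norm2 w f}"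

definition linear_op :: "(('a \<Rightarrow> complex) \<Rightarrow> ('a \<Rightarrow> complex)) \<Rightarrow> bool" where
  "linear_op T \<longleftrightarrow> (\<forall>f g. T (\<lambda>x. f x + g x) = (\<lambda>x. T f x + T g x))
      \<and> (\<forall>c f. T (\<lambda>x. c * f x) = (\<lambda>x. c * T f x))"

definition commutator :: "('a \<Rightarrow> real) \<Rightarrow> (('a \<Rightarrow> complex) \<Rightarrow> ('a \<Rightarrow> complex)) \<Rightarrow> (('a \<Rightarrow> complex) \<Rightarrow> ('a \<Rightarrow> complex))" where
  "commutator b T = (\<lambda>f x. complex_of_real (b x) * T f x - T (\<lambda>y. complex_of_real (b y) * f y) x)"

primrec iter_comm :: "nat \<Rightarrow> ('a \<Rightarrow> real) \<Rightarrow> (('a \<Rightarrow> complex) \<Rightarrow> ('a \<Rightarrow> complex)) \<Rightarrow> (('a \<Rightarrow> complex) \<Rightarrow> ('a \<Rightarrow> complex))" where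
  "iter_comm 0 b T = T"
| "iter_comm (Suc k) b T = commutator b (iter_comm k b T)"

definition admissible_phi :: "(real \<Rightarrow> real \<Rightarrow> real \<Rightarrow> real) \<Rightarrow> bool" where
  "admissible_phi \<phi> \<longleftrightarrow>
     (\<forall>x y z. 1 \<le> x \<and> 1 \<le> y \<and> 1 \<le> z \<longrightarrow> 0 \<le> \<phi> x y z) \<and>
     (\<forall>x y z x' y' z'. 1 \<le> x \<and> 1 \<le> y \<and> 1 \<le> z \<and> x \<le> x' \<and> y \<le> y' \<and> z \<le> z'
        \<longrightarrow> \<phi> x y z \<le> \<phi> x' y' z')"

end

theory Submission
  imports Defs
begin

text \<open>
  The iterated commutator is \<open>k!\<close> times the \<open>k\<close>-th Taylor coefficient at \<open>z = 0\<close> of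
  \<open>z \<mapsto> e\<^sup>z\<^sup>b T (e\<^sup>-\<^sup>z\<^sup>b f)\<close>. Conjugating by \<open>e\<^sup>z\<^sup>b\<close> turns the norm on \<open>L\<^sup>2(w)\<close> into the norm of \<open>T\<close>
  on \<open>L\<^sup>2(w e\<^sup>t\<^sup>b)\<close> with \<open>t = 2 Re z\<close>, so Cauchy's estimate on a circle of radius \<open>r\<close> costs a factor \<open>k! / r^k\<close>.
  One can take \<open>r\<close> of order \<open>1 / (\<beta> (A + A'))\<close>, where \<open>\<beta>\<close> is the BMO norm and \<open>A\<close>, \<open>A'\<close> are the Fujii-Wilson
  constants of \<open>w\<close> and its dual: the sharp reverse Hoelder inequality, whose gain \<open>\<delta>\<close> is of order \<open>1 / A\<close>,
  together with the John-Nirenberg inequality shows that \<open>w e\<^sup>t\<^sup>b\<close> has comparable \<open>A\<^sub>2\<close> constant and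
  still satisfies a reverse Hoelder inequality with gain \<open>\<delta> / 2\<close>, and this bounds its Fujii-Wilson
  constant by a multiple of \<open>1 / \<delta>\<close>. All these facts are read off from how mass decays along the level sets
  of the local dyadic maximal function.
\<close>

section \<open>Dyadic cubes and maximal selected cubes\<close>

(* as a simp rule it rewrites Lebesgue measure to the measure of a Borel main part *)
declare emeasure_completion [simp del]

text \<open>The order of the gain fixes the final exponent: a gain of order \<open>A^(-p)\<close>
  would only allow a radius of order \<open>(A + A')^(-p)\<close> and hence give the power
  \<open>p k\<close>. Both constants enter because the dual of a tilted weight is the dual weight
  tilted with the opposite sign, so one radius has to be small for \<open>w\<close> and for its
  dual.

  Tilting needs bounds from below as well as from above: a reverse Hoelder inequality for the new
  weight must be expressed through its own average. The lower bound comes from the upper bound for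
  the opposite tilt, which is why smallness is always imposed on \<open>|\<theta>|\<close>.

  Mass decay is a dyadic statement, whereas \<open>Ainf_char\<close> takes the maximal function over
  all cubes; tripled stopping cubes bridge the two.

  In the complex argument the functions \<open>e^(-zb) f\<close> live in a different weighted space
  for each direction of \<open>z\<close>, and \<open>b^m f\<close> may leave \<open>L2w w\<close>.
  One auxiliary weight, the tilt of \<open>w\<close> by \<open>|b|\<close>, carries all of them at
  once; the norm of \<open>T\<close> there only has to be finite, because it multiplies errors that
  vanish in a limit.\<close>

abbreviation vol :: "'a::euclidean_space set \<Rightarrow> ennreal" where
  "vol \<equiv> emeasure lebesgue"

abbreviation mass :: "('a::euclidean_space \<Rightarrow> real) \<Rightarrow> 'a set \<Rightarrow> ennreal" where
  "mass f S \<equiv> \<integral>\<^sup>+x\<in>S. ennreal (f x) \<partial>lebesgue"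

abbreviation max_mass :: "('a::euclidean_space \<Rightarrow> real) \<Rightarrow> 'a set \<Rightarrow> ennreal" where
  "max_mass f S \<equiv> \<integral>\<^sup>+x\<in>S. maxop (\<lambda>y. indicator S y * f y) x \<partial>lebesgue"

abbreviation tilt :: "('a \<Rightarrow> real) \<Rightarrow> ('a \<Rightarrow> real) \<Rightarrow> real \<Rightarrow> 'a \<Rightarrow> real" where
  "tilt w b \<theta> \<equiv> \<lambda>x. w x * exp (\<theta> * b x)"

lemma open_contains_cbox_cube:
  fixes x :: "'a::euclidean_space"
  assumes "open U" "x \<in> U"
  shows "\<exists>e>0. \<forall>y. (\<forall>i\<in>Basis. \<bar>(y - x) \<bullet> i\<bar> < e) \<longrightarrow> y \<in> U"
proof -
  obtain e where e: "e > 0" "ball x e \<subseteq> U" using assms by (meson openE)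
  define e' where "e' = e / DIM('a)"
  have "e' > 0" using e by (simp add: e'_def)
  moreover have "y \<in> U" if y: "\<forall>i\<in>Basis. \<bar>(y - x) \<bullet> i\<bar> < e'" for y
  proof -
    have "norm (y - x) \<le> (\<Sum>i\<in>Basis. \<bar>(y - x) \<bullet> i\<bar>)" by (rule norm_le_l1)
    also have "\<dots> < (\<Sum>i\<in>(Basis::'a set). e')"
      by (rule sum_strict_mono) (use y in auto)
    also have "\<dots> = e" by (simp add: e'_def)
    finally show ?thesis using e by (auto simp: dist_norm norm_minus_commute)
  qed
  ultimately show ?thesis by blast
qed

text \<open>The grid is anchored at an arbitrary cube, which becomes its generation-0 cube; an
  estimate on \<open>Q0\<close> valid in every grid is therefore an estimate on every cube.\<close>

locale dyadic_grid =
  fixes a :: "'a::euclidean_space" and l :: real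
  assumes l_pos: "0 < l"
begin

definition idx :: "nat \<Rightarrow> 'a \<Rightarrow> 'a \<Rightarrow> int" where
  "idx n x i = \<lfloor>2 ^ n * ((x - a) \<bullet> i) / l\<rfloor>"

definition corner :: "nat \<Rightarrow> 'a \<Rightarrow> 'a" where
  "corner n x = a + (l / 2 ^ n) *\<^sub>R (\<Sum>i\<in>Basis. real_of_int (idx n x i) *\<^sub>R i)"

text \<open>
  \<open>D n x\<close> and \<open>K n x\<close> are the half-open and the closed dyadic cube of generation \<open>n\<close> around \<open>x\<close>: the former
  partition the space, the latter are cubes in the sense of \<open>cube\<close>, and they differ by a null set.
\<close>

definition D :: "nat \<Rightarrow> 'a \<Rightarrow> 'a set" where
  "D n x = {y. \<forall>i\<in>Basis. idx n y i = idx n x i}"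

definition K :: "nat \<Rightarrow> 'a \<Rightarrow> 'a set" where
  "K n x = cbox (corner n x) (corner n x + (l / 2 ^ n) *\<^sub>R One)"

abbreviation Q0 :: "'a set" where "Q0 \<equiv> D 0 a"

lemma D_self [simp]: "x \<in> D n x"
  by (simp add: D_def)

lemma D_eq: "y \<in> D n x \<Longrightarrow> D n y = D n x"
  by (auto simp: D_def)

lemma corner_eq: "y \<in> D n x \<Longrightarrow> corner n y = corner n x"
  by (auto simp: D_def corner_def)

lemma K_eq: "y \<in> D n x \<Longrightarrow> K n y = K n x"
  by (simp add: K_def corner_eq)

lemma corner_inner: "i \<in> Basis \<Longrightarrow> corner n x \<bullet> i = a \<bullet> i + l / 2 ^ n * idx n x i"
  by (simp add: corner_def inner_simps)

lemma D_iff: "y \<in> D n x \<longleftrightarrow> (\<forall>i\<in>Basis. corner n x \<bullet> i \<le> y \<bullet> i \<and> y \<bullet> i < corner n x \<bullet> i + l / 2 ^ n)"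
proof -
  have "idx n y i = idx n x i \<longleftrightarrow> corner n x \<bullet> i \<le> y \<bullet> i \<and> y \<bullet> i < corner n x \<bullet> i + l / 2 ^ n"
    if i: "i \<in> Basis" for i
  proof -
    have "idx n y i = idx n x i \<longleftrightarrow>
      of_int (idx n x i) \<le> 2 ^ n * ((y - a) \<bullet> i) / l \<and> 2 ^ n * ((y - a) \<bullet> i) / l < of_int (idx n x i) + 1"
      unfolding idx_def[of n y] by (simp add: floor_eq_iff)
    also have "\<dots> \<longleftrightarrow> corner n x \<bullet> i \<le> y \<bullet> i \<and> y \<bullet> i < corner n x \<bullet> i + l / 2 ^ n"
      using l_pos i by (simp add: corner_inner inner_simps field_simps)
    finally show ?thesis .
  qed
  then show ?thesis by (auto simp: D_def)
qed

lemma idx_Suc: "idx n x i = idx (Suc n) x i div 2"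
proof -
  have "idx (Suc n) x i div 2 = \<lfloor>(2 ^ Suc n * ((x - a) \<bullet> i) / l) / of_nat 2\<rfloor>"
    unfolding idx_def floor_divide_real_eq_div[OF of_nat_0_le_iff]
    by (metis floor_divide_real_eq_div of_int_numeral of_nat_numeral zero_le_numeral)
  also have "\<dots> = idx n x i" by (simp add: idx_def)
  finally show ?thesis ..
qed

lemma D_Suc: "D (Suc n) x \<subseteq> D n x"
  by (auto simp: D_def idx_Suc[of n])

lemma D_mono: "m \<le> n \<Longrightarrow> D n x \<subseteq> D m x"
proof (induction n rule: dec_induct)
  case (step n)
  then show ?case using D_Suc[of n x] by blast
qed simp

lemma D_subset_K: "D n x \<subseteq> K n x"
  by (auto simp: D_iff K_def mem_box inner_simps less_imp_le)

lemma box_subset_D: "box (corner n x) (corner n x + (l / 2 ^ n) *\<^sub>R One) \<subseteq> D n x"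
  by (auto simp: D_iff mem_box inner_simps less_imp_le)

lemma K_mono:
  assumes "m \<le> n" shows "K n x \<subseteq> K m x"
proof -
  have step: "K (Suc n) x \<subseteq> K n x" for n
  proof -
    have "idx (Suc n) x i = 2 * idx n x i \<or> idx (Suc n) x i = 2 * idx n x i + 1" for i
      unfolding idx_Suc[of n x i] by presburger
    then have "2 * idx n x i \<le> idx (Suc n) x i \<and> idx (Suc n) x i \<le> 2 * idx n x i + 1" for i
      by (metis dual_order.refl le_add_same_cancel1 zle_add1_eq_le zless_add1_eq zero_le_one)
    then have *: "2 * real_of_int (idx n x i) \<le> idx (Suc n) x i" "real_of_int (idx (Suc n) x i) \<le> 2 * idx n x i + 1" for i
      by (metis of_int_le_iff of_int_mult of_int_numeral, metis of_int_1 of_int_add of_int_le_iff of_int_mult of_int_numeral)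
    define h where "h = l / 2 ^ Suc n"
    have h: "h > 0" "l / 2 ^ n = h * 2" "l / 2 ^ Suc n = h" using l_pos by (auto simp: h_def)
    have "corner n x \<bullet> i \<le> corner (Suc n) x \<bullet> i \<and>
      corner (Suc n) x \<bullet> i + l / 2 ^ Suc n \<le> corner n x \<bullet> i + l / 2 ^ n" if i: "i \<in> Basis" for i
    proof -
      have "h * (2 * idx n x i) \<le> h * idx (Suc n) x i" "h * (idx (Suc n) x i + 1) \<le> h * (2 * idx n x i + 2)"
        using *[of i] h(1) by (intro mult_left_mono; simp)+
      then show ?thesis unfolding corner_inner[OF i] h(2,3) by (simp add: algebra_simps)
    qed
    then show ?thesis unfolding K_def
      by (intro subset_box_imp) (auto simp: inner_simps)
  qed
  show ?thesis using assms by (induction n rule: dec_induct) (use step in auto)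
qed

lemma cube_K: "cube (K n x)"
  unfolding cube_def K_def using l_pos by (intro exI[of _ "corner n x"] exI[of _ "l / 2 ^ n"]) auto

lemma idx0a: "idx n a i = 0"
  by (simp add: idx_def)

lemma K0a: "K 0 a = cbox a (a + l *\<^sub>R One)"
  by (simp add: K_def corner_def idx0a)

lemma D0: "x \<in> Q0 \<Longrightarrow> D 0 x = Q0"
  by (rule D_eq)

lemma D_subset_Q0: "x \<in> Q0 \<Longrightarrow> D n x \<subseteq> Q0"
  using D_mono[of 0 n x] D0[of x] by blast

lemma sets_D_borel: "D n x \<in> sets borel"
proof -
  have "D n x = (\<Inter>i\<in>Basis. {y. corner n x \<bullet> i \<le> y \<bullet> i} \<inter> {y. y \<bullet> i < corner n x \<bullet> i + l / 2 ^ n})"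
    by (auto simp: D_iff)
  also have "\<dots> \<in> sets borel"
    by (intro sets.finite_INT sets.Int borel_closed borel_open)
      (auto intro!: closed_Collect_le open_Collect_less continuous_intros)
  finally show ?thesis .
qed

lemma sets_D [measurable]: "D n x \<in> sets lebesgue"
  using sets_D_borel by simp

lemma sets_K [measurable]: "K n x \<in> sets lebesgue"
  by (simp add: K_def)

lemma AE_D_K: "AE y in lebesgue. y \<in> D n x \<longleftrightarrow> y \<in> K n x"
proof -
  have "negligible (K n x - box (corner n x) (corner n x + (l / 2 ^ n) *\<^sub>R One))"
    unfolding K_def by (rule negligible_frontier_interval)
  then have "AE y in lebesgue. y \<notin> K n x - box (corner n x) (corner n x + (l / 2 ^ n) *\<^sub>R One)"
    using negligible_iff_null_sets AE_not_in by blast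
  then show ?thesis
    by (rule AE_mp) (use D_subset_K[of n x] box_subset_D[of n x] in \<open>auto intro!: AE_I2\<close>)
qed

text \<open>Stated for absolutely continuous measures because the exchange of half-open and closed
  cubes is also made for the weighted measures \<open>wm f\<close>.\<close>

lemma emeasure_D_K:
  assumes "sets M = sets lebesgue" "absolutely_continuous lebesgue M"
  shows "emeasure M (D n x) = emeasure M (K n x)"
proof (rule emeasure_eq_AE)
  have "AE y in lebesgue. y \<in> D n x \<longleftrightarrow> y \<in> K n x" by (rule AE_D_K)
  then show "AE y in M. y \<in> D n x \<longleftrightarrow> y \<in> K n x"
    using assms by (metis absolutely_continuous_AE)
qed (use assms in auto)

lemma emeasure_lebesgue_D: "vol (D n x) = ennreal ((l / 2 ^ n) ^ DIM('a))"
proof -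
  have "vol (D n x) = vol (K n x)"
    by (rule emeasure_D_K) (auto simp: absolutely_continuous_def)
  also have "\<dots> = ennreal (\<Prod>i\<in>(Basis::'a set). l / 2 ^ n)"
    unfolding K_def using l_pos by (auto simp: emeasure_completion emeasure_lborel_cbox_eq inner_simps)
  finally show ?thesis by simp
qed

lemma emeasure_D_parent: "vol (D n x) = 2 ^ DIM('a) * vol (D (Suc n) x)"
proof -
  have "(l / 2 ^ n) ^ DIM('a) = 2 ^ DIM('a) * (l / 2 ^ Suc n) ^ DIM('a)"
    by (simp flip: power_mult_distrib)
  then show ?thesis unfolding emeasure_lebesgue_D using l_pos
    by (simp add: ennreal_mult flip: ennreal_power)
qed

lemma countable_range_D: "countable (range (D n))"
proof -
  have "range (D n) \<subseteq> (\<lambda>g. {y. \<forall>i\<in>Basis. idx n y i = g i}) ` (Basis \<rightarrow>\<^sub>E UNIV)"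
  proof
    fix S assume "S \<in> range (D n)"
    then obtain x where "S = D n x" by auto
    then have "S = (\<lambda>g. {y. \<forall>i\<in>Basis. idx n y i = g i}) (restrict (idx n x) Basis)"
      by (auto simp: D_def)
    then show "S \<in> (\<lambda>g. {y. \<forall>i\<in>Basis. idx n y i = g i}) ` (Basis \<rightarrow>\<^sub>E UNIV)"
      by (intro image_eqI[of S _ "restrict (idx n x) Basis"]) auto
  qed
  moreover have "countable (Basis \<rightarrow>\<^sub>E (UNIV::int set) :: ('a \<Rightarrow> int) set)"
    by (rule countable_PiE) auto
  ultimately show ?thesis by (meson countable_image countable_subset)
qed

lemma D_small:
  assumes "open U" "x \<in> U"
  shows "\<exists>n. D n x \<subseteq> U"
proof -
  obtain e where e: "e > 0" "\<And>y. (\<forall>i\<in>Basis. \<bar>(y - x) \<bullet> i\<bar> < e) \<Longrightarrow> y \<in> U"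
    using open_contains_cbox_cube[OF assms] by blast
  obtain n where "l / e < 2 ^ n" using real_arch_pow[of 2 "l / e"] by auto
  then have n: "l / 2 ^ n < e" using e by (simp add: field_simps)
  have "y \<in> U" if "y \<in> D n x" for y
  proof (rule e(2), rule ballI)
    fix i :: 'a assume "i \<in> Basis"
    then show "\<bar>(y - x) \<bullet> i\<bar> < e"
      using that D_self[of x n] n unfolding D_iff by (force simp: inner_simps)
  qed
  then show ?thesis by blast
qed

text \<open>\<open>atoms S\<close> are the maximal dyadic subcubes of \<open>Q0\<close> selected by \<open>S\<close>, and \<open>stop S\<close> is their union.\<close>

definition stop :: "('a set \<Rightarrow> bool) \<Rightarrow> 'a set" where
  "stop S = {x \<in> Q0. \<exists>n. S (D n x)}"

definition atoms :: "('a set \<Rightarrow> bool) \<Rightarrow> 'a set set" where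
  "atoms S = {D n x | n x. x \<in> Q0 \<and> S (D n x) \<and> (\<forall>m<n. \<not> S (D m x))}"

text \<open>Any point of an atom may represent it: points sharing a dyadic cube share all its
  ancestors, so maximality transfers from the original representative.\<close>

lemma atomsE:
  assumes "P \<in> atoms S" "y \<in> P"
  obtains n where "P = D n y" "y \<in> Q0" "S (D n y)" "\<And>m. m < n \<Longrightarrow> \<not> S (D m y)"
proof -
  obtain n x where *: "P = D n x" "x \<in> Q0" "S (D n x)" "\<forall>m<n. \<not> S (D m x)"
    using assms by (auto simp: atoms_def)
  have "D m y = D m x" if "m \<le> n" for m
    using D_mono[OF that] *(1) assms(2) by (intro D_eq) auto
  with * show ?thesis using that[of n] assms(2) D_subset_Q0[of x n]
    by (metis less_imp_le order_refl subsetD)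
qed

lemma Union_atoms: "\<Union>(atoms S) = stop S"
proof
  show "\<Union>(atoms S) \<subseteq> stop S"
    by (auto simp: stop_def elim!: atomsE)
  show "stop S \<subseteq> \<Union>(atoms S)"
  proof
    fix x assume x: "x \<in> stop S"
    then obtain n where "S (D n x)" by (auto simp: stop_def)
    define N where "N = (LEAST n. S (D n x))"
    have "S (D N x)" unfolding N_def by (rule LeastI) fact
    moreover have "\<not> S (D m x)" if "m < N" for m using that not_less_Least unfolding N_def by blast
    ultimately have "D N x \<in> atoms S" using x unfolding atoms_def stop_def by blast
    then show "x \<in> \<Union>(atoms S)" using D_self by blast
  qed
qed

text \<open>A more demanding selection stops at a later generation, and two dyadic cubes with a
  common point are nested by generation.\<close>

lemma atoms_nested:
  assumes "\<And>n x. S' (D n x) \<Longrightarrow> S (D n x)" "P' \<in> atoms S'" "P \<in> atoms S" "y \<in> P" "y \<in> P'"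
  shows "P' \<subseteq> P"
proof -
  obtain n where n: "P = D n y" "\<And>m. m < n \<Longrightarrow> \<not> S (D m y)"
    using atomsE[OF assms(3,4)] by metis
  obtain n' where n': "P' = D n' y" "S' (D n' y)"
    using atomsE[OF assms(2,5)] by metis
  have "n \<le> n'" using n n' assms(1) by (meson not_le)
  then show ?thesis using n n' D_mono by auto
qed

lemma atoms_disjoint: "disjoint (atoms S)"
proof (rule disjointI)
  fix P P' assume P: "P \<in> atoms S" "P' \<in> atoms S" "P \<noteq> P'"
  have "P = P'" if "y \<in> P" "y \<in> P'" for y
    using atoms_nested[of S S P P' y] atoms_nested[of S S P' P y] P that by (intro equalityI)
  then show "P \<inter> P' = {}" using P(3) by auto
qed

lemma countable_atoms: "countable (atoms S)"
proof -
  have "atoms S \<subseteq> (\<Union>n. range (D n))" by (auto simp: atoms_def)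
  then show ?thesis using countable_range_D by (meson countable_UN countable_subset countableI_type)
qed

lemma sets_atoms: "P \<in> atoms S \<Longrightarrow> P \<in> sets lebesgue"
  by (auto simp: atoms_def)

lemma sets_stop [measurable]: "stop S \<in> sets lebesgue"
proof -
  have "\<Union>(atoms S) \<in> sets lebesgue"
    by (rule sets.countable_Union[OF countable_atoms]) (rule subsetI, rule sets_atoms)
  then show ?thesis by (simp only: Union_atoms)
qed

lemma stop_subset: "stop S \<subseteq> Q0"
  by (auto simp: stop_def)

lemma emeasure_stop:
  assumes M: "sets M = sets lebesgue" and X: "X \<in> sets lebesgue"
  shows "emeasure M (stop S \<inter> X) = (\<integral>\<^sup>+P. emeasure M (P \<inter> X) \<partial>count_space (atoms S))"
proof -
  have "stop S \<inter> X = (\<Union>P\<in>atoms S. P \<inter> X)" using Union_atoms[of S] by auto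
  moreover have "disjoint_family_on (\<lambda>P. P \<inter> X) (atoms S)"
    using atoms_disjoint[of S] unfolding disjoint_family_on_def disjoint_def by blast
  then have "emeasure M (\<Union>P\<in>atoms S. P \<inter> X) = (\<integral>\<^sup>+P. emeasure M (P \<inter> X) \<partial>count_space (atoms S))"
    by (intro emeasure_UN_countable) (use M X countable_atoms sets_atoms in auto)
  ultimately show ?thesis by simp
qed

text \<open>The device that turns estimates on single atoms into estimates on level sets, by summing
  over the countable disjoint family. A constant on the left-hand side is supplied by taking
  \<open>scale_measure\<close> for \<open>M\<close>.\<close>

lemma stop_emeasure_le:
  assumes "sets M = sets lebesgue" "sets N = sets lebesgue" "X \<in> sets lebesgue" "Y \<in> sets lebesgue"
    and "\<And>P. P \<in> atoms S \<Longrightarrow> emeasure M (P \<inter> X) \<le> c * emeasure N (P \<inter> Y)"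
  shows "emeasure M (stop S \<inter> X) \<le> c * emeasure N (stop S \<inter> Y)"
proof -
  have "(\<integral>\<^sup>+P. emeasure M (P \<inter> X) \<partial>count_space (atoms S)) \<le> (\<integral>\<^sup>+P. c * emeasure N (P \<inter> Y) \<partial>count_space (atoms S))"
    by (rule nn_integral_mono) (use assms in auto)
  then show ?thesis
    unfolding emeasure_stop[OF assms(1,3)] emeasure_stop[OF assms(2,4)]
    by (simp add: nn_integral_cmult)
qed

corollary stop_emeasure_le_UNIV:
  assumes "sets M = sets lebesgue" "sets N = sets lebesgue"
    and "\<And>P. P \<in> atoms S \<Longrightarrow> emeasure M P \<le> c * emeasure N P"
  shows "emeasure M (stop S) \<le> c * emeasure N (stop S)"
  using stop_emeasure_le[OF assms(1,2), of UNIV UNIV S c] assms(3) by simp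

end

section \<open>Level sets of the dyadic maximal function\<close>

definition wm :: "('a::euclidean_space \<Rightarrow> real) \<Rightarrow> 'a measure" where
  "wm f = density lebesgue (\<lambda>x. ennreal (f x))"

lemma sets_wm [simp, measurable_cong]: "sets (wm f) = sets lebesgue"
  by (simp add: wm_def)

lemma emeasure_wm:
  "f \<in> borel_measurable lebesgue \<Longrightarrow> S \<in> sets lebesgue \<Longrightarrow> emeasure (wm f) S = mass f S"
  unfolding wm_def by (rule emeasure_density) auto

lemma ac_wm: "f \<in> borel_measurable lebesgue \<Longrightarrow> absolutely_continuous lebesgue (wm f)"
  unfolding wm_def by (intro absolutely_continuousI_density) auto

context dyadic_grid
begin

lemma emeasure_lebesgue_K: "vol (K n x) = vol (D n x)"
  by (rule emeasure_D_K[symmetric]) (auto simp: absolutely_continuous_def)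

lemma emeasure_wm_K: "f \<in> borel_measurable lebesgue \<Longrightarrow> emeasure (wm f) (K n x) = emeasure (wm f) (D n x)"
  by (rule emeasure_D_K[symmetric]) (auto intro: ac_wm)

lemma emeasure_D_pos: "0 < vol (D n x)" "vol (D n x) < \<infinity>"
  unfolding emeasure_lebesgue_D using l_pos by auto

text \<open>The volume reveals the generation. Since \<open>atoms\<close> stores bare sets, this is
  what makes the generation of an atom well defined.\<close>

lemma D_level_unique: "D n x = D m y \<Longrightarrow> n = m"
proof -
  assume "D n x = D m y"
  then have "vol (D n x) = vol (D m y)" by simp
  then have "(l / 2 ^ n) ^ DIM('a) = (l / 2 ^ m) ^ DIM('a)"
    unfolding emeasure_lebesgue_D using l_pos by (subst (asm) ennreal_inj) auto
  then have "l / 2 ^ n = l / 2 ^ m" using l_pos by (subst (asm) power_eq_iff_eq_base) auto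
  then show "n = m" using l_pos by simp
qed

text \<open>
  Lebesgue differentiation is avoided: cover the exceptional set by maximal dyadic cubes with small average
  inside an open superset of almost the same measure.
\<close>

lemma AE_le_of_averages:
  fixes t :: real
  assumes f[measurable]: "f \<in> borel_measurable lebesgue" and t: "0 \<le> t"
  shows "AE x in lebesgue. x \<in> Q0 \<longrightarrow> (\<forall>n. emeasure (wm f) (D n x) \<le> t * vol (D n x)) \<longrightarrow> f x \<le> t"
proof -
  define B where "B = Q0 - stop (\<lambda>S. \<not> emeasure (wm f) S \<le> t * vol S)"
  define Z where "Z = B \<inter> {x. t < f x}"
  have B [measurable]: "B \<in> sets lebesgue" unfolding B_def by measurable
  have "{x. t < f x} = {x \<in> space lebesgue. t < f x}" by simp
  also have "\<dots> \<in> sets lebesgue" by measurable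
  finally have Z [measurable]: "Z \<in> sets lebesgue" unfolding Z_def by auto
  have "vol Z \<le> vol Q0"
    by (rule emeasure_mono) (auto simp: Z_def B_def)
  then have Zfin: "vol Z < \<infinity>" using emeasure_D_pos(2)[of 0 a] by (rule le_less_trans)
  have "emeasure (wm f) Z \<le> ennreal t * vol Z + ennreal e" if "e > 0" for e :: real
  proof -
    \<comment> \<open>Dividing by \<open>t + 1\<close> instead of \<open>t\<close> covers the case
      \<open>t = 0\<close>.\<close>
    have "e / (t + 1) > 0" using that t by simp
    then obtain T where T: "open T" "Z \<subseteq> T" "T - Z \<in> lmeasurable" "vol (T - Z) < ennreal (e / (t + 1))"
      using sets_lebesgue_outer_open[OF Z] by blast
    \<comment> \<open>At a point of \<open>Z\<close> all dyadic averages are at most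
      \<open>t\<close>, so every dyadic cube around it that fits into \<open>T\<close> is selected;
      the maximal ones cover \<open>Z\<close> without leaving \<open>T\<close>.\<close>
    define S where "S = (\<lambda>P. P \<subseteq> T \<and> emeasure (wm f) P \<le> t * vol P)"
    have "Z \<subseteq> stop S"
    proof
      fix x assume x: "x \<in> Z"
      then obtain n where "D n x \<subseteq> T" using D_small[OF T(1)] T(2) by blast
      then show "x \<in> stop S" using x unfolding stop_def S_def Z_def B_def by blast
    qed
    then have "emeasure (wm f) Z \<le> emeasure (wm f) (stop S)" by (intro emeasure_mono) auto
    also have "\<dots> \<le> t * vol (stop S)"
      by (rule stop_emeasure_le_UNIV) (auto simp: atoms_def S_def)
    also have "\<dots> \<le> t * vol (Z \<union> (T - Z))"
    proof (intro mult_left_mono emeasure_mono)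
      show "stop S \<subseteq> Z \<union> (T - Z)" unfolding stop_def S_def using D_self by blast
      show "Z \<union> (T - Z) \<in> sets lebesgue" using T(3) by (intro sets.Un Z fmeasurableD)
    qed auto
    also have "\<dots> = t * (vol Z + vol (T - Z))"
      using T(3) by (subst plus_emeasure) auto
    also have "\<dots> \<le> t * (vol Z + ennreal (e / (t + 1)))"
      using T(4) by (intro mult_left_mono add_left_mono) (auto simp: less_imp_le)
    also have "\<dots> = t * vol Z + ennreal (t * (e / (t + 1)))"
      using t by (simp only: distrib_left ennreal_mult')
    also have "\<dots> \<le> t * vol Z + ennreal e"
      using t that by (intro add_left_mono ennreal_leI) (simp add: field_simps)
    finally show ?thesis .
  qed
  then have le: "emeasure (wm f) Z \<le> ennreal t * vol Z"
    by (rule ennreal_le_epsilon)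
  \<comment> \<open>On \<open>Z\<close> the function exceeds \<open>t\<close>, so \<open>le\<close>
    leaves no room for the excess \<open>f - t\<close>; the finite volume of \<open>Z\<close>
    permits the cancellation.\<close>
  have "emeasure (wm f) Z = (\<integral>\<^sup>+x. ennreal t * indicator Z x + ennreal (f x - t) * indicator Z x \<partial>lebesgue)"
    unfolding emeasure_wm[OF f Z]
    by (rule nn_integral_cong) (use t in \<open>auto simp: Z_def indicator_def ennreal_plus[symmetric] simp del: ennreal_plus\<close>)
  also have "\<dots> = ennreal t * vol Z + (\<integral>\<^sup>+x. ennreal (f x - t) * indicator Z x \<partial>lebesgue)"
    by (subst nn_integral_add) (auto simp: nn_integral_cmult)
  finally have "ennreal t * vol Z + (\<integral>\<^sup>+x. ennreal (f x - t) * indicator Z x \<partial>lebesgue) \<le> ennreal t * vol Z + 0"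
    using le by simp
  then have "(\<integral>\<^sup>+x. ennreal (f x - t) * indicator Z x \<partial>lebesgue) = 0"
    using Zfin by (subst (asm) ennreal_add_left_cancel_le) (auto simp: ennreal_mult_eq_top_iff)
  then have "AE x in lebesgue. ennreal (f x - t) * indicator Z x = 0"
    by (subst (asm) nn_integral_0_iff_AE) auto
  then show ?thesis
  proof (rule AE_mp, intro AE_I2 impI)
    fix x assume x: "ennreal (f x - t) * indicator Z x = 0" "x \<in> Q0" "\<forall>n. emeasure (wm f) (D n x) \<le> t * vol (D n x)"
    show "f x \<le> t"
    proof (rule ccontr)
      assume "\<not> f x \<le> t"
      then have "x \<in> Z" using x(2,3) by (simp add: Z_def B_def stop_def)
      then show False using x(1) \<open>\<not> f x \<le> t\<close> by simp
    qed
  qed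
qed

text \<open>The non-strict inequality matters: at the height equal to the average over
  \<open>Q0\<close> it selects \<open>Q0\<close> itself, so that the level sets start from all of
  \<open>Q0\<close> in \<open>Om_lvl_0\<close>.\<close>

definition lev :: "('a \<Rightarrow> real) \<Rightarrow> real \<Rightarrow> 'a set \<Rightarrow> bool" where
  "lev f t S \<longleftrightarrow> ennreal t * vol S \<le> emeasure (wm f) S"

abbreviation Om :: "('a \<Rightarrow> real) \<Rightarrow> real \<Rightarrow> 'a set" where
  "Om f t \<equiv> stop (lev f t)"

lemma lev_mono: "lev f t S \<Longrightarrow> s \<le> t \<Longrightarrow> lev f s S"
  unfolding lev_def by (rule order_trans[OF mult_right_mono]) (auto intro: ennreal_leI)

lemma Om_mono: "s \<le> t \<Longrightarrow> Om f t \<subseteq> Om f s"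
  unfolding stop_def using lev_mono by blast

lemma atoms_lev_lower: "P \<in> atoms (lev f t) \<Longrightarrow> ennreal t * vol P \<le> emeasure (wm f) P"
  by (auto simp: atoms_def lev_def)

text \<open>The dyadic parent of an atom is not selected and has \<open>2^d\<close> times its
  volume. An atom of generation 0 has no parent in the grid on \<open>Q0\<close>; the assumption on
  \<open>Q0\<close> replaces it.\<close>

lemma atoms_lev_upper:
  assumes "emeasure (wm f) Q0 \<le> ennreal t * vol Q0" "P \<in> atoms (lev f t)"
  shows "emeasure (wm f) P \<le> 2 ^ DIM('a) * ennreal t * vol P"
proof -
  obtain n x where n: "P = D n x" "x \<in> Q0" "\<forall>m<n. \<not> lev f t (D m x)"
    using assms by (auto simp: atoms_def)
  show ?thesis
  proof (cases n)
    case 0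
    then have "emeasure (wm f) P \<le> 1 * (ennreal t * vol P)"
      using n assms(1) D0[of x] by simp
    also have "\<dots> \<le> 2 ^ DIM('a) * (ennreal t * vol P)"
      by (intro mult_right_mono one_le_power) auto
    finally show ?thesis by (simp add: mult.assoc)
  next
    case (Suc m)
    have "emeasure (wm f) P \<le> emeasure (wm f) (D m x)"
      unfolding n Suc by (rule emeasure_mono) (auto intro: D_Suc[THEN subsetD])
    also have "\<dots> \<le> ennreal t * vol (D m x)"
      using n(3) Suc by (auto simp: lev_def not_le less_imp_le)
    also have "\<dots> = 2 ^ DIM('a) * ennreal t * vol P"
      unfolding n Suc emeasure_D_parent[of m] by (simp add: mult_ac)
    finally show ?thesis .
  qed
qed

text \<open>Atoms at the larger height are contained in \<open>P\<close> or disjoint from it, so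
  their lower bounds can be summed inside \<open>P\<close>.\<close>

lemma Om_lower_atom:
  assumes "s \<le> t" "P \<in> atoms (lev f s)"
  shows "ennreal t * vol (Om f t \<inter> P) \<le> emeasure (wm f) (Om f t \<inter> P)"
proof -
  have "emeasure (scale_measure (ennreal t) lebesgue) (Om f t \<inter> P) \<le> 1 * emeasure (wm f) (Om f t \<inter> P)"
  proof (rule stop_emeasure_le)
    fix P' assume P': "P' \<in> atoms (lev f t)"
    show "emeasure (scale_measure (ennreal t) lebesgue) (P' \<inter> P) \<le> 1 * emeasure (wm f) (P' \<inter> P)"
    proof (cases "P' \<inter> P = {}")
      case False
      then have "P' \<inter> P = P'" using atoms_nested[of "lev f t" "lev f s", OF _ P' assms(2)] lev_mono[OF _ assms(1)]
        by (metis IntE equals0I inf.absorb1)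
      then show ?thesis using atoms_lev_lower[OF P'] by simp
    qed simp
  qed (use assms sets_atoms in auto)
  then show ?thesis by simp
qed

lemma Om_upper:
  assumes "emeasure (wm f) Q0 \<le> ennreal t * vol Q0"
  shows "emeasure (wm f) (Om f t) \<le> 2 ^ DIM('a) * ennreal t * vol (Om f t)"
  by (rule stop_emeasure_le_UNIV) (use atoms_lev_upper[OF assms] in auto)

lemma Om_lower: "ennreal t * vol (Om f t) \<le> emeasure (wm f) (Om f t)"
  using stop_emeasure_le_UNIV[of "scale_measure (ennreal t) lebesgue" "wm f" "lev f t" 1] atoms_lev_lower[of _ f t]
  by simp

lemma AE_le_off_Om:
  assumes "f \<in> borel_measurable lebesgue" "0 \<le> t"
  shows "AE x in lebesgue. x \<in> Q0 \<longrightarrow> x \<notin> Om f t \<longrightarrow> f x \<le> t"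
  using AE_le_of_averages[OF assms]
  by (rule AE_mp) (auto intro!: AE_I2 simp: stop_def lev_def not_le less_imp_le)

text \<open>The average over \<open>P\<close> is at most \<open>2^d t\<close>, so the part of
  \<open>P\<close> covered by cubes of average at least \<open>2^(d+1) t\<close> fills at most half
  of it.\<close>

lemma Om_half:
  assumes "emeasure (wm f) Q0 \<le> ennreal t * vol Q0" "0 < t" "P \<in> atoms (lev f t)"
  shows "2 * vol (Om f (2 ^ Suc DIM('a) * t) \<inter> P) \<le> vol P"
proof -
  let ?X = "Om f (2 ^ Suc DIM('a) * t) \<inter> P"
  have *: "t \<le> 2 ^ Suc DIM('a) * t" using assms(2) one_le_power[of "2::real" "Suc DIM('a)"] by simp
  have "ennreal (2 ^ DIM('a) * t) * (2 * vol ?X) = ennreal (2 ^ Suc DIM('a) * t) * vol ?X"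
    using assms(2) by (simp add: ennreal_mult' mult_ac flip: ennreal_power)
  also have "\<dots> \<le> emeasure (wm f) ?X" by (rule Om_lower_atom[OF * assms(3)])
  also have "\<dots> \<le> emeasure (wm f) P" using assms(3) sets_atoms by (intro emeasure_mono) auto
  also have "\<dots> \<le> 2 ^ DIM('a) * ennreal t * vol P" by (rule atoms_lev_upper[OF assms(1,3)])
  also have "\<dots> = ennreal (2 ^ DIM('a) * t) * vol P"
    using assms(2) by (simp add: ennreal_mult' flip: ennreal_power)
  finally show ?thesis using assms(2)
    by (subst (asm) ennreal_mult_le_mult_iff) auto
qed

end

section \<open>Decay of mass along level sets under \<open>\<A>2\<close> and Fujii-Wilson
  bounds\<close>

lemma maxop_ge_avg:
  assumes "cube Q" "x \<in> Q"
  shows "avg Q (\<lambda>y. \<bar>g y\<bar>) \<le> maxop g x"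
  unfolding maxop_def using assms by (intro SUP_upper) auto

text \<open>Cauchy-Schwarz for \<open>1 = sqrt w * sqrt (1 / w)\<close>. Applied to a large part
  \<open>E\<close> of a cube, it lets the product bound for \<open>w\<close> and its dual force a
  definite share of the mass of \<open>w\<close> onto \<open>E\<close>.\<close>

lemma emeasure_sq_le_dual:
  fixes w :: "'a::euclidean_space \<Rightarrow> real"
  assumes w[measurable]: "w \<in> borel_measurable lebesgue" and pos: "AE x in lebesgue. 0 < w x"
    and E[measurable]: "E \<in> sets lebesgue"
  shows "(vol E)\<^sup>2 \<le> emeasure (wm w) E * emeasure (wm (dual_weight w)) E"
proof -
  have dw[measurable]: "dual_weight w \<in> borel_measurable lebesgue" unfolding dual_weight_def by measurable
  let ?f = "\<lambda>x. ennreal (sqrt (w x)) * indicator E x" and ?g = "\<lambda>x. ennreal (sqrt (1 / w x)) * indicator E x"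
  have "(\<integral>\<^sup>+x. ?f x * ?g x \<partial>lebesgue)\<^sup>2 \<le> (\<integral>\<^sup>+x. (?f x)\<^sup>2 \<partial>lebesgue) * (\<integral>\<^sup>+x. (?g x)\<^sup>2 \<partial>lebesgue)"
    by (rule Cauchy_Schwarz_nn_integral) auto
  moreover have "(\<integral>\<^sup>+x. ?f x * ?g x \<partial>lebesgue) = (\<integral>\<^sup>+x. indicator E x \<partial>lebesgue)"
    by (rule nn_integral_cong_AE, use pos in eventually_elim)
      (auto simp: indicator_def ennreal_mult[symmetric] real_sqrt_mult[symmetric])
  moreover have "(\<integral>\<^sup>+x. (?f x)\<^sup>2 \<partial>lebesgue) = emeasure (wm w) E"
    unfolding emeasure_wm[OF w E]
    by (rule nn_integral_cong_AE, use pos in eventually_elim)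
      (auto simp: indicator_def ennreal_power)
  moreover have "(\<integral>\<^sup>+x. (?g x)\<^sup>2 \<partial>lebesgue) = emeasure (wm (dual_weight w)) E"
    unfolding emeasure_wm[OF dw E]
    by (rule nn_integral_cong_AE, use pos in eventually_elim)
      (auto simp: indicator_def ennreal_power dual_weight_def)
  ultimately show ?thesis by simp
qed

lemma ennreal_le_divide_iff:
  fixes a b c :: ennreal
  assumes "c \<noteq> 0" "c \<noteq> top"
  shows "a \<le> b / c \<longleftrightarrow> a * c \<le> b"
  using divide_less_ennreal[of c b a] assms by (auto simp: top.not_eq_extremum simp flip: not_less)

context dyadic_grid
begin

text \<open>The ratio \<open>2^(d+1)\<close> of consecutive heights is the one for which \<open>Om_half\<close> applies.\<close>

definition lvl :: "real \<Rightarrow> nat \<Rightarrow> real" where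
  "lvl t m = (2 ^ Suc DIM('a)) ^ m * t"

lemma lvl_0 [simp]: "lvl t 0 = t"
  by (simp add: lvl_def)

lemma lvl_Suc: "lvl t (Suc m) = 2 ^ Suc DIM('a) * lvl t m"
  by (simp add: lvl_def)

lemma lvl_double: "0 \<le> t \<Longrightarrow> 2 * lvl t m \<le> lvl t (Suc m)"
  unfolding lvl_Suc by (intro mult_right_mono) (auto simp: lvl_def)

lemma lvl_nonneg: "0 \<le> t \<Longrightarrow> 0 \<le> lvl t m"
  by (simp add: lvl_def)

lemma lvl_pos: "0 < t \<Longrightarrow> 0 < lvl t m"
  by (simp add: lvl_def)

lemma lvl_mono: "0 \<le> t \<Longrightarrow> m \<le> n \<Longrightarrow> lvl t m \<le> lvl t n"
  unfolding lvl_def by (intro mult_right_mono power_increasing one_le_power) auto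

lemma sum_lvl: "0 \<le> t \<Longrightarrow> (\<Sum>m\<le>j. lvl t m) \<le> 2 * lvl t j"
proof (induction j)
  case (Suc j)
  then show ?case using lvl_double[of t j] by simp
qed simp

lemma Om_lvl_mono: "0 \<le> t \<Longrightarrow> m \<le> n \<Longrightarrow> Om w (lvl t n) \<subseteq> Om w (lvl t m)"
  by (intro Om_mono lvl_mono)

context
  fixes w :: "'a \<Rightarrow> real" and t :: real
  assumes w[measurable]: "w \<in> borel_measurable lebesgue" and t: "0 < t"
    and wt: "ennreal t * vol Q0 = emeasure (wm w) Q0"
begin

lemma wm_Q0: "0 < emeasure (wm w) Q0" "emeasure (wm w) Q0 < \<infinity>"
  using emeasure_D_pos[of 0 a] t unfolding wt[symmetric]
  by (auto simp: ennreal_zero_less_mult_iff ennreal_mult_less_top)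

lemma wm_Q0_le: "emeasure (wm w) Q0 \<le> ennreal (lvl t m) * vol Q0"
  unfolding wt[symmetric] using lvl_mono[of t 0 m] t by (intro mult_right_mono ennreal_leI) auto

lemma Om_lvl_0: "Om w (lvl t 0) = Q0"
proof -
  have "lev w t (D 0 x)" if "x \<in> Q0" for x using wt D0[OF that] by (simp add: lev_def)
  then show ?thesis unfolding stop_def by auto
qed

lemma wm_fin: "S \<subseteq> Q0 \<Longrightarrow> emeasure (wm w) S < \<infinity>"
  using emeasure_mono[of S Q0 "wm w"] wm_Q0 by (auto intro: le_less_trans)

text \<open>On each atom at least half of the volume lies outside the next level set, and the
  product bound with the dual weight makes that half carry a fraction \<open>1 / (4 A)\<close> of
  the mass. The masses between consecutive levels telescope. This serves to show that Fujii-Wilson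
  constants are finite.\<close>

lemma A2_sum:
  fixes A :: real
  assumes pos: "AE x in lebesgue. 0 < w x"
    and A: "\<And>n x. x \<in> Q0 \<Longrightarrow> emeasure (wm w) (D n x) * emeasure (wm (dual_weight w)) (D n x) \<le> A * (vol (D n x))\<^sup>2"
  shows "(\<Sum>m<N. emeasure (wm w) (Om w (lvl t m))) \<le> 4 * ennreal A * emeasure (wm w) Q0"
proof -
  let ?\<nu> = "emeasure (wm w)" and ?\<sigma> = "emeasure (wm (dual_weight w))" and ?\<mu> = vol
  have step: "?\<nu> (Om w (lvl t m)) \<le> 4 * ennreal A * ?\<nu> (Om w (lvl t m) - Om w (lvl t (Suc m)))" for m
  proof -
    let ?O = "Om w (lvl t (Suc m))"
    have "?\<nu> (Om w (lvl t m) \<inter> UNIV) \<le> 4 * ennreal A * ?\<nu> (Om w (lvl t m) \<inter> - ?O)"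
    proof (rule stop_emeasure_le)
      fix P assume P: "P \<in> atoms (lev w (lvl t m))"
      then obtain n x where n: "x \<in> Q0" "P = D n x" by (auto simp: atoms_def)
      have [measurable]: "P \<in> sets lebesgue" using n by simp
      let ?E = "P - ?O"
      have "2 * ?\<mu> (?O \<inter> P) \<le> ?\<mu> P"
        using Om_half[OF wm_Q0_le lvl_pos[OF t] P] by (simp add: lvl_Suc)
      moreover have "?\<mu> P = ?\<mu> (?O \<inter> P) + ?\<mu> ?E"
        by (subst plus_emeasure) (auto intro!: arg_cong[where f = ?\<mu>])
      moreover have "?\<mu> (?O \<inter> P) < \<infinity>"
        using emeasure_mono[of "?O \<inter> P" P lebesgue] emeasure_D_pos(2)[of n x] n by (auto intro: le_less_trans)
      ultimately have "?\<mu> (?O \<inter> P) \<le> ?\<mu> ?E"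
        by (auto simp: mult_2 ennreal_add_left_cancel_le)
      then have "?\<mu> P \<le> 2 * ?\<mu> ?E"
        unfolding \<open>?\<mu> P = ?\<mu> (?O \<inter> P) + ?\<mu> ?E\<close> mult_2 by (rule add_right_mono)
      then have "(?\<mu> P)\<^sup>2 \<le> (2 * ?\<mu> ?E)\<^sup>2" by (rule power_mono) auto
      also have "\<dots> = 4 * (?\<mu> ?E)\<^sup>2" by (simp add: power2_eq_square mult_ac)
      also have "\<dots> \<le> 4 * (?\<nu> ?E * ?\<sigma> ?E)"
        by (intro mult_left_mono emeasure_sq_le_dual[OF w pos]) auto
      also have "\<dots> \<le> 4 * (?\<nu> ?E * ?\<sigma> P)"
        by (intro mult_left_mono emeasure_mono) auto
      finally have 1: "(?\<mu> P)\<^sup>2 \<le> 4 * (?\<nu> ?E * ?\<sigma> P)" .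
      \<comment> \<open>Multiplying the previous estimate by \<open>A\<close> leaves the common
        factor \<open>?\<sigma> P\<close>, which is cancelled once it is known to be positive and
        finite.\<close>
      have "?\<sigma> P * ?\<nu> P \<le> A * (?\<mu> P)\<^sup>2" using A[of x n] n by (simp add: mult.commute)
      also have "\<dots> \<le> A * (4 * (?\<nu> ?E * ?\<sigma> P))" by (intro mult_left_mono 1) auto
      finally have 2: "?\<sigma> P * ?\<nu> P \<le> ?\<sigma> P * (4 * ennreal A * ?\<nu> ?E)" by (simp add: mult_ac)
      have sq: "(?\<mu> P)\<^sup>2 \<noteq> 0" "(?\<mu> P)\<^sup>2 < \<infinity>" using emeasure_D_pos[of n x] n
        by (auto simp: power_less_top_ennreal zero_less_power)
      have 3: "(?\<mu> P)\<^sup>2 \<le> ?\<nu> P * ?\<sigma> P" by (rule emeasure_sq_le_dual[OF w pos]) simp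
      have "?\<sigma> P \<noteq> 0" "?\<nu> P \<noteq> 0" using 3 sq by auto
      moreover have "?\<sigma> P \<noteq> top"
      proof
        assume "?\<sigma> P = top"
        then have "?\<nu> P * ?\<sigma> P = top" using \<open>?\<nu> P \<noteq> 0\<close> by (simp add: ennreal_mult_eq_top_iff)
        then show False using A[of x n] n sq by (auto simp: ennreal_mult_eq_top_iff top_unique)
      qed
      ultimately have "?\<nu> P \<le> 4 * ennreal A * ?\<nu> ?E" using 2 by (simp add: ennreal_mult_le_mult_iff)
      then show "?\<nu> (P \<inter> UNIV) \<le> 4 * ennreal A * ?\<nu> (P \<inter> - ?O)" by (simp add: Diff_eq)
    qed (auto simp: Compl_eq_Diff_UNIV)
    then show ?thesis by (simp add: Diff_eq)
  qed
  have "(\<Sum>m<N. ?\<nu> (Om w (lvl t m) - Om w (lvl t (Suc m)))) + ?\<nu> (Om w (lvl t N)) = ?\<nu> Q0"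
  proof (induction N)
    case (Suc N)
    have "?\<nu> (Om w (lvl t N)) = ?\<nu> (Om w (lvl t N) - Om w (lvl t (Suc N))) + ?\<nu> (Om w (lvl t (Suc N)))"
      using Om_lvl_mono[of t N "Suc N" w] t by (subst plus_emeasure) (auto intro!: arg_cong[where f = ?\<nu>])
    then show ?case using Suc by (simp add: add.assoc)
  qed (simp add: Om_lvl_0[simplified])
  then have *: "(\<Sum>m<N. ?\<nu> (Om w (lvl t m) - Om w (lvl t (Suc m)))) \<le> ?\<nu> Q0"
    by (rule subst) (rule add_increasing2, auto)
  have "(\<Sum>m<N. ?\<nu> (Om w (lvl t m))) \<le> (\<Sum>m<N. 4 * ennreal A * ?\<nu> (Om w (lvl t m) - Om w (lvl t (Suc m))))"
    by (rule sum_mono) (rule step)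
  also have "\<dots> \<le> 4 * ennreal A * ?\<nu> Q0"
    unfolding sum_distrib_left[symmetric] by (intro mult_left_mono *) auto
  finally show ?thesis .
qed

text \<open>Inside an atom at height \<open>lvl t k\<close>, a sum of multiples of indicators of all
  higher level sets is dominated by the maximal function of \<open>w\<close> localised to that atom.
  Integrating with the Fujii-Wilson bound controls the sum of height times volume, and
  \<open>Om_upper\<close> converts this into mass. The resulting tail bound is linear in
  \<open>A\<close>.\<close>

lemma Ainf_sum:
  fixes A :: real
  assumes A: "\<And>n x. x \<in> Q0 \<Longrightarrow> max_mass w (K n x) \<le> A * emeasure (wm w) (K n x)"
  shows "(\<Sum>m\<in>{k<..<N}. emeasure (wm w) (Om w (lvl t m))) \<le> 2 ^ Suc DIM('a) * ennreal A * emeasure (wm w) (Om w (lvl t k))"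
proof -
  let ?\<nu> = "emeasure (wm w)" and ?\<mu> = vol
  let ?h = "\<lambda>m. ennreal (lvl t m / 2)" and ?O = "\<lambda>m. Om w (lvl t m)"
  \<comment> \<open>The factor \<open>1 / 2\<close> makes \<open>F\<close> at most the highest level
    reached at the point, because the heights at least double and \<open>sum_lvl\<close> costs a
    factor 2.\<close>
  define F :: "'a \<Rightarrow> real" where "F x = (\<Sum>m\<in>{k<..<N}. lvl t m / 2 * indicator (?O m) x)" for x
  have [measurable]: "F \<in> borel_measurable lebesgue" unfolding F_def by measurable
  have "emeasure (wm F) (?O k) \<le> ennreal A * ?\<nu> (?O k)"
  proof (rule stop_emeasure_le_UNIV)
    fix P assume P: "P \<in> atoms (lev w (lvl t k))"
    then obtain n x where n: "x \<in> Q0" "P = D n x" by (auto simp: atoms_def)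
    have le: "ennreal (F y) \<le> maxop (\<lambda>z. indicator (K n x) z * w z) y" if y: "y \<in> P" for y
    proof (cases "\<exists>m\<in>{k<..<N}. y \<in> ?O m")
      case False
      then have "F y = 0" unfolding F_def by (intro sum.neutral) auto
      then show ?thesis by simp
    next
      case True
      define j where "j = Max {m\<in>{k<..<N}. y \<in> ?O m}"
      have j: "j \<in> {k<..<N}" "y \<in> ?O j" and jm: "\<And>m. m \<in> {k<..<N} \<Longrightarrow> y \<in> ?O m \<Longrightarrow> m \<le> j"
      proof -
        let ?J = "{m\<in>{k<..<N}. y \<in> ?O m}"
        have fin: "finite ?J" "?J \<noteq> {}" using True by auto
        show "j \<in> {k<..<N}" "y \<in> ?O j" using Max_in[OF fin] unfolding j_def by blast+
        show "m \<le> j" if "m \<in> {k<..<N}" "y \<in> ?O m" for m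
          unfolding j_def using that fin(1) by (intro Max_ge) blast+
      qed
      have "F y = (\<Sum>m\<in>{m\<in>{k<..<N}. y \<in> ?O m}. lvl t m / 2)"
        unfolding F_def by (rule sum.mono_neutral_cong_right) auto
      also have "\<dots> \<le> (\<Sum>m\<in>{..j}. lvl t m / 2)"
        using jm t by (intro sum_mono2) (auto simp: lvl_nonneg)
      also have "\<dots> \<le> lvl t j" using sum_lvl[of t j] t by (simp add: sum_divide_distrib[symmetric])
      finally have Fj: "F y \<le> lvl t j" .
      obtain n' where n': "lev w (lvl t j) (D n' y)" using j by (auto simp: stop_def)
      obtain n'' where n'': "P = D n'' y" "\<And>m. m < n'' \<Longrightarrow> \<not> lev w (lvl t k) (D m y)"
        using atomsE[OF P y] by metis
      \<comment> \<open>The cube of large average is also selected at the lower height, so by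
        maximality it lies inside \<open>P\<close>; restricting \<open>w\<close> to
        \<open>K n x\<close> therefore does not lower its average.\<close>
      have "lev w (lvl t k) (D n' y)" using n' by (rule lev_mono) (use j t in \<open>auto intro: lvl_mono\<close>)
      then have "n'' \<le> n'" using n'' by (meson not_le)
      have "n = n''" using n n'' by (intro D_level_unique) auto
      have "K n y = K n x" using y n by (intro K_eq) auto
      then have sub: "K n' y \<subseteq> K n x" using K_mono[OF \<open>n'' \<le> n'\<close>, of y] \<open>n = n''\<close> by simp
      have "ennreal (lvl t j) * ?\<mu> (K n' y) \<le> ?\<nu> (K n' y)"
        using n' by (simp add: lev_def emeasure_lebesgue_K emeasure_wm_K)
      also have "\<dots> \<le> mass (\<lambda>z. \<bar>indicator (K n x) z * w z\<bar>) (K n' y)"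
        unfolding emeasure_wm[OF w sets_K]
        by (rule nn_integral_mono) (use sub in \<open>auto simp: indicator_def intro!: ennreal_leI\<close>)
      finally have "ennreal (lvl t j) \<le> avg (K n' y) (\<lambda>z. \<bar>indicator (K n x) z * w z\<bar>)"
        unfolding avg_def using emeasure_D_pos[of n' y]
        by (subst ennreal_le_divide_iff) (auto simp: emeasure_lebesgue_K)
      also have "\<dots> \<le> maxop (\<lambda>z. indicator (K n x) z * w z) y"
        by (rule maxop_ge_avg[OF cube_K subsetD[OF D_subset_K D_self]])
      finally show ?thesis using Fj ennreal_leI order_trans by blast
    qed
    have "emeasure (wm F) P = (\<integral>\<^sup>+y\<in>P. F y \<partial>lebesgue)" using n by (intro emeasure_wm) auto
    also have "\<dots> \<le> max_mass w (K n x)"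
      using n le D_subset_K[of n x] by (intro nn_integral_mono) (auto simp: indicator_def)
    also have "\<dots> \<le> A * ?\<nu> (K n x)" by (rule A[OF n(1)])
    finally show "emeasure (wm F) P \<le> A * ?\<nu> P" using n by (simp add: emeasure_wm_K)
  qed auto
  moreover have "emeasure (wm F) (?O k) = (\<Sum>m\<in>{k<..<N}. ?h m * ?\<mu> (?O m))"
  proof -
    have "emeasure (wm F) (?O k) = (\<integral>\<^sup>+y\<in>?O k. F y \<partial>lebesgue)"
      by (rule emeasure_wm) auto
    also have "\<dots> = (\<integral>\<^sup>+y. (\<Sum>m\<in>{k<..<N}. ?h m * indicator (?O m) y) \<partial>lebesgue)"
    proof (rule nn_integral_cong)
      fix y
      have "ennreal (F y) = (\<Sum>m\<in>{k<..<N}. ennreal (lvl t m / 2 * indicator (?O m) y))"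
        unfolding F_def using t lvl_nonneg[of t] by (intro sum_ennreal[symmetric]) auto
      also have "\<dots> = (\<Sum>m\<in>{k<..<N}. ?h m * indicator (?O m) y)"
        by (intro sum.cong) (auto simp: indicator_def)
      finally have "ennreal (F y) = (\<Sum>m\<in>{k<..<N}. ?h m * indicator (?O m) y)" .
      moreover have "(\<Sum>m\<in>{k<..<N}. ?h m * indicator (?O m) y) = 0" if "y \<notin> ?O k"
      proof (rule sum.neutral, rule ballI)
        fix m assume "m \<in> {k<..<N}"
        then have "y \<notin> ?O m" using that Om_lvl_mono[of t k m w] t by auto
        then show "?h m * indicator (?O m) y = 0" by simp
      qed
      ultimately show "ennreal (F y) * indicator (?O k) y = (\<Sum>m\<in>{k<..<N}. ?h m * indicator (?O m) y)"
        by (auto simp: indicator_def)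
    qed
    also have "\<dots> = (\<Sum>m\<in>{k<..<N}. ?h m * ?\<mu> (?O m))"
      by (subst nn_integral_sum) (auto simp: nn_integral_cmult)
    finally show ?thesis .
  qed
  ultimately have *: "(\<Sum>m\<in>{k<..<N}. ?h m * ?\<mu> (?O m)) \<le> ennreal A * ?\<nu> (?O k)"
    by simp
  have "?\<nu> (?O m) \<le> 2 ^ Suc DIM('a) * (?h m * ?\<mu> (?O m))" for m
  proof -
    have "ennreal (lvl t m) = 2 * ?h m"
      using t lvl_nonneg[of t m] by (simp flip: ennreal_mult' ennreal_numeral)
    then show ?thesis using Om_upper[OF wm_Q0_le, of m] by (simp add: mult_ac)
  qed
  then have "(\<Sum>m\<in>{k<..<N}. ?\<nu> (?O m)) \<le> (\<Sum>m\<in>{k<..<N}. 2 ^ Suc DIM('a) * (?h m * ?\<mu> (?O m)))"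
    by (rule sum_mono)
  also have "\<dots> \<le> 2 ^ Suc DIM('a) * (ennreal A * ?\<nu> (?O k))"
    unfolding sum_distrib_left[symmetric] by (rule mult_left_mono[OF *]) auto
  finally show ?thesis by (simp add: mult.assoc)
qed

end

section \<open>The non-dyadic maximal function\<close>

definition near :: "nat \<Rightarrow> 'a \<Rightarrow> 'a \<Rightarrow> bool" where
  "near n x y \<longleftrightarrow> (\<forall>i\<in>Basis. \<bar>idx n x i - idx n y i\<bar> \<le> 1)"

definition tri :: "nat \<Rightarrow> 'a \<Rightarrow> 'a set" where
  "tri n y = cbox (corner n y - (l / 2 ^ n) *\<^sub>R One) (corner n y + (2 * (l / 2 ^ n)) *\<^sub>R One)"

text \<open>Atoms are bare sets, so the tripled cube is taken over all representations;
  \<open>Tri_D\<close> shows that there is only one.\<close>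

definition Tri :: "'a set \<Rightarrow> 'a set" where
  "Tri P = (\<Union>{tri n y | n y. P = D n y})"

definition Om3 :: "('a \<Rightarrow> real) \<Rightarrow> real \<Rightarrow> 'a set" where
  "Om3 f t = (\<Union>P\<in>atoms (lev f t). Tri P)"

text \<open>Halving and rounding down keeps integers of distance at most 1 at distance at most
  1.\<close>

lemma near_mono:
  assumes "m \<le> n" "near n x y" shows "near m x y"
proof -
  have step: "near k x y" if "near (Suc k) x y" for k
    unfolding near_def
  proof
    fix i :: 'a assume "i \<in> Basis"
    then have "\<bar>idx (Suc k) x i - idx (Suc k) y i\<bar> \<le> 1" using that by (auto simp: near_def)
    then show "\<bar>idx k x i - idx k y i\<bar> \<le> 1" unfolding idx_Suc[of k] by linarith
  qed
  show ?thesis using assms by (induction n rule: dec_induct) (use step in auto)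
qed

lemma near_tri:
  assumes "near n x y" shows "x \<in> tri n y"
  unfolding tri_def mem_box
proof
  fix i :: 'a assume i: "i \<in> Basis"
  define h where "h = l / 2 ^ n"
  have h: "h > 0" using l_pos by (simp add: h_def)
  have x: "corner n x \<bullet> i \<le> x \<bullet> i" "x \<bullet> i < corner n x \<bullet> i + h"
    using D_self[of x n] i unfolding D_iff h_def by auto
  define r where "r = h * real_of_int (idx n x i - idx n y i)"
  have c: "corner n x \<bullet> i = corner n y \<bullet> i + r"
    unfolding corner_inner[OF i] h_def[symmetric] r_def by (simp add: algebra_simps)
  have "-1 \<le> idx n x i - idx n y i" "idx n x i - idx n y i \<le> 1"
    using assms i unfolding near_def by (auto simp: abs_le_iff dest!: bspec)
  then have "-1 \<le> real_of_int (idx n x i - idx n y i)" "real_of_int (idx n x i - idx n y i) \<le> 1"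
    by linarith+
  then have "h * (-1) \<le> r" "r \<le> h * 1"
    unfolding r_def using h by (intro mult_left_mono; simp)+
  then show "(corner n y - (l / 2 ^ n) *\<^sub>R One) \<bullet> i \<le> x \<bullet> i \<and> x \<bullet> i \<le> (corner n y + (2 * (l / 2 ^ n)) *\<^sub>R One) \<bullet> i"
    unfolding h_def[symmetric] using x unfolding c using i by (auto simp: inner_simps)
qed

lemma Tri_D: "Tri (D n y) = tri n y"
proof -
  have "tri m z = tri n y" if "D n y = D m z" for m z
  proof -
    have "m = n" using D_level_unique[OF that] by simp
    moreover have "corner n z = corner n y"
      using that D_self[of z m] \<open>m = n\<close> by (intro corner_eq) simp
    ultimately show ?thesis by (simp add: tri_def)
  qed
  then show ?thesis unfolding Tri_def by blast
qed

lemma emeasure_tri: "vol (tri n y) = 3 ^ DIM('a) * vol (D n y)"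
proof -
  have "vol (tri n y) = ennreal (\<Prod>i\<in>(Basis::'a set). 3 * (l / 2 ^ n))"
    unfolding tri_def using l_pos by (auto simp: emeasure_completion emeasure_lborel_cbox_eq inner_simps field_simps)
  also have "\<dots> = 3 ^ DIM('a) * vol (D n y)"
  proof -
    have "(\<Prod>i\<in>(Basis::'a set). 3 * (l / 2 ^ n)) = 3 ^ DIM('a) * (l / 2 ^ n) ^ DIM('a)"
      by (simp flip: power_mult_distrib)
    then show ?thesis
      unfolding emeasure_lebesgue_D using l_pos by (simp only:) (subst ennreal_mult', auto simp flip: ennreal_power)
  qed
  finally show ?thesis .
qed

lemma sets_Tri: "P \<in> atoms S \<Longrightarrow> Tri P \<in> sets lebesgue"
  by (auto simp: atoms_def Tri_D tri_def)

lemma sets_Om3 [measurable]: "Om3 f t \<in> sets lebesgue"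
  unfolding Om3_def by (rule sets.countable_UN''[OF countable_atoms]) (rule sets_Tri)

text \<open>The triples may overlap, so this is a union bound, written as an integral over the
  countable family of atoms.\<close>

lemma emeasure_Om3_le: "vol (Om3 f t) \<le> 3 ^ DIM('a) * vol (Om f t)"
proof -
  have "vol (Om3 f t) = (\<integral>\<^sup>+x. indicator (Om3 f t) x \<partial>lebesgue)" by simp
  also have "\<dots> \<le> (\<integral>\<^sup>+x. (\<integral>\<^sup>+P. indicator (Tri P) x \<partial>count_space (atoms (lev f t))) \<partial>lebesgue)"
  proof (rule nn_integral_mono)
    fix x :: 'a
    show "indicator (Om3 f t) x \<le> (\<integral>\<^sup>+P. indicator (Tri P) x \<partial>count_space (atoms (lev f t)))"
    proof (cases "x \<in> Om3 f t")
      case True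
      then obtain P where P: "P \<in> atoms (lev f t)" "x \<in> Tri P" by (auto simp: Om3_def)
      then show ?thesis using nn_integral_ge_point[OF P(1), of "\<lambda>P. indicator (Tri P) x"] by (simp add: True)
    qed simp
  qed
  also have "\<dots> = (\<integral>\<^sup>+P. (\<integral>\<^sup>+x. indicator (Tri P) x \<partial>lebesgue) \<partial>count_space (atoms (lev f t)))"
    by (rule nn_integral_count_space_nn_integral) (use countable_atoms sets_Tri in auto)
  also have "\<dots> = (\<integral>\<^sup>+P. 3 ^ DIM('a) * vol P \<partial>count_space (atoms (lev f t)))"
    by (rule nn_integral_cong) (auto simp: sets_Tri, auto simp: atoms_def Tri_D emeasure_tri)
  also have "\<dots> = 3 ^ DIM('a) * vol (Om f t)"
    using emeasure_stop[of lebesgue UNIV "lev f t"] by (simp add: nn_integral_cmult)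
  finally show ?thesis .
qed

lemma near_if_close:
  assumes "\<And>i. i \<in> Basis \<Longrightarrow> \<bar>(x - y) \<bullet> i\<bar> \<le> s" "s < l / 2 ^ n"
  shows "near n x y"
  unfolding near_def
proof
  fix i :: 'a assume i: "i \<in> Basis"
  have eq: "2 ^ n * ((x - a) \<bullet> i) / l - 2 ^ n * ((y - a) \<bullet> i) / l = 2 ^ n / l * ((x - y) \<bullet> i)"
    by (simp add: inner_simps right_diff_distrib diff_divide_distrib)
  have "\<bar>2 ^ n / l * ((x - y) \<bullet> i)\<bar> \<le> 2 ^ n / l * s"
    using assms(1)[OF i] l_pos by (simp add: abs_mult divide_right_mono)
  also have "\<dots> < 2 ^ n / l * (l / 2 ^ n)" using l_pos assms(2) by (intro mult_strict_left_mono) auto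
  also have "\<dots> = 1" using l_pos by simp
  finally have "\<bar>2 ^ n * ((x - a) \<bullet> i) / l - 2 ^ n * ((y - a) \<bullet> i) / l\<bar> < 1" unfolding eq .
  then show "\<bar>idx n x i - idx n y i\<bar> \<le> 1" unfolding idx_def by linarith
qed

lemma emeasure_cube: "0 \<le> s \<Longrightarrow> vol (cbox b (b + s *\<^sub>R One) :: 'a set) = ennreal (s ^ DIM('a))"
  by (auto simp: emeasure_completion emeasure_lborel_cbox_eq inner_simps)

text \<open>A cube \<open>Q\<close> around \<open>x\<close> of side \<open>s < l\<close> is compared
  with grid cubes of side between \<open>s\<close> and \<open>2 s\<close>. It meets at most
  \<open>3^d\<close> of them, and none that meets it at a point of \<open>Q0\<close> has average
  above \<open>t\<close>, since otherwise \<open>x\<close> would lie in the triple of an atom. This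
  gives \<open>3^d * 2^d = 6^d\<close>. Larger cubes are compared with \<open>Q0\<close>
  directly.\<close>

lemma maxop_le:
  assumes f[measurable]: "f \<in> borel_measurable lebesgue" and pos: "AE x in lebesgue. 0 \<le> f x"
    and t: "0 \<le> t" "emeasure (wm f) Q0 \<le> ennreal t * vol Q0"
    and x: "x \<in> Q0" "x \<notin> Om3 f t"
  shows "maxop (\<lambda>z. indicator (K 0 a) z * f z) x \<le> 6 ^ DIM('a) * ennreal t"
  unfolding maxop_def
proof (rule SUP_least)
  fix Q :: "'a set" assume "Q \<in> {Q. cube Q \<and> x \<in> Q}"
  then obtain b s where s: "0 < s" "Q = cbox b (b + s *\<^sub>R One)" and xQ: "x \<in> Q" unfolding cube_def by auto
  have [measurable]: "Q \<in> sets lebesgue" using s by simp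
  have mQ: "vol Q = ennreal (s ^ DIM('a))" using s emeasure_cube by simp
  have "mass (\<lambda>z. \<bar>indicator (K 0 a) z * f z\<bar>) Q = emeasure (wm f) (Q \<inter> Q0)"
    unfolding emeasure_wm[OF f sets.Int[OF \<open>Q \<in> sets lebesgue\<close> sets_D]]
    by (rule nn_integral_cong_AE, use pos AE_D_K[of 0 a] in eventually_elim) (auto simp: indicator_def)
  also have "\<dots> \<le> 6 ^ DIM('a) * ennreal t * vol Q"
  proof (cases "l \<le> s")
    case True
    have "emeasure (wm f) (Q \<inter> Q0) \<le> emeasure (wm f) Q0" by (rule emeasure_mono) auto
    also have "\<dots> \<le> ennreal t * vol Q0" by (rule t)
    also have "\<dots> \<le> ennreal t * vol Q"
      unfolding mQ emeasure_lebesgue_D using True l_pos by (intro mult_left_mono ennreal_leI power_mono) auto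
    also have "\<dots> \<le> 6 ^ DIM('a) * (ennreal t * vol Q)"
      using mult_right_mono[of 1 "6 ^ DIM('a)" "ennreal t * vol Q"] by (simp add: one_le_power)
    finally show ?thesis by (simp add: mult.assoc)
  next
    case False
    obtain n0 where "l / s < 2 ^ n0" using real_arch_pow[of 2 "l / s"] by auto
    then have n0: "l / 2 ^ n0 \<le> s" using s by (simp add: field_simps)
    \<comment> \<open>The predecessor \<open>n\<close> of the least generation with side at most
      \<open>s\<close> satisfies \<open>s < l / 2^n\<close> and
      \<open>l / 2^n \<le> 2 s\<close>.\<close>
    define n' where "n' = (LEAST n. l / 2 ^ n \<le> s)"
    have n': "l / 2 ^ n' \<le> s" unfolding n'_def by (rule LeastI) (rule n0)
    then have "n' \<noteq> 0" using False by (cases n') auto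
    then obtain n where n: "n' = Suc n" by (cases n') auto
    have ns: "s < l / 2 ^ n" "l / 2 ^ n \<le> 2 * s"
      using not_less_Least[of n "\<lambda>n. l / 2 ^ n \<le> s"] n' unfolding n'_def[symmetric] n by (auto simp: field_simps)
    have near: "near n x y" if "y \<in> Q" for y
    proof (rule near_if_close[OF _ ns(1)])
      fix i :: 'a assume "i \<in> Basis"
      then show "\<bar>(x - y) \<bullet> i\<bar> \<le> s"
        using xQ that s unfolding mem_box s(2) by (force simp: inner_simps)
    qed
    have notlev: "emeasure (wm f) (D n y) \<le> ennreal t * vol (D n y)" if y: "y \<in> Q" "y \<in> Q0" for y
    proof (rule ccontr)
      assume "\<not> ?thesis"
      then have lev: "lev f t (D n y)" by (simp add: lev_def)
      then have "y \<in> Om f t" using y by (auto simp: stop_def)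
      then obtain P where P: "P \<in> atoms (lev f t)" "y \<in> P" using Union_atoms by blast
      obtain m where m: "P = D m y" "\<And>k. k < m \<Longrightarrow> \<not> lev f t (D k y)" using atomsE[OF P] by metis
      \<comment> \<open>The atom over \<open>y\<close> is at least as large as the
        generation-\<open>n\<close> cube, and adjacency at generation \<open>n\<close> persists for
        ancestors; so \<open>x\<close> falls into its triple, contrary to the choice of
        \<open>x\<close>.\<close>
      have "m \<le> n" using lev m by (meson not_le)
      then have "x \<in> tri m y" using near_mono near near_tri y by blast
      then show False using x(2) P(1) unfolding Om3_def m(1) by (auto simp: Tri_D)
    qed
    \<comment> \<open>Index vectors adjacent to that of \<open>x\<close>: three choices per
      coordinate.\<close>
    let ?H = "PiE (Basis::'a set) (\<lambda>i. {idx n x i - 1..idx n x i + 1})"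
    have sub: "D n ` (Q \<inter> Q0) \<subseteq> (\<lambda>h. {y. \<forall>i\<in>Basis. idx n y i = h i}) ` ?H"
    proof
      fix P assume "P \<in> D n ` (Q \<inter> Q0)"
      then obtain y where y: "P = D n y" "y \<in> Q" by auto
      have "P = (\<lambda>h. {y. \<forall>i\<in>Basis. idx n y i = h i}) (restrict (idx n y) Basis)" by (auto simp: y D_def)
      moreover have "restrict (idx n y) Basis \<in> ?H"
        using near[OF y(2)] by (force simp: near_def abs_le_iff)
      ultimately show "P \<in> (\<lambda>h. {y. \<forall>i\<in>Basis. idx n y i = h i}) ` ?H" by (rule image_eqI)
    qed
    have finH: "finite ?H" by (intro finite_PiE) auto
    have cardH: "card ?H = 3 ^ DIM('a)" by (simp add: card_PiE)
    have fin: "finite (D n ` (Q \<inter> Q0))" using sub finH by (meson finite_imageI finite_subset)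
    have card: "card (D n ` (Q \<inter> Q0)) \<le> 3 ^ DIM('a)"
      using card_mono[OF finite_imageI[OF finH] sub] card_image_le[OF finH, of "\<lambda>h. {y. \<forall>i\<in>Basis. idx n y i = h i}"] cardH by linarith
    have "emeasure (wm f) (Q \<inter> Q0) \<le> emeasure (wm f) (\<Union>P\<in>D n ` (Q \<inter> Q0). P)"
      using fin by (intro emeasure_mono) auto
    also have "\<dots> \<le> (\<Sum>P\<in>D n ` (Q \<inter> Q0). emeasure (wm f) P)"
      by (rule emeasure_subadditive_finite[OF fin]) auto
    also have "\<dots> \<le> (\<Sum>P\<in>D n ` (Q \<inter> Q0). ennreal t * ennreal ((l / 2 ^ n) ^ DIM('a)))"
      by (rule sum_mono) (use notlev in \<open>auto simp: emeasure_lebesgue_D\<close>)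
    also have "\<dots> \<le> 3 ^ DIM('a) * (ennreal t * ennreal ((l / 2 ^ n) ^ DIM('a)))"
    proof -
      have "of_nat (card (D n ` (Q \<inter> Q0))) \<le> (of_nat (3 ^ DIM('a)) :: ennreal)"
        using card by (rule of_nat_mono)
      then show ?thesis by (simp add: mult_right_mono)
    qed
    also have "\<dots> \<le> 3 ^ DIM('a) * (ennreal t * ennreal ((2 * s) ^ DIM('a)))"
      using ns l_pos by (intro mult_left_mono ennreal_leI power_mono) auto
    also have "\<dots> = 6 ^ DIM('a) * ennreal t * vol Q"
    proof -
      have "ennreal ((2 * s) ^ DIM('a)) = 2 ^ DIM('a) * ennreal (s ^ DIM('a))"
        using s by (simp add: power_mult_distrib ennreal_mult' flip: ennreal_power)
      moreover have "(6::ennreal) ^ DIM('a) = 3 ^ DIM('a) * 2 ^ DIM('a)"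
        by (simp flip: power_mult_distrib)
      ultimately show ?thesis unfolding mQ by (simp add: mult_ac)
    qed
    finally show ?thesis .
  qed
  finally show "avg Q (\<lambda>y. \<bar>indicator (K 0 a) y * f y\<bar>) \<le> 6 ^ DIM('a) * ennreal t"
    unfolding avg_def mQ using s by (intro divide_le_posI_ennreal) (auto simp: mult_ac)
qed

end

section \<open>Reverse Hoelder inequalities and the Fujii-Wilson constant\<close>

text \<open>Expanding \<open>\<rho>^m\<close> as \<open>1 + (\<rho> - 1)\<close> times a geometric
  sum and exchanging the summations turns the weighted sum \<open>T\<close> into tail sums, hence
  into a term at most \<open>(\<rho> - 1) B T\<close>. This is at most half of \<open>T\<close> and
  can be absorbed, since \<open>T\<close> is a finite sum.\<close>

lemma sum_geometric_weights:
  fixes x :: "nat \<Rightarrow> real" and B \<rho> :: real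
  assumes x: "\<And>m. 0 \<le> x m" and \<rho>: "1 \<le> \<rho>" "(\<rho> - 1) * B \<le> 1 / 2"
    and B: "\<And>k N. (\<Sum>m\<in>{k<..<N}. x m) \<le> B * x k"
  shows "(\<Sum>m<N. \<rho> ^ m * x m) \<le> 2 * (1 + B) * x 0"
proof -
  define T where "T = (\<Sum>m<N. \<rho> ^ m * x m)"
  have pow: "\<rho> ^ m = 1 + (\<rho> - 1) * (\<Sum>k<m. \<rho> ^ k)" for m
    by (simp flip: power_diff_1_eq)
  have "T = (\<Sum>m<N. x m) + (\<rho> - 1) * (\<Sum>m<N. \<Sum>k<m. \<rho> ^ k * x m)"
    unfolding T_def by (subst pow) (simp add: algebra_simps sum.distrib sum_distrib_left sum_subtractf)
  also have "(\<Sum>m<N. \<Sum>k<m. \<rho> ^ k * x m) = (\<Sum>m<N. \<Sum>k<N. if k < m then \<rho> ^ k * x m else 0)"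
    by (intro sum.cong refl sum.mono_neutral_cong_left) auto
  also have "\<dots> = (\<Sum>k<N. \<Sum>m<N. if k < m then \<rho> ^ k * x m else 0)"
    by (rule sum.swap)
  also have "\<dots> = (\<Sum>k<N. \<Sum>m\<in>{k<..<N}. \<rho> ^ k * x m)"
    by (intro sum.cong refl sum.mono_neutral_cong_right) auto
  also have "\<dots> = (\<Sum>k<N. \<rho> ^ k * (\<Sum>m\<in>{k<..<N}. x m))" by (simp add: sum_distrib_left)
  also have "\<dots> \<le> (\<Sum>k<N. \<rho> ^ k * (B * x k))"
    using \<rho> by (intro sum_mono mult_left_mono B) auto
  also have "\<dots> = B * T" by (simp add: T_def sum_distrib_left mult_ac)
  finally have "T \<le> (\<Sum>m<N. x m) + (\<rho> - 1) * B * T" using \<rho> by (simp add: mult_left_mono mult.assoc)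
  moreover have "(\<rho> - 1) * B * T \<le> 1 / 2 * T"
    using \<rho> x by (intro mult_right_mono) (auto simp: T_def intro!: sum_nonneg)
  moreover have "(\<Sum>m<N. x m) \<le> (1 + B) * x 0"
  proof (cases N)
    case 0
    have "0 \<le> B * x 0" using B[of 0 0] by simp
    then show ?thesis using x[of 0] 0 by (simp add: algebra_simps)
  next
    case (Suc n)
    have "{..<N} = insert 0 {0<..<N}" using Suc by auto
    then show ?thesis using B[of 0 N] by (simp add: algebra_simps)
  qed
  ultimately show ?thesis unfolding T_def by linarith
qed

section \<open>Integrals of the maximal function from the size of level sets\<close>

context dyadic_grid
begin

context
  fixes w :: "'a \<Rightarrow> real" and t :: real
  assumes w[measurable]: "w \<in> borel_measurable lebesgue" and t: "0 < t"
    and pos: "AE x in lebesgue. 0 < w x"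
    and wt: "ennreal t * vol Q0 = emeasure (wm w) Q0"
begin

lemmas wt_facts = w t wt

text \<open>The maximal function is dominated by a step function along the tripled level sets. The
  constant collects \<open>6^d\<close> from \<open>maxop_le\<close>, \<open>3^d\<close> from the
  triples and \<open>2^(d+1)\<close> from the ratio of consecutive heights.\<close>

lemma maxop_integral_le:
  fixes C :: real
  assumes C: "0 \<le> C" "\<And>N. (\<Sum>m<N. ennreal (lvl t m) * vol (Om w (lvl t m))) \<le> ennreal C * emeasure (wm w) Q0"
  shows "max_mass w (K 0 a)
     \<le> 2 * 36 ^ DIM('a) * (1 + ennreal C) * emeasure (wm w) (K 0 a)"
proof -
  let ?d = "DIM('a)" and ?\<mu> = vol and ?\<nu> = "emeasure (wm w)"
  let ?M = "maxop (\<lambda>z. indicator (K 0 a) z * w z)"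
  \<comment> \<open>If \<open>M\<close> is the first index whose tripled set misses
    \<open>x\<close>, the value is controlled by \<open>lvl t M\<close>. This is the term with index
    \<open>M - 1\<close> of the series, or the leading term when \<open>M = 0\<close>.\<close>
  define G where "G x = ennreal t * indicator Q0 x + (\<Sum>m. ennreal (lvl t (Suc m)) * indicator (Om3 w (lvl t m)) x)" for x
  have single: "h m \<le> (\<Sum>m. h m)" for h :: "nat \<Rightarrow> ennreal" and m
    using sum_le_suminf[of h "{m}"] by simp
  have bound: "?M x \<le> 6 ^ ?d * ennreal (lvl t M)" if "x \<in> Q0" "x \<notin> Om3 w (lvl t M)" for x M
    by (rule maxop_le[OF w _ _ wm_Q0_le[OF wt_facts] that])
      (use pos t in \<open>auto simp: lvl_nonneg elim: eventually_mono\<close>)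
  have le: "?M x \<le> 6 ^ ?d * G x" if x: "x \<in> Q0" for x
  proof (cases "\<exists>M. x \<notin> Om3 w (lvl t M)")
    case True
    define M where "M = (LEAST M. x \<notin> Om3 w (lvl t M))"
    have M: "x \<notin> Om3 w (lvl t M)" unfolding M_def by (rule LeastI_ex[OF True])
    have "ennreal (lvl t M) \<le> G x"
    proof (cases M)
      case 0
      then show ?thesis using x by (simp add: G_def)
    next
      case (Suc m)
      then have "x \<in> Om3 w (lvl t m)" using not_less_Least[of m "\<lambda>M. x \<notin> Om3 w (lvl t M)"] unfolding M_def by auto
      then have "ennreal (lvl t M) = ennreal (lvl t (Suc m)) * indicator (Om3 w (lvl t m)) x" by (simp add: Suc)
      also have "\<dots> \<le> (\<Sum>m. ennreal (lvl t (Suc m)) * indicator (Om3 w (lvl t m)) x)"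
        by (rule single)
      also have "\<dots> \<le> G x" unfolding G_def by (rule add_increasing) auto
      finally show ?thesis .
    qed
    then show ?thesis using bound[OF x M] by (meson mult_left_mono order_trans zero_le)
  next
    case False
    \<comment> \<open>A point in all tripled sets: each term of the series is at least
      \<open>t\<close>, so \<open>G x\<close> is infinite and the bound is trivial.\<close>
    have "of_nat N * ennreal t \<le> G x" for N
    proof -
      have "of_nat N * ennreal t = (\<Sum>m<N. ennreal t)" by simp
      also have "\<dots> \<le> (\<Sum>m<N. ennreal (lvl t (Suc m)) * indicator (Om3 w (lvl t m)) x)"
        using False lvl_mono[of t 0] t by (intro sum_mono) (auto intro!: ennreal_leI)
      also have "\<dots> \<le> (\<Sum>m. ennreal (lvl t (Suc m)) * indicator (Om3 w (lvl t m)) x)"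
        by (rule sum_le_suminf) auto
      also have "\<dots> \<le> G x" unfolding G_def by (rule add_increasing) auto
      finally show ?thesis .
    qed
    have "G x = top"
    proof (rule ccontr)
      assume "G x \<noteq> top"
      then obtain g where g: "G x = ennreal g" "0 \<le> g" by (cases "G x") auto
      obtain N where "g / t < of_nat N" using reals_Archimedean2 by blast
      then have "g < real N * t" using t by (simp add: field_simps)
      moreover have "ennreal (real N * t) \<le> ennreal g"
        using \<open>of_nat N * ennreal t \<le> G x\<close> t unfolding g by (simp add: ennreal_mult' ennreal_of_nat_eq_real_of_nat)
      ultimately show False using g t by (simp add: ennreal_le_iff)
    qed
    then show ?thesis by (simp add: ennreal_mult_top)
  qed
  have "(\<integral>\<^sup>+y\<in>K 0 a. ?M y \<partial>lebesgue) \<le> (\<integral>\<^sup>+y. 6 ^ ?d * G y \<partial>lebesgue)"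
    by (rule nn_integral_mono_AE, use AE_D_K[of 0 a] in eventually_elim) (use le in \<open>auto simp: indicator_def\<close>)
  also have "\<dots> = 6 ^ ?d * (\<integral>\<^sup>+y. G y \<partial>lebesgue)" unfolding G_def by (rule nn_integral_cmult) auto
  also have "(\<integral>\<^sup>+y. G y \<partial>lebesgue) = ennreal t * ?\<mu> Q0 + (\<Sum>m. ennreal (lvl t (Suc m)) * ?\<mu> (Om3 w (lvl t m)))"
    unfolding G_def by (subst nn_integral_add) (auto simp: nn_integral_cmult nn_integral_suminf)
  also have "\<dots> \<le> ?\<nu> Q0 + 3 ^ ?d * 2 ^ Suc ?d * (ennreal C * ?\<nu> Q0)"
  proof (rule add_mono)
    show "(\<Sum>m. ennreal (lvl t (Suc m)) * ?\<mu> (Om3 w (lvl t m))) \<le> 3 ^ ?d * 2 ^ Suc ?d * (ennreal C * ?\<nu> Q0)"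
    proof (rule suminf_le_const[OF summableI])
      fix N
      have "(\<Sum>m<N. ennreal (lvl t (Suc m)) * ?\<mu> (Om3 w (lvl t m)))
         \<le> (\<Sum>m<N. 3 ^ ?d * 2 ^ Suc ?d * (ennreal (lvl t m) * ?\<mu> (Om w (lvl t m))))"
      proof (rule sum_mono)
        fix m
        have "ennreal (lvl t (Suc m)) = 2 ^ Suc ?d * ennreal (lvl t m)"
          using t lvl_nonneg[of t m] unfolding lvl_Suc by (subst ennreal_mult', simp) (metis ennreal_numeral ennreal_power zero_le_numeral)
        then show "ennreal (lvl t (Suc m)) * ?\<mu> (Om3 w (lvl t m)) \<le> 3 ^ ?d * 2 ^ Suc ?d * (ennreal (lvl t m) * ?\<mu> (Om w (lvl t m)))"
          using mult_left_mono[OF emeasure_Om3_le[of w "lvl t m"], of "2 ^ Suc ?d * ennreal (lvl t m)"]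
          by (simp add: mult_ac)
      qed
      also have "\<dots> \<le> 3 ^ ?d * 2 ^ Suc ?d * (ennreal C * ?\<nu> Q0)"
        unfolding sum_distrib_left[symmetric] by (intro mult_left_mono C) auto
      finally show "(\<Sum>m<N. ennreal (lvl t (Suc m)) * ?\<mu> (Om3 w (lvl t m))) \<le> 3 ^ ?d * 2 ^ Suc ?d * (ennreal C * ?\<nu> Q0)" .
    qed
  qed (use wt in simp)
  also have "\<dots> \<le> 2 * 6 ^ ?d * ?\<nu> Q0 + 2 * 6 ^ ?d * (ennreal C * ?\<nu> Q0)"
  proof (rule add_mono)
    have "1 * ?\<nu> Q0 \<le> 2 * 6 ^ ?d * ?\<nu> Q0"
      using mult_mono[of "1::ennreal" 2 1 "6 ^ ?d"] by (intro mult_right_mono) (auto simp: one_le_power)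
    then show "?\<nu> Q0 \<le> 2 * 6 ^ ?d * ?\<nu> Q0" by simp
    have "(3::ennreal) ^ ?d * 2 ^ Suc ?d = 2 * 6 ^ ?d" by (simp add: mult_ac flip: power_mult_distrib)
    then show "3 ^ ?d * 2 ^ Suc ?d * (ennreal C * ?\<nu> Q0) \<le> 2 * 6 ^ ?d * (ennreal C * ?\<nu> Q0)" by simp
  qed
  also have "6 ^ ?d * (2 * 6 ^ ?d * ?\<nu> Q0 + 2 * 6 ^ ?d * (ennreal C * ?\<nu> Q0)) = 2 * 36 ^ ?d * (1 + ennreal C) * ?\<nu> Q0"
  proof -
    have "(36::ennreal) ^ ?d = 6 ^ ?d * 6 ^ ?d" by (simp flip: power_mult_distrib)
    then show ?thesis by (simp add: algebra_simps)
  qed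
  finally show ?thesis by (simp add: emeasure_wm_K mult_left_mono)
qed

lemma maxop_integral_le_A2:
  fixes A :: real
  assumes "0 \<le> A" "\<And>n x. x \<in> Q0 \<Longrightarrow> emeasure (wm w) (D n x) * emeasure (wm (dual_weight w)) (D n x) \<le> A * (vol (D n x))\<^sup>2"
  shows "max_mass w (K 0 a)
     \<le> 2 * 36 ^ DIM('a) * (1 + ennreal (4 * A)) * emeasure (wm w) (K 0 a)"
proof (rule maxop_integral_le)
  fix N
  have "(\<Sum>m<N. ennreal (lvl t m) * vol (Om w (lvl t m))) \<le> (\<Sum>m<N. emeasure (wm w) (Om w (lvl t m)))"
    by (intro sum_mono Om_lower)
  also have "\<dots> \<le> 4 * ennreal A * emeasure (wm w) Q0" by (rule A2_sum[OF wt_facts pos assms(2)])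
  finally show "(\<Sum>m<N. ennreal (lvl t m) * vol (Om w (lvl t m))) \<le> ennreal (4 * A) * emeasure (wm w) Q0"
    using assms(1) by (simp add: ennreal_mult')
qed (use assms in auto)

text \<open>A higher integrability bound makes height times volume of the level sets decay
  geometrically with ratio \<open>2 powr (1 - s)\<close>; summing the geometric series produces the
  factor \<open>1 / (s - 1)\<close>.\<close>

lemma maxop_integral_le_RH:
  fixes s R :: real
  assumes s: "1 < s" "s \<le> 2" and R: "0 \<le> R"
    "mass (\<lambda>x. w x powr s) Q0 \<le> ennreal (R * t powr s) * vol Q0"
  shows "max_mass w (K 0 a)
     \<le> 2 * 36 ^ DIM('a) * (1 + ennreal (12 * R / (s - 1))) * emeasure (wm w) (K 0 a)"
proof (rule maxop_integral_le)
  let ?\<mu> = vol and ?\<nu> = "emeasure (wm w)"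
  let ?I = "emeasure (wm (\<lambda>x. w x powr s))"
  have ws[measurable]: "(\<lambda>x. w x powr s) \<in> borel_measurable lebesgue" by measurable
  define q where "q = 2 powr (1 - s)"
  have q: "0 < q" "q < 1" using s by (auto simp: q_def powr_less_one)
  have step: "ennreal (lvl t m) * ?\<mu> (Om w (lvl t m)) \<le> ennreal (4 * R * q ^ m) * ?\<nu> Q0" for m
  proof -
    let ?L = "lvl t m" let ?O = "Om w ?L"
    have L: "0 < ?L" using t by (rule lvl_pos)
    have fin: "?\<mu> ?O < \<infinity>" using emeasure_mono[OF stop_subset[of "lev w ?L"], of lebesgue] emeasure_D_pos(2)[of 0 a]
      by (auto intro: le_less_trans)
    \<comment> \<open>Where \<open>u\<close> exceeds half the height, a power \<open>s\<close> gains
      a factor \<open>(2 u / ?L) powr (s - 1)\<close>. The other part contributes half of the lower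
      bound for the mass of the level set and is absorbed.\<close>
    have pw: "u \<le> ?L / 2 + (2 / ?L) powr (s - 1) * u powr s" if "0 \<le> u" for u
    proof (cases "u \<le> ?L / 2")
      case False
      then have "0 < u" using L by auto
      have "1 \<le> (2 / ?L * u) powr (s - 1)" using False L s by (intro ge_one_powr_ge_zero) (auto simp: field_simps)
      then have "u * 1 \<le> u * (2 / ?L * u) powr (s - 1)" using \<open>0 < u\<close> by (intro mult_left_mono) auto
      also have "\<dots> = (2 / ?L) powr (s - 1) * u powr s"
        using \<open>0 < u\<close> L by (subst powr_mult) (auto simp: powr_diff)
      finally show ?thesis using L by simp
    qed (auto intro: order_trans[of _ "?L / 2"])
    have "?L * ?\<mu> ?O \<le> ?\<nu> ?O" by (rule Om_lower)
    also have "\<dots> = mass w ?O" by (rule emeasure_wm) auto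
    also have "\<dots> \<le> (\<integral>\<^sup>+x. ennreal (?L / 2) * indicator ?O x + ennreal ((2 / ?L) powr (s - 1)) * (ennreal (w x powr s) * indicator ?O x) \<partial>lebesgue)"
      by (rule nn_integral_mono_AE, use pos in eventually_elim)
        (use L pw in \<open>auto simp: indicator_def ennreal_mult'[symmetric] ennreal_plus[symmetric] intro!: ennreal_leI simp del: ennreal_plus\<close>)
    also have "\<dots> = ennreal (?L / 2) * ?\<mu> ?O + ennreal ((2 / ?L) powr (s - 1)) * ?I ?O"
      by (subst nn_integral_add) (auto simp: nn_integral_cmult emeasure_wm)
    finally have "ennreal (?L / 2) * ?\<mu> ?O + ennreal (?L / 2) * ?\<mu> ?O \<le> ennreal (?L / 2) * ?\<mu> ?O + ennreal ((2 / ?L) powr (s - 1)) * ?I ?O"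
      using L by (simp flip: distrib_right ennreal_plus)
    then have "ennreal (?L / 2) * ?\<mu> ?O \<le> ennreal ((2 / ?L) powr (s - 1)) * ?I ?O"
      using fin by (auto simp: ennreal_add_left_cancel_le ennreal_mult_eq_top_iff)
    also have "\<dots> \<le> ennreal ((2 / ?L) powr (s - 1)) * ?I Q0"
      by (intro mult_left_mono emeasure_mono stop_subset) auto
    also have "\<dots> \<le> ennreal ((2 / ?L) powr (s - 1)) * (ennreal (R * t powr s) * ?\<mu> Q0)"
      using R(2) by (intro mult_left_mono) (auto simp: emeasure_wm)
    finally have "2 * (ennreal (?L / 2) * ?\<mu> ?O) \<le> 2 * (ennreal ((2 / ?L) powr (s - 1)) * (ennreal (R * t powr s) * ?\<mu> Q0))"
      by (rule mult_left_mono) auto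
    also have "2 * (ennreal (?L / 2) * ?\<mu> ?O) = ennreal ?L * ?\<mu> ?O"
      using L by (simp add: mult.assoc[symmetric] flip: ennreal_mult' ennreal_numeral)
    also have "2 * (ennreal ((2 / ?L) powr (s - 1)) * (ennreal (R * t powr s) * ?\<mu> Q0)) = ennreal (2 * ((2 / ?L) powr (s - 1) * (R * t powr s))) * ?\<mu> Q0"
      using R by (simp add: ennreal_mult' mult.assoc)
    also have "2 * ((2 / ?L) powr (s - 1) * (R * t powr s)) \<le> 4 * R * q ^ m * t"
    proof -
      have *: "((2::real) ^ Suc DIM('a)) ^ m = (2 ^ Suc DIM('a)) powr m" by (simp add: powr_realpow)
      have "(2 / ?L) powr (s - 1) = 2 powr (s - 1) * (1 / (2 ^ Suc DIM('a)) ^ m) powr (s - 1) * (1 / t) powr (s - 1)"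
        unfolding lvl_def using t by (subst powr_mult[symmetric], simp, simp, subst powr_mult[symmetric]) auto
      \<comment> \<open>Replacing the true ratio \<open>2^(d+1)\<close> of heights by 2 makes
        \<open>q\<close> independent of the dimension.\<close>
      also have "(1 / ((2::real) ^ Suc DIM('a)) ^ m) powr (s - 1) \<le> (1 / 2 ^ m) powr (s - 1)"
      proof -
        have "(2::real) ^ m \<le> (2 ^ Suc DIM('a)) ^ m" by (intro power_mono) auto
        then show ?thesis using s by (intro powr_mono2) (auto simp: field_simps)
      qed
      also have "(1 / (2::real) ^ m) powr (s - 1) = q ^ m"
        by (simp add: q_def powr_divide powr_powr powr_realpow[symmetric] powr_minus_divide[symmetric] algebra_simps powr_power)
      also have "2 powr (s - 1) \<le> (2::real) powr 1" using s by (intro powr_mono) auto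
      also have "(1 / t) powr (s - 1) = t * t powr (- s)"
        using t by (simp add: powr_divide powr_diff powr_minus field_simps)
      finally have "(2 / ?L) powr (s - 1) \<le> 2 * q ^ m * (t * t powr (- s))"
        using t q by (simp add: mult_right_mono mult_left_mono)
      then have "2 * ((2 / ?L) powr (s - 1) * (R * t powr s)) \<le> 2 * ((2 * q ^ m * (t * t powr (- s))) * (R * t powr s))"
        using R by (intro mult_left_mono mult_right_mono) auto
      also have "\<dots> = 4 * R * q ^ m * t"
        using t by (simp add: powr_minus field_simps)
      finally show ?thesis .
    qed
    finally have "ennreal ?L * ?\<mu> ?O \<le> ennreal (4 * R * q ^ m * t) * ?\<mu> Q0"
      by (meson ennreal_leI mult_right_mono order_trans zero_le)
    then show ?thesis using R q t unfolding wt[symmetric] by (simp add: ennreal_mult' mult_ac)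
  qed
  fix N
  have "(\<Sum>m<N. ennreal (lvl t m) * ?\<mu> (Om w (lvl t m))) \<le> (\<Sum>m<N. ennreal (4 * R * q ^ m) * ?\<nu> Q0)"
    by (rule sum_mono) (rule step)
  also have "\<dots> = ennreal (\<Sum>m<N. 4 * R * q ^ m) * ?\<nu> Q0"
    unfolding sum_distrib_right[symmetric] using R q by (subst sum_ennreal) auto
  also have "\<dots> \<le> ennreal (12 * R / (s - 1)) * ?\<nu> Q0"
  proof (intro mult_right_mono ennreal_leI)
    have "(\<Sum>m<N. q ^ m) \<le> 1 / (1 - q)" using q by (simp add: sum_gp_strict divide_right_mono)
    also have "\<dots> \<le> 3 / (s - 1)"
    proof -
      \<comment> \<open>Since \<open>1 / q \<ge> 1 + (s - 1) / 2\<close>, the quantity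
        \<open>1 - q\<close> is at least \<open>q (s - 1) / 2\<close>; by \<open>s \<le> 2\<close>
        it is also at least \<open>(1 - q) (s - 1)\<close>. Twice the first plus the second gives
        \<open>s - 1 \<le> 3 (1 - q)\<close>.\<close>
      have "1 / 2 \<le> ln (2::real)" using ln_2_less_1 ln2_ge_two_thirds by simp
      then have "1 + (s - 1) / 2 \<le> 1 + (s - 1) * ln 2" using s mult_left_mono[of "1 / 2" "ln 2" "s - 1"] by simp
      also have "\<dots> \<le> exp ((s - 1) * ln 2)" by (rule exp_ge_add_one_self)
      also have "\<dots> = 1 / q" by (simp add: q_def powr_def exp_minus[symmetric] algebra_simps flip: exp_diff inverse_eq_divide)
      finally have le: "q * (1 + (s - 1) / 2) \<le> 1" using q by (simp add: field_simps)
      define y where "y = q * (s - 1)"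
      have "q + y / 2 \<le> 1" using le by (simp add: y_def distrib_left)
      moreover have "(1 - q) * (s - 1) \<le> (1 - q) * 1" using q s by (intro mult_left_mono) auto
      then have "(s - 1) - y \<le> 1 - q" by (simp add: y_def left_diff_distrib)
      ultimately have "s - 1 \<le> 3 * (1 - q)" by (simp add: algebra_simps)
      then show ?thesis using q s by (simp add: field_simps)
    qed
    finally show "(\<Sum>m<N. 4 * R * q ^ m) \<le> 12 * R / (s - 1)"
      unfolding sum_distrib_left[symmetric] using mult_left_mono[of "sum ((^) q) {..<N}" "3 / (s - 1)" "4 * R"] R by simp
  qed auto
  finally show "(\<Sum>m<N. ennreal (lvl t m) * ?\<mu> (Om w (lvl t m))) \<le> ennreal (12 * R / (s - 1)) * ?\<nu> Q0" .
qed (use R s in auto)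

end

section \<open>Layer-cake sums over level sets and the sharp reverse Hoelder inequality\<close>

lemma AE_layer:
  fixes f :: "'a \<Rightarrow> real" and L :: "nat \<Rightarrow> real" and \<psi> :: "real \<Rightarrow> real"
  assumes f: "f \<in> borel_measurable lebesgue" "AE x in lebesgue. 0 \<le> f x"
    and L: "mono L" "\<And>u. \<exists>m. u \<le> L m" "0 \<le> L 0"
    and \<psi>: "\<And>u v. 0 \<le> u \<Longrightarrow> u \<le> v \<Longrightarrow> \<psi> u \<le> \<psi> v" "0 \<le> \<psi> 0"
  shows "AE x in lebesgue. x \<in> Q0 \<longrightarrow> ennreal (\<psi> (f x)) \<le> ennreal (\<psi> (L 0)) +
     (\<Sum>m. ennreal (\<psi> (L (Suc m)) - \<psi> (L m)) * indicator (Om f (L m)) x)"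
proof -
  have L0: "0 \<le> L m" for m using monoD[OF L(1), of 0 m] L(3) by simp
  have "AE x in lebesgue. \<forall>m. x \<in> Q0 \<longrightarrow> x \<notin> Om f (L m) \<longrightarrow> f x \<le> L m"
    unfolding AE_all_countable using AE_le_off_Om[OF f(1) L0] by blast
  then show ?thesis using f(2)
  proof (eventually_elim, intro impI)
    fix x assume x: "\<forall>m. x \<in> Q0 \<longrightarrow> x \<notin> Om f (L m) \<longrightarrow> f x \<le> L m" "0 \<le> f x" "x \<in> Q0"
    \<comment> \<open>The alternative \<open>f x \<le> L m\<close> guarantees that the index exists
      even at a point lying in all level sets; below it \<open>x\<close> is in every level set, so
      every increment up to \<open>M\<close> is counted.\<close>
    define M where "M = (LEAST m. x \<notin> Om f (L m) \<or> f x \<le> L m)"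
    have "x \<notin> Om f (L M) \<or> f x \<le> L M"
      unfolding M_def by (rule LeastI_ex) (use L(2) in blast)
    then have fM: "f x \<le> L M" using x by blast
    have in_Om: "x \<in> Om f (L m)" if "m < M" for m using not_less_Least[OF that[unfolded M_def]] by blast
    have inc: "\<psi> (L m) \<le> \<psi> (L (Suc m))" for m using L0 L(1) by (intro \<psi>) (auto dest: incseq_SucD)
    have pos: "0 \<le> \<psi> (L m)" for m using \<psi>(1)[of 0 "L m"] \<psi>(2) L0[of m] by simp
    have "\<psi> (f x) \<le> \<psi> (L M)" using x fM by (intro \<psi>)
    also have "\<psi> (L M) = \<psi> (L 0) + (\<Sum>m<M. \<psi> (L (Suc m)) - \<psi> (L m))"
      using sum_lessThan_telescope[of "\<lambda>m. \<psi> (L m)" M] by simp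
    finally have "ennreal (\<psi> (f x)) \<le> ennreal (\<psi> (L 0) + (\<Sum>m<M. \<psi> (L (Suc m)) - \<psi> (L m)))"
      by (rule ennreal_leI)
    also have "\<dots> = ennreal (\<psi> (L 0)) + ennreal (\<Sum>m<M. \<psi> (L (Suc m)) - \<psi> (L m))"
      by (rule ennreal_plus) (use pos inc in \<open>auto intro!: sum_nonneg\<close>)
    also have "ennreal (\<Sum>m<M. \<psi> (L (Suc m)) - \<psi> (L m)) = (\<Sum>m<M. ennreal (\<psi> (L (Suc m)) - \<psi> (L m)))"
      by (rule sum_ennreal[symmetric]) (use inc in auto)
    also have "\<dots> = (\<Sum>m<M. ennreal (\<psi> (L (Suc m)) - \<psi> (L m)) * indicator (Om f (L m)) x)"
      by (rule sum.cong) (use in_Om in auto)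
    also have "\<dots> \<le> (\<Sum>m. ennreal (\<psi> (L (Suc m)) - \<psi> (L m)) * indicator (Om f (L m)) x)"
      by (rule sum_le_suminf) auto
    finally show "ennreal (\<psi> (f x)) \<le> ennreal (\<psi> (L 0)) +
     (\<Sum>m. ennreal (\<psi> (L (Suc m)) - \<psi> (L m)) * indicator (Om f (L m)) x)" by simp
  qed
qed

text \<open>Used with \<open>f = g = w\<close> and a power for the reverse Hoelder inequality, and
  with \<open>g = 1\<close> and an exponential for John-Nirenberg.\<close>

lemma layer_integral_le:
  fixes f g :: "'a \<Rightarrow> real" and L :: "nat \<Rightarrow> real" and \<psi> :: "real \<Rightarrow> real"
  assumes f: "f \<in> borel_measurable lebesgue" "AE x in lebesgue. 0 \<le> f x"
    and g[measurable]: "g \<in> borel_measurable lebesgue"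
    and L: "mono L" "\<And>u. \<exists>m. u \<le> L m" "0 \<le> L 0"
    and \<psi>: "\<And>u v. 0 \<le> u \<Longrightarrow> u \<le> v \<Longrightarrow> \<psi> u \<le> \<psi> v" "0 \<le> \<psi> 0"
  shows "(\<integral>\<^sup>+x\<in>Q0. ennreal (\<psi> (f x)) * ennreal (g x) \<partial>lebesgue) \<le>
     ennreal (\<psi> (L 0)) * emeasure (wm g) Q0 +
     (\<Sum>m. ennreal (\<psi> (L (Suc m)) - \<psi> (L m)) * emeasure (wm g) (Om f (L m)))"
proof -
  let ?w = "\<lambda>m. ennreal (\<psi> (L (Suc m)) - \<psi> (L m))" and ?base = "ennreal (\<psi> (L 0))" and ?g = "\<lambda>x. ennreal (\<psi> (f x))"
  have lay: "AE x in lebesgue. x \<in> Q0 \<longrightarrow> ?g x \<le> ?base +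
     (\<Sum>m. ?w m * indicator (Om f (L m)) x)"
    by (rule AE_layer[where \<psi> = \<psi>, OF f L]) (use \<psi> in auto)
  have "(\<integral>\<^sup>+x\<in>Q0. ?g x * ennreal (g x) \<partial>lebesgue) \<le>
    (\<integral>\<^sup>+x. (?base * (ennreal (g x) * indicator Q0 x) +
      (\<Sum>m. ?w m * (ennreal (g x) * indicator (Om f (L m)) x))) \<partial>lebesgue)"
  proof (rule nn_integral_mono_AE, use lay in eventually_elim)
    fix x
    assume *: "x \<in> Q0 \<longrightarrow> ?g x \<le> ?base +
     (\<Sum>m. ?w m * indicator (Om f (L m)) x)"
    show "?g x * ennreal (g x) * indicator Q0 x \<le> ?base * (ennreal (g x) * indicator Q0 x) +
      (\<Sum>m. ?w m * (ennreal (g x) * indicator (Om f (L m)) x))"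
    proof (cases "x \<in> Q0")
      case True
      have "ennreal (g x) * ?g x \<le> ennreal (g x) * (?base +
     (\<Sum>m. ?w m * indicator (Om f (L m)) x))"
        using * True by (intro mult_left_mono) auto
      then show ?thesis using True by (simp add: distrib_left mult_ac flip: ennreal_suminf_cmult)
    qed simp
  qed
  also have "\<dots> = ?base * emeasure (wm g) Q0 +
     (\<Sum>m. ?w m * emeasure (wm g) (Om f (L m)))"
    by (subst nn_integral_add) (auto simp: nn_integral_cmult nn_integral_suminf emeasure_wm)
  finally show ?thesis .
qed

text \<open>Integrating \<open>w powr \<delta>\<close> against \<open>w\<close> by layers gives the
  level masses weighted by powers of \<open>\<rho> = 2 powr ((d + 1) \<delta>)\<close>. Their tails
  are bounded through \<open>Ainf_sum\<close> with \<open>B = 2^(d+1) A\<close>, so they can be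
  summed by \<open>sum_geometric_weights\<close>.\<close>

lemma reverse_Holder:
  fixes w :: "'a \<Rightarrow> real" and t A \<delta> :: real
  assumes w[measurable]: "w \<in> borel_measurable lebesgue" and t: "0 < t"
    and pos: "AE x in lebesgue. 0 < w x"
    and wt: "ennreal t * vol Q0 = emeasure (wm w) Q0"
    and A: "1 \<le> A" "\<And>n x. x \<in> Q0 \<Longrightarrow> max_mass w (K n x) \<le> A * emeasure (wm w) (K n x)"
    and \<delta>: "0 < \<delta>" "\<delta> * (4 * Suc DIM('a) * 2 ^ Suc DIM('a) * A) \<le> 1"
  shows "mass (\<lambda>x. w x powr (1 + \<delta>)) Q0 \<le> ennreal (5 * t powr (1 + \<delta>)) * vol Q0"
proof -
  let ?\<nu> = "emeasure (wm w)"
  let ?s = "\<lambda>m. ennreal (lvl t (Suc m) powr \<delta> - lvl t m powr \<delta>) * ?\<nu> (Om w (lvl t m))"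
  note facts = w t wt
  define \<alpha> :: real where "\<alpha> = 2 ^ Suc DIM('a)"
  define B where "B = \<alpha> * A"
  define \<rho> where "\<rho> = \<alpha> powr \<delta>"
  have \<alpha>: "1 < \<alpha>" unfolding \<alpha>_def by (rule one_less_power) auto
  have B1: "1 \<le> B" using \<alpha> A(1) mult_mono[of 1 \<alpha> 1 A] by (simp add: B_def)
  have \<rho>1: "1 \<le> \<rho>" using \<alpha> \<delta> by (simp add: \<rho>_def ge_one_powr_ge_zero)
  have "ln \<alpha> = Suc DIM('a) * ln 2" unfolding \<alpha>_def by (rule ln_realpow)
  also have "\<dots> \<le> real (Suc DIM('a)) * 1" using ln_2_less_1 by (intro mult_left_mono) auto
  finally have ln\<alpha>: "ln \<alpha> \<le> Suc DIM('a)" by simp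
  \<comment> \<open>The source of a gain of order \<open>1 / A\<close>: absorption requires
    \<open>\<rho> - 1 \<le> 1 / (2 B)\<close>, and \<open>\<rho> - 1\<close> is at most
    \<open>2 \<delta> ln \<alpha>\<close>.\<close>
  have "\<delta> * ln \<alpha> * (4 * B) \<le> \<delta> * Suc DIM('a) * (4 * B)" using ln\<alpha> \<delta> B1 by (intro mult_right_mono mult_left_mono) auto
  also have "\<dots> \<le> 1" using \<delta>(2) by (simp add: B_def \<alpha>_def algebra_simps)
  finally have dl: "\<delta> * ln \<alpha> * (4 * B) \<le> 1" .
  have dl0: "0 \<le> \<delta> * ln \<alpha>" using \<delta> \<alpha> by simp
  have dl1: "\<delta> * ln \<alpha> \<le> 1"
    using dl mult_left_mono[of 1 "4 * B" "\<delta> * ln \<alpha>"] dl0 B1 by linarith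
  have "\<rho> = exp (\<delta> * ln \<alpha>)" using \<alpha> by (simp add: \<rho>_def powr_def)
  also have "\<dots> \<le> 1 + \<delta> * ln \<alpha> + (\<delta> * ln \<alpha>)\<^sup>2" using dl0 dl1 by (intro exp_bound) auto
  also have "\<dots> \<le> 1 + 2 * (\<delta> * ln \<alpha>)"
    using mult_left_mono[OF dl1 dl0] by (simp add: power2_eq_square)
  finally have "(\<rho> - 1) * B \<le> 2 * (\<delta> * ln \<alpha>) * B" using B1 by (intro mult_right_mono) auto
  then have \<rho>B: "(\<rho> - 1) * B \<le> 1 / 2" using dl by simp
  define x where "x m = measure (wm w) (Om w (lvl t m))" for m
  have x: "?\<nu> (Om w (lvl t m)) = ennreal (x m)" for m
    unfolding x_def by (rule emeasure_eq_ennreal_measure) (use wm_fin[OF facts stop_subset[of "lev w (lvl t m)"]] in simp)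
  have xs: "(\<Sum>m\<in>{k<..<N}. x m) \<le> B * x k" for k N
  proof -
    have "ennreal (\<Sum>m\<in>{k<..<N}. x m) = (\<Sum>m\<in>{k<..<N}. ?\<nu> (Om w (lvl t m)))"
      unfolding x by (rule sum_ennreal[symmetric]) (simp add: x_def)
    also have "\<dots> \<le> 2 ^ Suc DIM('a) * ennreal A * ?\<nu> (Om w (lvl t k))"
      by (rule Ainf_sum[OF facts A(2)])
    also have "\<dots> = ennreal (B * x k)"
    proof -
      have "ennreal \<alpha> = 2 ^ Suc DIM('a)" unfolding \<alpha>_def by (metis ennreal_numeral ennreal_power zero_le_numeral)
      then show ?thesis using A(1) \<alpha> unfolding x B_def by (simp add: ennreal_mult' x_def)
    qed
    finally show ?thesis using B1 by (subst (asm) ennreal_le_iff) (auto simp: x_def)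
  qed
  have sumT: "(\<Sum>m<N. \<rho> ^ m * x m) \<le> 2 * (1 + B) * x 0" for N
    by (rule sum_geometric_weights[OF _ \<rho>1 \<rho>B xs]) (simp add: x_def)
  have x0: "?\<nu> Q0 = ennreal (x 0)" using x[of 0] Om_lvl_0[OF facts] by simp
  have lvl_powr: "lvl t m powr \<delta> = \<rho> ^ m * t powr \<delta>" for m
    using t \<alpha> unfolding lvl_def \<alpha>_def[symmetric] \<rho>_def
    by (simp add: powr_mult powr_powr powr_realpow[symmetric] mult.commute powr_power)
  have "mass (\<lambda>x. w x powr (1 + \<delta>)) Q0 = (\<integral>\<^sup>+x\<in>Q0. ennreal (w x powr \<delta>) * ennreal (w x) \<partial>lebesgue)"
    by (rule nn_integral_cong_AE, use pos in eventually_elim)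
      (auto simp: powr_add mult.commute simp flip: ennreal_mult)
  also have "\<dots> \<le> ennreal (lvl t 0 powr \<delta>) * ?\<nu> Q0 + (\<Sum>m. ?s m)"
  proof (rule layer_integral_le[OF w _ w])
    show "AE x in lebesgue. 0 \<le> w x" using pos by (auto elim: eventually_mono)
    show "mono (lvl t)" using t by (intro monoI lvl_mono) auto
    show "\<exists>m. u \<le> lvl t m" for u
    proof -
      obtain m where "u / t < \<alpha> ^ m" using real_arch_pow[OF \<alpha>] by blast
      then show ?thesis using t unfolding lvl_def \<alpha>_def[symmetric] by (intro exI[of _ m]) (simp add: field_simps)
    qed
  qed (use t \<delta> in \<open>auto intro: powr_mono2\<close>)
  \<comment> \<open>The constant 5 arises as 1 from the base height plus 4 from the layers above
    it.\<close>
  also have "\<dots> \<le> ennreal (t powr \<delta> * x 0) + ennreal (t powr \<delta> * (4 * x 0))"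
  proof (rule add_mono)
    show "(\<Sum>m. ?s m) \<le> ennreal (t powr \<delta> * (4 * x 0))"
    proof (rule suminf_le_const[OF summableI])
      fix N
      have "(\<Sum>m<N. ?s m) =
         (\<Sum>m<N. ennreal ((\<rho> - 1) * t powr \<delta> * (\<rho> ^ m * x m)))"
        unfolding lvl_powr x using \<rho>1
        by (intro sum.cong refl) (auto simp: x_def algebra_simps simp flip: ennreal_mult')
      also have "\<dots> = ennreal (\<Sum>m<N. (\<rho> - 1) * t powr \<delta> * (\<rho> ^ m * x m))"
        using \<rho>1 by (intro sum_ennreal) (auto simp: x_def)
      also have "\<dots> \<le> ennreal (t powr \<delta> * (4 * x 0))"
      proof (rule ennreal_leI)
        have "(\<rho> - 1) * (2 * (1 + B)) \<le> 4"
        proof -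
          have "(\<rho> - 1) * 1 \<le> (\<rho> - 1) * B" using \<rho>1 B1 by (intro mult_left_mono) auto
          then show ?thesis using \<rho>B by (simp add: algebra_simps)
        qed
        then have *: "(\<rho> - 1) * (2 * (1 + B)) * x 0 \<le> 4 * x 0" by (intro mult_right_mono) (auto simp: x_def)
        have "(\<Sum>m<N. (\<rho> - 1) * t powr \<delta> * (\<rho> ^ m * x m)) = (\<rho> - 1) * t powr \<delta> * (\<Sum>m<N. \<rho> ^ m * x m)"
          by (simp add: sum_distrib_left)
        also have "\<dots> \<le> (\<rho> - 1) * t powr \<delta> * (2 * (1 + B) * x 0)"
          using \<rho>1 by (intro mult_left_mono sumT) auto
        also have "\<dots> = t powr \<delta> * ((\<rho> - 1) * (2 * (1 + B)) * x 0)" by (simp add: mult_ac)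
        also have "\<dots> \<le> t powr \<delta> * (4 * x 0)" by (intro mult_left_mono *) auto
        finally show "(\<Sum>m<N. (\<rho> - 1) * t powr \<delta> * (\<rho> ^ m * x m)) \<le> t powr \<delta> * (4 * x 0)" .
      qed
      finally show "(\<Sum>m<N. ?s m) \<le> ennreal (t powr \<delta> * (4 * x 0))" .
    qed
  qed (simp add: x0 ennreal_mult')
  also have "\<dots> = ennreal (5 * t powr \<delta>) * ennreal (x 0)"
    by (simp add: x_def algebra_simps flip: ennreal_plus ennreal_mult')
  also have "\<dots> = ennreal (5 * t powr (1 + \<delta>)) * vol Q0"
    using t unfolding x0[symmetric] wt[symmetric] powr_add by (simp add: ennreal_mult' mult_ac)
  finally show ?thesis .
qed

end

section \<open>The John-Nirenberg inequality\<close>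

lemma cubeE:
  fixes Q :: "'a::euclidean_space set"
  assumes "cube Q"
  obtains a l where "dyadic_grid l" "Q = dyadic_grid.K a l 0 a"
proof -
  obtain a l where "0 < l" "Q = cbox a (a + l *\<^sub>R One)" using assms by (auto simp: cube_def)
  then have "dyadic_grid l" "Q = dyadic_grid.K a l 0 a"
    by (auto simp: dyadic_grid_def dyadic_grid.K0a)
  then show ?thesis using that by blast
qed

lemma cube_lebesgue:
  assumes "cube Q" shows "Q \<in> sets lebesgue" "0 < vol Q" "vol Q < \<infinity>"
    "0 < measure lebesgue Q" "vol Q = ennreal (measure lebesgue Q)"
proof -
  obtain a l where Q: "dyadic_grid l" "Q = dyadic_grid.K a l 0 a" by (rule cubeE[OF assms])
  interpret dyadic_grid a l by (rule Q)
  show *: "Q \<in> sets lebesgue" "0 < vol Q" "vol Q < \<infinity>"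
    using emeasure_D_pos[of 0 a] unfolding Q(2) by (auto simp: emeasure_lebesgue_K)
  then show "vol Q = ennreal (measure lebesgue Q)" by (intro emeasure_eq_ennreal_measure) auto
  then show "0 < measure lebesgue Q" using * by (simp add: ennreal_less_zero_iff)
qed

lemma set_nn_integral_norm:
  fixes f :: "'a \<Rightarrow> real"
  assumes "set_integrable M Q f"
  shows "ennreal \<bar>LINT x:Q|M. f x\<bar> \<le> (\<integral>\<^sup>+x\<in>Q. ennreal \<bar>f x\<bar> \<partial>M)"
proof -
  have "ennreal (norm (LINT x:Q|M. f x)) \<le> (\<integral>\<^sup>+x. ennreal (norm (indicator Q x *\<^sub>R f x)) \<partial>M)"
    unfolding set_lebesgue_integral_def by (rule integral_norm_bound_ennreal) (use assms in \<open>simp add: set_integrable_def\<close>)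
  also have "\<dots> = (\<integral>\<^sup>+x\<in>Q. ennreal \<bar>f x\<bar> \<partial>M)"
    by (rule nn_integral_cong) (auto simp: indicator_def)
  finally show ?thesis by simp
qed

text \<open>The deviation of a mean from \<open>c\<close> is the mean of \<open>b - c\<close>. The
  freedom in \<open>c\<close> permits comparing means over different cubes.\<close>

lemma cube_mean_dev:
  assumes "cube Q" "set_integrable lebesgue Q b"
  shows "ennreal \<bar>cube_mean Q b - c\<bar> * vol Q \<le> mass (\<lambda>x. \<bar>b x - c\<bar>) Q"
proof -
  note Q = cube_lebesgue[OF assms(1)]
  have c: "set_integrable lebesgue Q (\<lambda>_. c)" using Q unfolding set_integrable_def by simp
  have "(LINT x:Q|lebesgue. b x - c) = (LINT x:Q|lebesgue. b x) - (LINT x:Q|lebesgue. c)"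
    by (rule set_integral_diff(2)[OF assms(2) c])
  also have "(LINT x:Q|lebesgue. c) = c * measure lebesgue Q"
    using Q unfolding set_lebesgue_integral_def by simp
  finally have "(cube_mean Q b - c) * measure lebesgue Q = (LINT x:Q|lebesgue. b x - c)"
    unfolding cube_mean_def using Q(4) by (simp add: left_diff_distrib)
  then have "\<bar>cube_mean Q b - c\<bar> * measure lebesgue Q = \<bar>LINT x:Q|lebesgue. b x - c\<bar>"
    using Q(4) abs_mult[of "cube_mean Q b - c" "measure lebesgue Q"] by simp
  then have "ennreal \<bar>cube_mean Q b - c\<bar> * vol Q = ennreal \<bar>LINT x:Q|lebesgue. b x - c\<bar>"
    unfolding Q(5) by (simp flip: ennreal_mult')
  also have "\<dots> \<le> mass (\<lambda>x. \<bar>b x - c\<bar>) Q"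
    by (rule set_nn_integral_norm) (rule set_integral_diff(1)[OF assms(2) c])
  finally show ?thesis .
qed

context dyadic_grid
begin

text \<open>Raising the height of the averages of \<open>f = |b - mean|\<close> by
  \<open>\<Lambda>\<close> halves the measure of the level set: on an atom, \<open>b\<close> has
  mean close to the top mean up to the current height, and its oscillation about its own mean is at
  most \<open>\<beta>\<close> on average. Exponential integrability follows by layers.\<close>

lemma John_Nirenberg_grid:
  fixes b :: "'a \<Rightarrow> real" and \<beta> :: real
  assumes b[measurable]: "b \<in> borel_measurable lebesgue" and bi: "\<And>Q. cube Q \<Longrightarrow> set_integrable lebesgue Q b"
    and \<beta>: "0 < \<beta>" "\<And>Q. cube Q \<Longrightarrow> mass (\<lambda>x. \<bar>b x - cube_mean Q b\<bar>) Q \<le> ennreal \<beta> * vol Q"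
  shows "mass (\<lambda>x. exp (ln (3 / 2) / ((2 ^ DIM('a) + 2) * \<beta>) * \<bar>b x - cube_mean (K 0 a) b\<bar>)) Q0 \<le> 5 * vol Q0"
proof -
  let ?\<mu> = vol
  define \<kappa> :: real where "\<kappa> = 2 ^ DIM('a)"
  define \<Lambda> where "\<Lambda> = (\<kappa> + 2) * \<beta>"
  have \<kappa>: "1 \<le> \<kappa>" "ennreal \<kappa> = 2 ^ DIM('a)" unfolding \<kappa>_def
    by (simp, metis ennreal_numeral ennreal_power zero_le_numeral)
  have \<Lambda>: "\<beta> \<le> \<Lambda>" "0 < \<Lambda>" using \<kappa> \<beta> mult_right_mono[of 1 "\<kappa> + 2" \<beta>]
    unfolding \<Lambda>_def by (auto intro!: mult_pos_pos)
  define mean where "mean n x = cube_mean (K n x) b" for n x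
  define f where "f x = \<bar>b x - mean 0 a\<bar>" for x
  have f[measurable]: "f \<in> borel_measurable lebesgue" unfolding f_def by measurable
  have KD: "(\<integral>\<^sup>+x\<in>K n y. g x \<partial>lebesgue) = (\<integral>\<^sup>+x\<in>D n y. g x \<partial>lebesgue)" for n y and g :: "'a \<Rightarrow> ennreal"
    by (rule nn_integral_cong_AE, use AE_D_K[of n y] in eventually_elim) (simp add: indicator_def)
  have osc: "mass (\<lambda>x. \<bar>b x - mean n y\<bar>) (D n y) \<le> ennreal \<beta> * ?\<mu> (D n y)" for n y
    using \<beta>(2)[OF cube_K[of n y]] unfolding KD mean_def emeasure_lebesgue_K .
  have dev: "ennreal \<bar>mean n y - c\<bar> * ?\<mu> (D n y) \<le> mass (\<lambda>x. \<bar>b x - c\<bar>) (D n y)" for n y c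
    using cube_mean_dev[OF cube_K bi[OF cube_K], of n y c] unfolding KD mean_def emeasure_lebesgue_K .
  have cancel: "u \<le> v" if "ennreal u * ?\<mu> (D n y) \<le> ennreal v * ?\<mu> (D n y)" "0 \<le> v" for u v n y
  proof -
    have "?\<mu> (D n y) * ennreal u \<le> ?\<mu> (D n y) * ennreal v" using that by (simp add: mult.commute)
    then have "ennreal u \<le> ennreal v" using emeasure_D_pos[of n y] by (subst (asm) ennreal_mult_le_mult_iff) auto
    then show ?thesis using that by simp
  qed
  have jump: "\<bar>mean (Suc n) y - mean n y\<bar> \<le> \<kappa> * \<beta>" for n y
  proof (rule cancel)
    have "ennreal \<bar>mean (Suc n) y - mean n y\<bar> * ?\<mu> (D (Suc n) y) \<le> mass (\<lambda>x. \<bar>b x - mean n y\<bar>) (D (Suc n) y)"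
      by (rule dev)
    also have "\<dots> \<le> mass (\<lambda>x. \<bar>b x - mean n y\<bar>) (D n y)"
      by (intro nn_integral_mono mult_left_mono) (use D_Suc[of n y] in \<open>auto simp: indicator_def\<close>)
    also have "\<dots> \<le> ennreal \<beta> * ?\<mu> (D n y)" by (rule osc)
    also have "\<dots> = ennreal (\<kappa> * \<beta>) * ?\<mu> (D (Suc n) y)"
      unfolding emeasure_D_parent[of n] \<kappa>(2)[symmetric] using \<kappa> \<beta> by (simp add: ennreal_mult' mult_ac)
    finally show "ennreal \<bar>mean (Suc n) y - mean n y\<bar> * ?\<mu> (D (Suc n) y) \<le> ennreal (\<kappa> * \<beta>) * ?\<mu> (D (Suc n) y)" .
  qed (use \<kappa> \<beta> in simp)
  \<comment> \<open>The parent of an atom is not selected, so its mean deviates by at most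
    \<open>s\<close>; \<open>jump\<close> accounts for the last generation.\<close>
  have meanP: "\<bar>mean n y - mean 0 a\<bar> \<le> s + \<kappa> * \<beta>"
    if s: "0 \<le> s" "y \<in> Q0" "\<And>m. m < n \<Longrightarrow> \<not> lev f s (D m y)" for n y s
  proof (cases n)
    case 0
    then have "mean n y = mean 0 a" using K_eq[OF s(2)] by (simp add: mean_def)
    then show ?thesis using s \<kappa> \<beta> by simp
  next
    case (Suc m)
    have "ennreal \<bar>mean m y - mean 0 a\<bar> * ?\<mu> (D m y) \<le> emeasure (wm f) (D m y)"
      using dev[of m y "mean 0 a"] by (simp add: emeasure_wm f_def)
    also have "\<dots> \<le> ennreal s * ?\<mu> (D m y)" using s(3)[of m] Suc by (simp add: lev_def)
    finally have "\<bar>mean m y - mean 0 a\<bar> \<le> s" using s(1) by (rule cancel)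
    then show ?thesis using jump[of m y] unfolding Suc by linarith
  qed
  have half: "2 * ?\<mu> (Om f (s + \<Lambda>)) \<le> ?\<mu> (Om f s)" if s: "0 \<le> s" for s
  proof -
    have sub: "Om f (s + \<Lambda>) \<subseteq> Om f s" using \<Lambda> by (intro Om_mono) auto
    have "emeasure (scale_measure 2 lebesgue) (Om f s \<inter> Om f (s + \<Lambda>)) \<le> 1 * ?\<mu> (Om f s \<inter> UNIV)"
    proof (rule stop_emeasure_le)
      fix P assume P: "P \<in> atoms (lev f s)"
      then obtain n y where y: "P = D n y" "y \<in> Q0" "\<And>m. m < n \<Longrightarrow> \<not> lev f s (D m y)" by (auto simp: atoms_def)
      have [measurable]: "P \<in> sets lebesgue" using y by simp
      let ?X = "Om f (s + \<Lambda>) \<inter> P"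
      have Xfin: "?\<mu> ?X < \<infinity>" using emeasure_mono[of ?X P lebesgue] emeasure_D_pos(2)[of n y] y
        by (auto intro: le_less_trans)
      have "ennreal (s + \<Lambda>) * ?\<mu> ?X \<le> emeasure (wm f) ?X"
        by (rule Om_lower_atom[OF _ P]) (use \<Lambda> in simp)
      also have "\<dots> = mass f ?X" by (rule emeasure_wm) auto
      also have "\<dots> \<le> (\<integral>\<^sup>+x. ennreal \<bar>b x - mean n y\<bar> * indicator P x + ennreal (s + \<kappa> * \<beta>) * indicator ?X x \<partial>lebesgue)"
      proof (rule nn_integral_mono)
        fix x
        have "\<bar>mean n y - mean 0 a\<bar> \<le> s + \<kappa> * \<beta>" by (rule meanP[OF s y(2)]) (rule y(3))
        then have "f x \<le> \<bar>b x - mean n y\<bar> + (s + \<kappa> * \<beta>)" unfolding f_def by linarith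
        then have "ennreal (f x) \<le> ennreal \<bar>b x - mean n y\<bar> + ennreal (s + \<kappa> * \<beta>)"
          using s \<kappa> \<beta> by (simp flip: ennreal_plus)
        then show "ennreal (f x) * indicator ?X x \<le> ennreal \<bar>b x - mean n y\<bar> * indicator P x + ennreal (s + \<kappa> * \<beta>) * indicator ?X x"
          by (auto simp: indicator_def)
      qed
      also have "\<dots> = mass (\<lambda>x. \<bar>b x - mean n y\<bar>) P + ennreal (s + \<kappa> * \<beta>) * ?\<mu> ?X"
        by (subst nn_integral_add) (auto simp: nn_integral_cmult)
      also have "\<dots> \<le> ennreal \<beta> * ?\<mu> P + ennreal (s + \<kappa> * \<beta>) * ?\<mu> ?X"
        using osc[of n y] y by (intro add_right_mono) simp
      finally have "ennreal (s + \<Lambda>) * ?\<mu> ?X \<le> ennreal \<beta> * ?\<mu> P + ennreal (s + \<kappa> * \<beta>) * ?\<mu> ?X" .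
      \<comment> \<open>The choice of \<open>\<Lambda>\<close>: after removing
        \<open>s + \<kappa> \<beta>\<close> from both sides, \<open>2 \<beta>\<close> faces
        \<open>\<beta>\<close>, which is the halving.\<close>
      moreover have "ennreal (s + \<Lambda>) = ennreal (s + \<kappa> * \<beta>) + ennreal (2 * \<beta>)"
        using s \<kappa> \<beta> by (simp add: \<Lambda>_def distrib_right flip: ennreal_plus)
      ultimately have "ennreal (s + \<kappa> * \<beta>) * ?\<mu> ?X + ennreal (2 * \<beta>) * ?\<mu> ?X \<le> ennreal (s + \<kappa> * \<beta>) * ?\<mu> ?X + ennreal \<beta> * ?\<mu> P"
        by (simp add: distrib_right add.commute)
      then have "ennreal (2 * \<beta>) * ?\<mu> ?X \<le> ennreal \<beta> * ?\<mu> P"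
        using Xfin by (auto simp: ennreal_add_left_cancel_le ennreal_mult_eq_top_iff)
      then have "ennreal \<beta> * (2 * ?\<mu> ?X) \<le> ennreal \<beta> * ?\<mu> P"
        using \<beta> by (simp add: ennreal_mult' mult_ac)
      then have "2 * ?\<mu> ?X \<le> ?\<mu> P" using \<beta> by (subst (asm) ennreal_mult_le_mult_iff) auto
      then show "emeasure (scale_measure 2 lebesgue) (P \<inter> Om f (s + \<Lambda>)) \<le> 1 * ?\<mu> (P \<inter> UNIV)"
        by (simp add: Int_commute)
    qed auto
    then show ?thesis using sub by (simp add: Int_absorb1)
  qed
  define L where "L m = (real m + 1) * \<Lambda>" for m
  have LS: "L (Suc m) = L m + \<Lambda>" for m by (simp add: L_def algebra_simps)
  have L0: "0 \<le> L m" for m using \<Lambda> by (simp add: L_def)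
  have decay: "?\<mu> (Om f (L m)) \<le> ennreal ((1 / 2) ^ m) * ?\<mu> Q0" for m
  proof (induction m)
    case 0
    then show ?case using emeasure_mono[OF stop_subset[of "lev f (L 0)"], of lebesgue] by simp
  next
    case (Suc m)
    have "2 * ?\<mu> (Om f (L (Suc m))) \<le> ennreal ((1 / 2) ^ m) * ?\<mu> Q0"
      using half[OF L0[of m]] Suc unfolding LS by (rule order_trans)
    also have "ennreal ((1 / 2) ^ m) = 2 * ennreal ((1 / 2) ^ Suc m)"
      by (simp flip: ennreal_mult' ennreal_numeral)
    finally have "2 * ?\<mu> (Om f (L (Suc m))) \<le> 2 * (ennreal ((1 / 2) ^ Suc m) * ?\<mu> Q0)" by (simp add: mult.assoc)
    then show ?case by (subst (asm) ennreal_mult_le_mult_iff) auto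
  qed
  \<comment> \<open>One step of length \<open>\<Lambda>\<close> multiplies the exponential by
    \<open>3 / 2\<close> while the measure at least halves, so the layers sum like powers of
    \<open>3 / 4\<close>.\<close>
  define c where "c = ln (3 / 2) / \<Lambda>"
  have c: "0 \<le> c" using \<Lambda> by (simp add: c_def)
  let ?s = "\<lambda>m. ennreal (exp (c * L (Suc m)) - exp (c * L m)) * emeasure (wm (\<lambda>_. 1)) (Om f (L m))"
  have ec: "exp (c * L m) = (3 / 2) ^ Suc m" for m
  proof -
    have "c * L m = real (Suc m) * ln (3 / 2)" using \<Lambda> by (simp add: c_def L_def add.commute)
    then show ?thesis by (simp only: exp_of_nat_mult) simp
  qed
  have one: "emeasure (wm (\<lambda>_. 1)) S = ?\<mu> S" if "S \<in> sets lebesgue" for S :: "'a set"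
    using that by (simp add: emeasure_wm)
  have "mass (\<lambda>x. exp (c * f x)) Q0 = (\<integral>\<^sup>+x\<in>Q0. ennreal (exp (c * f x)) * ennreal 1 \<partial>lebesgue)" by simp
  also have "\<dots> \<le> ennreal (exp (c * L 0)) * emeasure (wm (\<lambda>_. 1)) Q0 + (\<Sum>m. ?s m)"
  proof (rule layer_integral_le)
    show "mono L" unfolding L_def using \<Lambda> by (auto intro!: monoI mult_right_mono)
    show "\<exists>m. u \<le> L m" for u
    proof -
      obtain m where "u / \<Lambda> < real m" using reals_Archimedean2 by blast
      then have "u \<le> L m" using \<Lambda> by (simp add: L_def field_simps)
      then show ?thesis ..
    qed
  qed (use c L0 in \<open>auto simp: f_def intro: mult_left_mono\<close>)
  also have "\<dots> \<le> ennreal (3 / 2) * ?\<mu> Q0 + ennreal 3 * ?\<mu> Q0"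
  proof (rule add_mono)
    show "(\<Sum>m. ?s m) \<le> ennreal 3 * ?\<mu> Q0"
    proof (rule suminf_le_const[OF summableI])
      fix N
      have "(\<Sum>m<N. ?s m)
        \<le> (\<Sum>m<N. ennreal (3 / 4 * (3 / 4) ^ m) * ?\<mu> Q0)"
      proof (rule sum_mono)
        fix m
        have "?s m \<le>
          ennreal (1 / 2 * (3 / 2) ^ Suc m) * (ennreal ((1 / 2) ^ m) * ?\<mu> Q0)"
          unfolding ec by (intro mult_mono) (use decay[of m] in \<open>auto simp: one intro: ennreal_leI\<close>)
        also have "\<dots> = ennreal (1 / 2 * (3 / 2) ^ Suc m) * ennreal ((1 / 2) ^ m) * ?\<mu> Q0"
          by (rule mult.assoc[symmetric])
        also have "ennreal (1 / 2 * (3 / 2) ^ Suc m) * ennreal ((1 / 2) ^ m) = ennreal (1 / 2 * (3 / 2) ^ Suc m * (1 / 2) ^ m)"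
          by (rule ennreal_mult'[symmetric]) simp
        also have "1 / 2 * (3 / 2) ^ Suc m * (1 / 2) ^ m = 3 / 4 * (3 / 4 :: real) ^ m"
          by (simp flip: power_mult_distrib)
        finally show "?s m \<le> ennreal (3 / 4 * (3 / 4) ^ m) * ?\<mu> Q0" .
      qed
      also have "\<dots> = ennreal (\<Sum>m<N. 3 / 4 * (3 / 4) ^ m) * ?\<mu> Q0"
        unfolding sum_distrib_right[symmetric] by (subst sum_ennreal) auto
      also have "\<dots> \<le> ennreal 3 * ?\<mu> Q0"
      proof (intro mult_right_mono ennreal_leI)
        have "(\<Sum>m<N. 3 / 4 * (3 / 4) ^ m) = 3 * (1 - (3 / 4 :: real) ^ N)"
          by (induction N) auto
        then show "(\<Sum>m<N. 3 / 4 * (3 / 4) ^ m) \<le> (3::real)" by simp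
      qed auto
      finally show "(\<Sum>m<N. ?s m) \<le> ennreal 3 * ?\<mu> Q0" .
    qed
  qed (simp add: one ec)
  also have "\<dots> \<le> 5 * ?\<mu> Q0"
    unfolding distrib_right[symmetric] by (intro mult_right_mono) (auto simp flip: ennreal_plus ennreal_numeral intro: ennreal_leI)
  finally show ?thesis unfolding c_def f_def mean_def \<Lambda>_def \<kappa>_def .
qed

end

lemma John_Nirenberg:
  fixes b :: "'a::euclidean_space \<Rightarrow> real" and \<beta> :: real
  assumes b: "b \<in> borel_measurable lebesgue" and bi: "\<And>Q. cube Q \<Longrightarrow> set_integrable lebesgue Q b"
    and \<beta>: "0 < \<beta>" "\<And>Q. cube Q \<Longrightarrow> mass (\<lambda>x. \<bar>b x - cube_mean Q b\<bar>) Q \<le> ennreal \<beta> * vol Q"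
    and Q: "cube Q" and c: "0 \<le> c" "c * (3 * (2 ^ DIM('a) + 2) * \<beta>) \<le> 1"
  shows "mass (\<lambda>x. exp (c * \<bar>b x - cube_mean Q b\<bar>)) Q \<le> 5 * vol Q"
proof -
  obtain a l where al: "dyadic_grid l" "Q = dyadic_grid.K a l 0 a" by (rule cubeE[OF Q])
  interpret dyadic_grid a l by (rule al)
  let ?G = "(2 ^ DIM('a) + 2) * \<beta>"
  have G: "0 < ?G" using \<beta> by (intro mult_pos_pos add_pos_pos) auto
  \<comment> \<open>Follows from \<open>ln (2 / 3) \<le> - 1 / 3\<close>; it trades the logarithm in
    the rate for the factor 3 in the assumption on \<open>c\<close>.\<close>
  have "1 / 3 \<le> ln (3 / 2 :: real)" using ln_ge_iff[of "3/2" "1/3"] ln_one_minus_pos_lower_bound ln_le_minus_one[of "2/3::real"]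
    by (simp add: ln_div)
  then have "(1 / 3) / ?G \<le> ln (3 / 2) / ?G" using G by (intro divide_right_mono) auto
  moreover have "c \<le> (1 / 3) / ?G" using G c(2) by (simp add: field_simps)
  moreover define C where "C = ln (3 / 2) / ?G"
  ultimately have "c \<le> C" by simp
  then have "mass (\<lambda>x. exp (c * \<bar>b x - cube_mean Q b\<bar>)) Q \<le>
    mass (\<lambda>x. exp (C * \<bar>b x - cube_mean (K 0 a) b\<bar>)) Q0"
    unfolding al(2)
    by (intro nn_integral_mono_AE, use AE_D_K[of 0 a] in eventually_elim)
      (auto simp: indicator_def intro!: ennreal_leI mult_right_mono)
  also have "\<dots> \<le> 5 * vol Q0" unfolding C_def by (rule John_Nirenberg_grid[OF b bi \<beta>])
  finally show ?thesis unfolding al(2) emeasure_lebesgue_K .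
qed

section \<open>Weights perturbed by exponentials of BMO functions\<close>

text \<open>Pointwise substitute for Hoelder's inequality when combining reverse Hoelder with John-Nirenberg.\<close>

lemma powr_exp_Young:
  fixes v s \<delta> y :: real
  assumes v: "0 < v" and \<delta>: "0 < \<delta>" and s: "1 \<le> s" "s \<le> 1 + \<delta> / 2"
  shows "v powr s * exp y \<le> v powr (1 + \<delta>) + exp (\<bar>y\<bar> * (2 * s / \<delta> + 1))"
proof -
  have pos: "0 \<le> 2 * s / \<delta>" using s \<delta> by simp
  have mono: "exp y \<le> exp (\<bar>y\<bar> * (2 * s / \<delta> + 1))"
    using pos mult_nonneg_nonneg[OF abs_ge_zero[of y] pos] by (simp add: distrib_left)
  \<comment> \<open>For \<open>v > 1\<close> either the exponential is paid for by the spare power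
    \<open>v powr (\<delta> / 2)\<close>, or \<open>v\<close> itself is below a power of the
    exponential.\<close>
  consider "v \<le> 1" | "1 < v" "exp y \<le> v powr (\<delta> / 2)" | "1 < v" "v powr (\<delta> / 2) < exp y" by linarith
  then show ?thesis
  proof cases
    case 1
    then have "v powr s \<le> 1" using v s by (simp add: powr_le1)
    then have "v powr s * exp y \<le> 1 * exp y" by (intro mult_right_mono) auto
    then show ?thesis using mono powr_ge_zero[of v "1 + \<delta>"] by linarith
  next
    case 2
    have "v powr s * exp y \<le> v powr s * v powr (\<delta> / 2)" using 2 by (intro mult_left_mono) auto
    also have "\<dots> = v powr (s + \<delta> / 2)" by (simp add: powr_add)
    also have "\<dots> \<le> v powr (1 + \<delta>)" using 2 s by (intro powr_mono) auto
    finally show ?thesis by (simp add: add_increasing2)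
  next
    case 3
    have "(v powr (\<delta> / 2)) powr (2 * s / \<delta>) \<le> exp y powr (2 * s / \<delta>)"
      using 3 pos by (intro powr_mono2) auto
    then have "v powr s \<le> exp (y * (2 * s / \<delta>))"
      using \<delta> by (simp add: powr_powr exp_powr_real)
    then have "v powr s * exp y \<le> exp (y * (2 * s / \<delta>)) * exp y" by (intro mult_right_mono) auto
    also have "\<dots> = exp (y * (2 * s / \<delta> + 1))" by (simp add: exp_add[symmetric] distrib_left)
    also have "\<dots> \<le> exp (\<bar>y\<bar> * (2 * s / \<delta> + 1))" using pos by (simp add: mult_right_mono)
    finally show ?thesis by (simp add: add_increasing)
  qed
qed

section \<open>Averages and characteristics of weights\<close>

lemma weight_avg:
  assumes "weight w" "cube Q"
  obtains \<tau> where "0 < \<tau>" "mass w Q = ennreal \<tau> * vol Q"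
    "avg Q w = ennreal \<tau>"
proof -
  note Q = cube_lebesgue[OF assms(2)]
  have w[measurable]: "w \<in> borel_measurable lebesgue" and pos: "AE x in lebesgue. 0 < w x" and i: "set_integrable lebesgue Q w"
    using assms by (auto simp: weight_def)
  let ?I = "\<integral>\<^sup>+x\<in>Q. ennreal (w x) \<partial>lebesgue"
  have "?I \<le> (\<integral>\<^sup>+x. ennreal (norm (indicator Q x *\<^sub>R w x)) \<partial>lebesgue)"
    by (rule nn_integral_mono) (auto simp: indicator_def intro!: ennreal_leI)
  also have "\<dots> < \<infinity>" using i unfolding set_integrable_def by (simp add: integrable_iff_bounded)
  finally have fin: "?I < \<infinity>" .
  have "?I \<noteq> 0"
  proof
    assume "?I = 0"
    then have "AE x in lebesgue. ennreal (w x) * indicator Q x = 0"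
      using Q by (subst (asm) nn_integral_0_iff_AE) auto
    then have "AE x in lebesgue. x \<notin> Q" using pos
      by eventually_elim (auto simp: indicator_def split: if_splits)
    then have "vol Q = 0" using Q AE_iff_measurable[OF Q(1), of "\<lambda>x. x \<notin> Q"] by simp
    then show False using Q by simp
  qed
  then obtain i where i: "?I = ennreal i" "0 < i" using fin
    by (cases ?I) (auto simp: ennreal_eq_0_iff not_le)
  define \<tau> where "\<tau> = i / measure lebesgue Q"
  have \<tau>: "0 < \<tau>" using i Q by (simp add: \<tau>_def)
  have "?I = ennreal \<tau> * vol Q"
    unfolding i Q(5) using Q \<tau> by (simp add: \<tau>_def flip: ennreal_mult')
  moreover have "avg Q w = ennreal \<tau>" unfolding avg_def i Q(5) \<tau>_def
    using i Q by (intro divide_ennreal) auto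
  ultimately show ?thesis using \<tau> that by blast
qed

lemma dual_dual [simp]: "dual_weight (dual_weight w) = w"
  by (simp add: dual_weight_def)

lemma A2_char_dual: "A2_char (dual_weight w) = A2_char w"
  by (simp add: A2_char_def mult.commute)

lemma avg_mult_le_A2_char: "cube Q \<Longrightarrow> avg Q w * avg Q (dual_weight w) \<le> A2_char w"
  unfolding A2_char_def by (rule SUP_upper) simp

text \<open>A positive average of \<open>w\<close> turns the finite product of averages into a
  finite average of \<open>1 / w\<close>, hence into local integrability.\<close>

lemma A2_dual:
  assumes "A2 w" shows "A2 (dual_weight w)"
proof -
  have w: "weight w" "A2_char w < \<infinity>" using assms by (auto simp: A2_def)
  then have [measurable]: "w \<in> borel_measurable lebesgue" by (simp add: weight_def)
  have dw[measurable]: "dual_weight w \<in> borel_measurable lebesgue" unfolding dual_weight_def by measurable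
  have pos: "AE x in lebesgue. 0 < dual_weight w x" using w unfolding weight_def dual_weight_def by auto
  have "set_integrable lebesgue Q (dual_weight w)" if Q: "cube Q" for Q
  proof -
    note QL = cube_lebesgue[OF Q]
    obtain \<tau> where \<tau>: "0 < \<tau>" "avg Q w = ennreal \<tau>" using weight_avg[OF w(1) Q] by metis
    have "avg Q w * avg Q (dual_weight w) < \<infinity>" using avg_mult_le_A2_char[OF Q, of w] w(2) by (rule le_less_trans)
    then have "avg Q (dual_weight w) < \<infinity>" using \<tau> by (auto simp: ennreal_mult_less_top)
    then have fin: "mass (dual_weight w) Q < \<infinity>"
      using QL unfolding avg_def
      by (cases "mass (dual_weight w) Q = top") (auto simp: ennreal_top_divide top.not_eq_extremum)
    have "(\<integral>\<^sup>+x. ennreal (norm (indicator Q x *\<^sub>R dual_weight w x)) \<partial>lebesgue) = mass (dual_weight w) Q"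
      by (rule nn_integral_cong_AE, use pos in eventually_elim) (auto simp: indicator_def)
    with fin show ?thesis using QL unfolding set_integrable_def
      by (intro integrableI_bounded) auto
  qed
  then show ?thesis unfolding A2_def weight_def A2_char_dual using pos w by auto
qed

text \<open>Cauchy-Schwarz on a single cube. \<open>admissible_phi\<close> speaks only about
  arguments from 1 on, so this and \<open>Ainf_char_ge_1\<close> are what make it
  applicable.\<close>

lemma A2_char_ge_1:
  fixes w :: "'a::euclidean_space \<Rightarrow> real"
  assumes "A2 w" shows "1 \<le> A2_char w"
proof -
  have w: "weight w" "weight (dual_weight w)" using assms A2_dual[OF assms] by (auto simp: A2_def)
  have Q: "cube (cbox 0 (0 + 1 *\<^sub>R One) :: 'a set)" unfolding cube_def by (intro exI[of _ 0] exI[of _ 1]) auto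
  let ?Q = "cbox 0 (0 + 1 *\<^sub>R One) :: 'a set"
  note QL = cube_lebesgue[OF Q]
  obtain s where s: "0 < s" "mass w ?Q = ennreal s * vol ?Q" "avg ?Q w = ennreal s"
    by (rule weight_avg[OF w(1) Q])
  obtain t where t: "0 < t" "mass (dual_weight w) ?Q = ennreal t * vol ?Q" "avg ?Q (dual_weight w) = ennreal t"
    by (rule weight_avg[OF w(2) Q])
  have "(vol ?Q)\<^sup>2 \<le> ennreal s * vol ?Q * (ennreal t * vol ?Q)"
    unfolding s(2)[symmetric] t(2)[symmetric]
    using emeasure_sq_le_dual[of w ?Q] w QL by (simp add: weight_def emeasure_wm)
  then have "(measure lebesgue ?Q)\<^sup>2 * 1 \<le> (measure lebesgue ?Q)\<^sup>2 * (s * t)"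
    unfolding QL(5) using s t by (simp add: ennreal_power power2_eq_square mult_ac flip: ennreal_mult')
  then have "1 \<le> s * t" using QL(4) by (subst (asm) mult_le_cancel_left_pos) auto
  then have "1 \<le> avg ?Q w * avg ?Q (dual_weight w)"
    unfolding s t using s t by (simp flip: ennreal_mult' ennreal_1)
  also have "\<dots> \<le> A2_char w" by (rule avg_mult_le_A2_char[OF Q])
  finally show ?thesis .
qed

lemma Ainf_char_leI:
  assumes "weight w" "\<And>Q. cube Q \<Longrightarrow> max_mass w Q \<le> C * mass w Q"
  shows "Ainf_char w \<le> C"
  unfolding Ainf_char_def
proof (rule SUP_least)
  fix Q :: "'a set" assume "Q \<in> {Q. cube Q}"
  then have Q: "cube Q" by simp
  note QL = cube_lebesgue[OF Q]
  obtain s where s: "0 < s" "mass w Q = ennreal s * vol Q"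
    using weight_avg[OF assms(1) Q] by metis
  then have "0 < (mass w Q)" using QL by (simp add: ennreal_zero_less_mult_iff)
  then show "max_mass w Q / mass w Q \<le> C"
    using assms(2)[OF Q] by (intro divide_le_posI_ennreal) (auto simp: mult.commute)
qed

text \<open>On \<open>Q\<close>, testing the maximal function with \<open>Q\<close> itself already
  gives the average of \<open>w\<close>.\<close>

lemma Ainf_char_ge_1:
  fixes w :: "'a::euclidean_space \<Rightarrow> real"
  assumes "weight w" shows "1 \<le> Ainf_char w"
proof -
  have Q: "cube (cbox 0 (0 + 1 *\<^sub>R One) :: 'a set)" unfolding cube_def by (intro exI[of _ 0] exI[of _ 1]) auto
  let ?Q = "cbox 0 (0 + 1 *\<^sub>R One) :: 'a set"
  note QL = cube_lebesgue[OF Q]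
  obtain s where s: "0 < s" "mass w ?Q = ennreal s * vol ?Q" "avg ?Q w = ennreal s"
    by (rule weight_avg[OF assms Q])
  have "ennreal s * vol ?Q = mass (\<lambda>x. s) ?Q" using QL by (simp add: nn_integral_cmult_indicator)
  also have "\<dots> \<le> max_mass w ?Q"
  proof (rule nn_integral_mono)
    fix x
    show "ennreal s * indicator ?Q x \<le> maxop (\<lambda>y. indicator ?Q y * w y) x * indicator ?Q x"
    proof (cases "x \<in> ?Q")
      case True
      have "avg ?Q w \<le> avg ?Q (\<lambda>y. \<bar>indicator ?Q y * w y\<bar>)"
        unfolding avg_def by (intro divide_right_mono_ennreal nn_integral_mono) (auto simp: indicator_def intro!: ennreal_leI)
      also have "\<dots> \<le> maxop (\<lambda>y. indicator ?Q y * w y) x" by (rule maxop_ge_avg[OF Q True])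
      finally show ?thesis unfolding s(3) using True by simp
    qed simp
  qed
  finally have "1 \<le> max_mass w ?Q / mass w ?Q"
    unfolding s(2) using s QL by (subst ennreal_le_divide_iff) (auto simp: ennreal_mult_eq_top_iff)
  also have "\<dots> \<le> Ainf_char w" unfolding Ainf_char_def by (rule SUP_upper) (use Q in simp)
  finally show ?thesis .
qed

lemma A2_ennreal:
  assumes "A2 w"
  shows "A2_char w = ennreal (enn2real (A2_char w))" "1 \<le> enn2real (A2_char w)"
proof -
  have "A2_char w < \<infinity>" using assms by (simp add: A2_def)
  then show *: "A2_char w = ennreal (enn2real (A2_char w))" by (simp add: less_top)
  have "ennreal 1 \<le> ennreal (enn2real (A2_char w))" using A2_char_ge_1[OF assms] * by simp
  then show "1 \<le> enn2real (A2_char w)" by (subst (asm) ennreal_le_iff) auto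
qed

text \<open>\<open>enn2real\<close> maps \<open>\<infinity>\<close> to \<open>0\<close>, so bounds in terms of \<open>enn2real (Ainf_char w)\<close> need this.\<close>

lemma Ainf_finite:
  assumes "A2 w" shows "Ainf_char w < \<infinity>"
proof -
  have w: "weight w" using assms by (simp add: A2_def)
  then have wm[measurable]: "w \<in> borel_measurable lebesgue" and pos: "AE x in lebesgue. 0 < w x" by (auto simp: weight_def)
  have dw[measurable]: "dual_weight w \<in> borel_measurable lebesgue" unfolding dual_weight_def by measurable
  define A where "A = enn2real (A2_char w)"
  note A = A2_ennreal[OF assms, folded A_def]
  have "Ainf_char w \<le> 2 * 36 ^ DIM('a) * (1 + ennreal (4 * A))"
  proof (rule Ainf_char_leI[OF w])
    fix Q :: "'a set" assume Q: "cube Q"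
    then obtain a l where al: "dyadic_grid l" "Q = dyadic_grid.K a l 0 a" by (rule cubeE)
    interpret dyadic_grid a l by (rule al)
    obtain t where t: "0 < t" "mass w Q = ennreal t * vol Q"
      using weight_avg[OF w Q] by metis
    have wt: "ennreal t * vol Q0 = emeasure (wm w) Q0"
      using t(2) unfolding al(2) emeasure_wm[OF wm sets_K, symmetric] emeasure_wm_K[OF wm] emeasure_lebesgue_K by simp
    have *: "emeasure (wm w) (D n x) * emeasure (wm (dual_weight w)) (D n x) \<le> A * (vol (D n x))\<^sup>2" for n x
    proof -
      have "avg (K n x) w * avg (K n x) (dual_weight w) \<le> ennreal A"
        unfolding A(1)[symmetric] by (rule avg_mult_le_A2_char[OF cube_K])
      then have "emeasure (wm w) (D n x) / vol (D n x) * (emeasure (wm (dual_weight w)) (D n x) / vol (D n x)) \<le> ennreal A"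
        unfolding avg_def emeasure_wm[OF wm sets_K, symmetric] emeasure_wm[OF dw sets_K, symmetric] emeasure_lebesgue_K
        by (simp add: emeasure_wm_K)
      then have "emeasure (wm w) (D n x) / vol (D n x) * (emeasure (wm (dual_weight w)) (D n x) / vol (D n x)) * (vol (D n x))\<^sup>2 \<le> ennreal A * (vol (D n x))\<^sup>2"
        by (rule mult_right_mono) simp
      moreover have "u / m * (v / m) * m\<^sup>2 = u * v" if "m \<noteq> 0" "m \<noteq> top" for u v m :: ennreal
        by (metis (no_types, opaque_lifting) ennreal_divide_times ennreal_mult_divide_eq mult.commute mult.left_commute power2_eq_square that)
      ultimately show ?thesis using emeasure_D_pos[of n x] by simp
    qed
    show "max_mass w Q \<le> 2 * 36 ^ DIM('a) * (1 + ennreal (4 * A)) * mass w Q"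
      using maxop_integral_le_A2[OF wm t(1) pos wt _ *] A(2) unfolding al(2) emeasure_wm[OF wm sets_K] by simp
  qed
  also have "\<dots> < \<infinity>" by (simp add: ennreal_mult_less_top power_less_top_ennreal)
  finally show ?thesis .
qed

lemma Ainf_ennreal:
  assumes "A2 w"
  shows "Ainf_char w = ennreal (enn2real (Ainf_char w))" "1 \<le> enn2real (Ainf_char w)"
    "cube Q \<Longrightarrow> max_mass w Q \<le> ennreal (enn2real (Ainf_char w)) * mass w Q"
proof -
  have w: "weight w" using assms by (simp add: A2_def)
  show *: "Ainf_char w = ennreal (enn2real (Ainf_char w))" using Ainf_finite[OF assms] by (simp add: less_top)
  have "ennreal 1 \<le> ennreal (enn2real (Ainf_char w))" using Ainf_char_ge_1[OF w] * by simp
  then show "1 \<le> enn2real (Ainf_char w)" by (subst (asm) ennreal_le_iff) auto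
  assume Q: "cube Q"
  note QL = cube_lebesgue[OF Q]
  let ?I = "\<integral>\<^sup>+x\<in>Q. maxop (\<lambda>y. indicator Q y * w y) x \<partial>lebesgue" and ?W = "\<integral>\<^sup>+x\<in>Q. ennreal (w x) \<partial>lebesgue"
  obtain s where s: "0 < s" "?W = ennreal s * vol Q" using weight_avg[OF w Q] by metis
  then have W: "?W \<noteq> 0" "?W \<noteq> top" using QL by (auto simp: ennreal_mult_eq_top_iff)
  have "?I / ?W \<le> Ainf_char w" unfolding Ainf_char_def by (rule SUP_upper) (use Q in simp)
  then have "?I / ?W * ?W \<le> Ainf_char w * ?W" by (rule mult_right_mono) simp
  moreover have "?I / ?W * ?W = ?I" using W by (simp add: ennreal_divide_times less_top)
  ultimately show "?I \<le> ennreal (enn2real (Ainf_char w)) * ?W" using * by simp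
qed

text \<open>A real upper bound in place of the norm itself: it can be enlarged to be positive, and
  it is easily doubled when passing from \<open>b\<close> to \<open>|b|\<close>.\<close>

definition bmo_le :: "('a::euclidean_space \<Rightarrow> real) \<Rightarrow> real \<Rightarrow> bool" where
  "bmo_le b \<beta> \<longleftrightarrow> b \<in> borel_measurable lebesgue \<and> (\<forall>Q. cube Q \<longrightarrow> set_integrable lebesgue Q b) \<and>
    (\<forall>Q. cube Q \<longrightarrow> mass (\<lambda>x. \<bar>b x - cube_mean Q b\<bar>) Q \<le> ennreal \<beta> * vol Q)"

lemma reverse_Holder_cube:
  fixes w :: "'a::euclidean_space \<Rightarrow> real"
  assumes w: "A2 w" and Q: "cube Q" and \<tau>: "0 < \<tau>" "mass w Q = ennreal \<tau> * vol Q"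
    and \<delta>: "0 < \<delta>" "\<delta> * (4 * Suc DIM('a) * 2 ^ Suc DIM('a) * enn2real (Ainf_char w)) \<le> 1"
  shows "mass (\<lambda>x. w x powr (1 + \<delta>)) Q \<le> ennreal (5 * \<tau> powr (1 + \<delta>)) * vol Q"
proof -
  obtain a l where al: "dyadic_grid l" "Q = dyadic_grid.K a l 0 a" using Q by (rule cubeE)
  interpret dyadic_grid a l by (rule al)
  have wm[measurable]: "w \<in> borel_measurable lebesgue" and pos: "AE x in lebesgue. 0 < w x" using w by (auto simp: A2_def weight_def)
  have wt: "ennreal \<tau> * vol Q0 = emeasure (wm w) Q0"
    using \<tau>(2) unfolding al(2) emeasure_wm[OF wm sets_K, symmetric] emeasure_wm_K[OF wm] emeasure_lebesgue_K by simp
  have "mass (\<lambda>x. w x powr (1 + \<delta>)) Q = mass (\<lambda>x. w x powr (1 + \<delta>)) Q0"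
    unfolding al(2) by (rule nn_integral_cong_AE, use AE_D_K[of 0 a] in eventually_elim) (simp add: indicator_def)
  also have "\<dots> \<le> ennreal (5 * \<tau> powr (1 + \<delta>)) * vol Q0"
    by (rule reverse_Holder[OF wm \<tau>(1) pos wt Ainf_ennreal(2)[OF w] _ \<delta>])
      (use Ainf_ennreal(3)[OF w cube_K] in \<open>simp add: emeasure_wm\<close>)
  finally show ?thesis unfolding al(2) emeasure_lebesgue_K .
qed

text \<open>The way back from a reverse Hoelder inequality. With \<open>s - 1\<close> of order
  \<open>1 / A\<close> and \<open>R\<close> bounded, it returns a constant of order
  \<open>A\<close>.\<close>

lemma Ainf_char_le_RH:
  fixes W :: "'a::euclidean_space \<Rightarrow> real"
  assumes W: "weight W" and s: "1 < s" "s \<le> 2" and R: "0 \<le> R"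
    and RH: "\<And>Q \<tau>. cube Q \<Longrightarrow> 0 < \<tau> \<Longrightarrow> mass W Q = ennreal \<tau> * vol Q \<Longrightarrow>
       mass (\<lambda>x. W x powr s) Q \<le> ennreal (R * \<tau> powr s) * vol Q"
  shows "Ainf_char W \<le> 2 * 36 ^ DIM('a) * (1 + ennreal (12 * R / (s - 1)))"
proof (rule Ainf_char_leI[OF W])
  fix Q :: "'a set" assume Q: "cube Q"
  then obtain a l where al: "dyadic_grid l" "Q = dyadic_grid.K a l 0 a" by (rule cubeE)
  interpret dyadic_grid a l by (rule al)
  have Wm[measurable]: "W \<in> borel_measurable lebesgue" and pos: "AE x in lebesgue. 0 < W x" using W by (auto simp: weight_def)
  obtain t where t: "0 < t" "mass W Q = ennreal t * vol Q"
    using weight_avg[OF W Q] by metis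
  have wt: "ennreal t * vol Q0 = emeasure (wm W) Q0"
    using t(2) unfolding al(2) emeasure_wm[OF Wm sets_K, symmetric] emeasure_wm_K[OF Wm] emeasure_lebesgue_K by simp
  have "mass (\<lambda>x. W x powr s) Q0 = mass (\<lambda>x. W x powr s) Q"
    unfolding al(2) by (rule nn_integral_cong_AE, use AE_D_K[of 0 a] in eventually_elim) (simp add: indicator_def)
  also have "\<dots> \<le> ennreal (R * t powr s) * vol Q0"
    using RH[OF Q t] unfolding al(2) emeasure_lebesgue_K .
  finally have "mass (\<lambda>x. W x powr s) Q0 \<le> ennreal (R * t powr s) * vol Q0" .
  from maxop_integral_le_RH[OF Wm t(1) pos wt s R this]
  show "max_mass W Q \<le> 2 * 36 ^ DIM('a) * (1 + ennreal (12 * R / (s - 1))) * mass W Q"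
    unfolding al(2) emeasure_wm[OF Wm sets_K] .
qed

section \<open>Tilted weights: integrals, averages and characteristics\<close>

lemma RH_exponent_ge_1:
  assumes "1 \<le> (A::real)" shows "1 \<le> 4 * real (Suc DIM('a::euclidean_space)) * 2 ^ Suc DIM('a) * A"
proof -
  have ge: "1 \<le> x * y" if "1 \<le> x" "1 \<le> y" for x y :: real
    using mult_mono[of 1 x 1 y] that by simp
  show ?thesis by (intro ge one_le_power assms) auto
qed

text \<open>
  The constant makes \<open>6 |\<theta>| / \<delta>\<close>, the largest exponent produced by \<open>powr_exp_Young\<close>, admissible in
  \<open>John_Nirenberg\<close> for the \<open>\<delta>\<close> of \<open>reverse_Holder_cube\<close>.
\<close>

definition pert_const :: "'a::euclidean_space itself \<Rightarrow> real" where
  "pert_const _ = 72 * (2 ^ DIM('a) + 2) * Suc DIM('a) * 2 ^ Suc DIM('a)"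

abbreviation small_tilt :: "('a::euclidean_space \<Rightarrow> real) \<Rightarrow> real \<Rightarrow> real \<Rightarrow> bool" where
  "small_tilt w \<beta> \<theta> \<equiv> \<bar>\<theta>\<bar> * \<beta> * pert_const TYPE('a) * enn2real (Ainf_char w) \<le> 1"

text \<open>After normalising \<open>w\<close> by its average and \<open>b\<close> by its mean,
  \<open>powr_exp_Young\<close> separates the two factors. Reverse Hoelder and John-Nirenberg
  contribute 5 each, which gives the 10.\<close>

lemma perturbed_integral:
  fixes w b :: "'a::euclidean_space \<Rightarrow> real"
  assumes w: "A2 w" and b: "bmo_le b \<beta>" "0 < \<beta>" and Q: "cube Q"
    and \<tau>: "0 < \<tau>" "mass w Q = ennreal \<tau> * vol Q"
    and \<delta>: "\<delta> = 1 / (4 * Suc DIM('a) * 2 ^ Suc DIM('a) * enn2real (Ainf_char w))"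
    and \<theta>: "small_tilt w \<beta> \<theta>"
    and s: "1 \<le> s" "s \<le> 1 + \<delta> / 2"
  shows "mass (\<lambda>x. (w x * exp (\<theta> * b x)) powr s) Q
    \<le> ennreal (10 * (\<tau> * exp (\<theta> * cube_mean Q b)) powr s) * vol Q"
proof -
  note QL = cube_lebesgue[OF Q]
  define A where "A = enn2real (Ainf_char w)"
  define m where "m = cube_mean Q b"
  have A: "1 \<le> A" unfolding A_def by (rule Ainf_ennreal(2)[OF w])
  define H where "H = 4 * real (Suc DIM('a)) * 2 ^ Suc DIM('a) * A"
  have H: "1 \<le> H" unfolding H_def by (rule RH_exponent_ge_1[OF A])
  have \<delta>H: "\<delta> = 1 / H" using \<delta> by (simp add: H_def A_def)
  have \<delta>0: "0 < \<delta>" "\<delta> \<le> 1" "\<delta> * H \<le> 1" unfolding \<delta>H using H by auto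
  have wm[measurable]: "w \<in> borel_measurable lebesgue" and pos: "AE x in lebesgue. 0 < w x" using w by (auto simp: A2_def weight_def)
  have bm[measurable]: "b \<in> borel_measurable lebesgue" using b by (simp add: bmo_le_def)
  define c where "c = \<bar>\<theta>\<bar> * s * (2 * s / \<delta> + 1)"
  have c0: "0 \<le> c" using s \<delta>0 by (auto simp: c_def)
  \<comment> \<open>The bound \<open>6 / \<delta> = 6 H\<close> is the exponent that
    \<open>pert_const\<close> is made for: 72 is this 6, times the 3 of
    \<open>John_Nirenberg\<close>, times the 4 in \<open>H\<close>.\<close>
  have "s * (2 * s / \<delta> + 1) \<le> (3 / 2) * (4 / \<delta>)"
  proof (rule mult_mono)
    show "s \<le> 3 / 2" using s \<delta>0 by simp
    have "2 * s / \<delta> + 1 \<le> 3 / \<delta> + 1 / \<delta>"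
      using s \<delta>0 by (intro add_mono divide_right_mono) (auto simp: field_simps)
    then show "2 * s / \<delta> + 1 \<le> 4 / \<delta>" by (simp add: add_divide_distrib[symmetric])
  qed (use s \<delta>0 in auto)
  then have "c \<le> \<bar>\<theta>\<bar> * (6 * H)"
    unfolding c_def mult.assoc using mult_left_mono[of "s * (2 * s / \<delta> + 1)" "6 * H" "\<bar>\<theta>\<bar>"] by (simp add: \<delta>H)
  then have "c * (3 * (2 ^ DIM('a) + 2) * \<beta>) \<le> \<bar>\<theta>\<bar> * (6 * H) * (3 * (2 ^ DIM('a) + 2) * \<beta>)"
    using b(2) by (intro mult_right_mono mult_nonneg_nonneg add_nonneg_nonneg) auto
  also have "\<dots> = \<bar>\<theta>\<bar> * \<beta> * pert_const TYPE('a) * A" by (simp add: H_def pert_const_def algebra_simps)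
  also have "\<dots> \<le> 1" using \<theta> by (simp add: A_def)
  finally have c1: "c * (3 * (2 ^ DIM('a) + 2) * \<beta>) \<le> 1" .
  have JN: "mass (\<lambda>x. exp (c * \<bar>b x - m\<bar>)) Q \<le> 5 * vol Q"
    unfolding m_def by (rule John_Nirenberg[OF bm _ b(2) _ Q c0 c1]) (use b in \<open>auto simp: bmo_le_def\<close>)
  have RH: "mass (\<lambda>x. w x powr (1 + \<delta>)) Q \<le> ennreal (5 * \<tau> powr (1 + \<delta>)) * vol Q"
    by (rule reverse_Holder_cube[OF w Q \<tau> \<delta>0(1)]) (use \<delta>0(3) in \<open>simp add: H_def A_def\<close>)
  define T where "T = (\<tau> * exp (\<theta> * m)) powr s"
  have T: "0 \<le> T" by (simp add: T_def)
  have pw: "(u * exp (\<theta> * y)) powr s \<le> T * (\<tau> powr (- (1 + \<delta>)) * u powr (1 + \<delta>) + exp (c * \<bar>y - m\<bar>))" if u: "0 < u" for u y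
  proof -
    have "(u * exp (\<theta> * y)) powr s = T * ((u / \<tau>) powr s * exp (s * \<theta> * (y - m)))"
    proof -
      have "exp (\<theta> * y) = exp (\<theta> * m) * exp (\<theta> * (y - m))" by (simp add: exp_add[symmetric] algebra_simps)
      then have "u * exp (\<theta> * y) = (\<tau> * exp (\<theta> * m)) * ((u / \<tau>) * exp (\<theta> * (y - m)))" using \<tau> by simp
      also have "\<dots> powr s = T * ((u / \<tau>) powr s * exp (\<theta> * (y - m)) powr s)"
        unfolding T_def using \<tau> u by (simp add: powr_mult powr_divide)
      also have "exp (\<theta> * (y - m)) powr s = exp (s * \<theta> * (y - m))" by (simp add: exp_powr_real mult_ac)
      finally show ?thesis .
    qed
    also have "\<dots> \<le> T * ((u / \<tau>) powr (1 + \<delta>) + exp (\<bar>s * \<theta> * (y - m)\<bar> * (2 * s / \<delta> + 1)))"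
      using u \<tau> T \<delta>0 s by (intro mult_left_mono powr_exp_Young) auto
    also have "\<bar>s * \<theta> * (y - m)\<bar> * (2 * s / \<delta> + 1) = c * \<bar>y - m\<bar>"
      unfolding c_def using s by (simp add: abs_mult mult_ac)
    also have "(u / \<tau>) powr p = \<tau> powr (- p) * u powr p" for p
      using u \<tau> by (simp add: powr_divide powr_minus_divide)
    finally show ?thesis .
  qed
  have "mass (\<lambda>x. (w x * exp (\<theta> * b x)) powr s) Q \<le>
    (\<integral>\<^sup>+x. ennreal T * (ennreal (\<tau> powr (- (1 + \<delta>))) * (ennreal (w x powr (1 + \<delta>)) * indicator Q x) + ennreal (exp (c * \<bar>b x - m\<bar>)) * indicator Q x) \<partial>lebesgue)"
  proof (rule nn_integral_mono_AE, use pos in eventually_elim)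
    fix x assume "0 < w x"
    from pw[OF this, of "b x"] have "ennreal ((w x * exp (\<theta> * b x)) powr s) \<le> ennreal T * (ennreal (\<tau> powr (- (1 + \<delta>))) * ennreal (w x powr (1 + \<delta>)) + ennreal (exp (c * \<bar>b x - m\<bar>)))"
      using T by (simp flip: ennreal_plus ennreal_mult' add: ennreal_leI)
    then show "ennreal ((w x * exp (\<theta> * b x)) powr s) * indicator Q x \<le> ennreal T * (ennreal (\<tau> powr (- (1 + \<delta>))) * (ennreal (w x powr (1 + \<delta>)) * indicator Q x) + ennreal (exp (c * \<bar>b x - m\<bar>)) * indicator Q x)"
      by (auto simp: indicator_def)
  qed
  also have "\<dots> = ennreal T * (ennreal (\<tau> powr (- (1 + \<delta>))) * mass (\<lambda>x. w x powr (1 + \<delta>)) Q + mass (\<lambda>x. exp (c * \<bar>b x - m\<bar>)) Q)"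
    using QL(1) by (simp add: nn_integral_cmult nn_integral_add)
  also have "\<dots> \<le> ennreal T * (ennreal (\<tau> powr (- (1 + \<delta>))) * (ennreal (5 * \<tau> powr (1 + \<delta>)) * vol Q) + 5 * vol Q)"
    by (intro mult_left_mono add_mono RH JN) auto
  also have "ennreal (\<tau> powr (- (1 + \<delta>))) * (ennreal (5 * \<tau> powr (1 + \<delta>)) * vol Q) = 5 * vol Q"
  proof -
    have "\<tau> powr (- p) * (5 * \<tau> powr p) = 5" for p using \<tau> by (simp add: powr_minus)
    from this[of "1 + \<delta>"] have "\<tau> powr (- (1 + \<delta>)) * (5 * \<tau> powr (1 + \<delta>)) = 5" .
    moreover have "ennreal (\<tau> powr (- (1 + \<delta>))) * ennreal (5 * \<tau> powr (1 + \<delta>)) = ennreal (\<tau> powr (- (1 + \<delta>)) * (5 * \<tau> powr (1 + \<delta>)))"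
      by (rule ennreal_mult'[symmetric]) simp
    ultimately have "ennreal (\<tau> powr (- (1 + \<delta>))) * ennreal (5 * \<tau> powr (1 + \<delta>)) = 5" by (simp only: ennreal_numeral)
    then show ?thesis by (simp add: mult.assoc[symmetric])
  qed
  also have "ennreal T * (5 * vol Q + 5 * vol Q) = ennreal (10 * T) * vol Q"
    using T by (simp add: ennreal_mult' distrib_right[symmetric] mult_ac)
  finally show ?thesis unfolding T_def m_def .
qed

lemma perturbed_integral_1:
  fixes w b :: "'a::euclidean_space \<Rightarrow> real"
  assumes w: "A2 w" and b: "bmo_le b \<beta>" "0 < \<beta>" and Q: "cube Q"
    and \<tau>: "0 < \<tau>" "mass w Q = ennreal \<tau> * vol Q"
    and \<theta>: "small_tilt w \<beta> \<theta>"
  shows "mass (tilt w b \<theta>) Q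
    \<le> ennreal (10 * (\<tau> * exp (\<theta> * cube_mean Q b))) * vol Q"
proof -
  have pos: "AE x in lebesgue. 0 < w x" using w by (auto simp: A2_def weight_def)
  have "mass (tilt w b \<theta>) Q = mass (\<lambda>x. (w x * exp (\<theta> * b x)) powr 1) Q"
    by (rule nn_integral_cong_AE, use pos in eventually_elim) simp
  also have "\<dots> \<le> ennreal (10 * (\<tau> * exp (\<theta> * cube_mean Q b)) powr 1) * vol Q"
    using Ainf_ennreal(2)[OF w] by (intro perturbed_integral[OF w b Q \<tau> refl \<theta>]) auto
  finally show ?thesis using \<tau> by simp
qed

lemma perturbed_weight:
  fixes w b :: "'a::euclidean_space \<Rightarrow> real"
  assumes w: "A2 w" and b: "bmo_le b \<beta>" "0 < \<beta>"
    and \<theta>: "small_tilt w \<beta> \<theta>"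
  shows "weight (tilt w b \<theta>)"
  unfolding weight_def
proof (intro conjI allI impI)
  have wm[measurable]: "w \<in> borel_measurable lebesgue" and pos: "AE x in lebesgue. 0 < w x" using w by (auto simp: A2_def weight_def)
  have bm[measurable]: "b \<in> borel_measurable lebesgue" using b by (simp add: bmo_le_def)
  show "(tilt w b \<theta>) \<in> borel_measurable lebesgue" by measurable
  show "AE x in lebesgue. 0 < w x * exp (\<theta> * b x)" using pos by eventually_elim simp
  fix Q :: "'a set" assume Q: "cube Q"
  note QL = cube_lebesgue[OF Q]
  obtain \<tau> where \<tau>: "0 < \<tau>" "mass w Q = ennreal \<tau> * vol Q"
    using weight_avg[OF _ Q] w unfolding A2_def by metis
  have "(\<integral>\<^sup>+x. ennreal (norm (indicator Q x *\<^sub>R (w x * exp (\<theta> * b x)))) \<partial>lebesgue) = mass (tilt w b \<theta>) Q"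
    by (rule nn_integral_cong_AE, use pos in eventually_elim) (auto simp: indicator_def)
  also have "\<dots> \<le> ennreal (10 * (\<tau> * exp (\<theta> * cube_mean Q b))) * vol Q"
    by (rule perturbed_integral_1[OF w b Q \<tau> \<theta>])
  also have "\<dots> < \<infinity>" using QL by (simp add: ennreal_mult_less_top)
  finally show "set_integrable lebesgue Q (tilt w b \<theta>)"
    using QL unfolding set_integrable_def by (intro integrableI_bounded) auto
qed

text \<open>Cauchy-Schwarz writes \<open>w\<close> as the geometric mean of its tilts by
  \<open>\<theta>\<close> and \<open>-\<theta>\<close>; the upper bound for the latter yields a
  lower bound for the former.\<close>

lemma perturbed_avg_lower:
  fixes w b :: "'a::euclidean_space \<Rightarrow> real"
  assumes w: "A2 w" and b: "bmo_le b \<beta>" "0 < \<beta>" and Q: "cube Q"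
    and \<tau>: "0 < \<tau>" "mass w Q = ennreal \<tau> * vol Q"
    and T: "0 < T" "mass (tilt w b \<theta>) Q = ennreal T * vol Q"
    and \<theta>: "small_tilt w \<beta> \<theta>"
  shows "\<tau> * exp (\<theta> * cube_mean Q b) \<le> 10 * T"
proof -
  have wm[measurable]: "w \<in> borel_measurable lebesgue" and pos: "AE x in lebesgue. 0 < w x" using w by (auto simp: A2_def weight_def)
  have bm[measurable]: "b \<in> borel_measurable lebesgue" using b by (simp add: bmo_le_def)
  note QL = cube_lebesgue[OF Q]
  have [measurable]: "Q \<in> sets lebesgue" by (rule QL)
  define m where "m = cube_mean Q b"
  let ?f = "\<lambda>x. ennreal (sqrt (w x * exp (\<theta> * b x))) * indicator Q x" and ?g = "\<lambda>x. ennreal (sqrt (w x * exp (- \<theta> * b x))) * indicator Q x"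
  have "(\<integral>\<^sup>+x. ?f x * ?g x \<partial>lebesgue)\<^sup>2 \<le> (\<integral>\<^sup>+x. (?f x)\<^sup>2 \<partial>lebesgue) * (\<integral>\<^sup>+x. (?g x)\<^sup>2 \<partial>lebesgue)"
    by (rule Cauchy_Schwarz_nn_integral) auto
  also have "(\<integral>\<^sup>+x. ?f x * ?g x \<partial>lebesgue) = mass w Q"
  proof (rule nn_integral_cong_AE, use pos in eventually_elim)
    fix x assume w0: "0 < w x"
    then have "sqrt (w x * exp (\<theta> * b x)) * sqrt (w x * exp (- \<theta> * b x)) = w x"
      unfolding real_sqrt_mult[symmetric] by (simp add: mult_ac exp_add[symmetric])
    then show "?f x * ?g x = ennreal (w x) * indicator Q x" using w0
      by (auto simp: indicator_def simp flip: ennreal_mult)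
  qed
  also have "(\<integral>\<^sup>+x. (?f x)\<^sup>2 \<partial>lebesgue) = ennreal T * vol Q"
    unfolding T(2)[symmetric]
    by (rule nn_integral_cong_AE, use pos in eventually_elim) (auto simp: indicator_def ennreal_power)
  also have "(\<integral>\<^sup>+x. (?g x)\<^sup>2 \<partial>lebesgue) = mass (tilt w b (- \<theta>)) Q"
    by (rule nn_integral_cong_AE, use pos in eventually_elim) (auto simp: indicator_def ennreal_power)
  also have "ennreal T * vol Q * mass (tilt w b (- \<theta>)) Q
    \<le> ennreal T * vol Q * (ennreal (10 * (\<tau> * exp (- \<theta> * m))) * vol Q)"
    unfolding m_def by (intro mult_left_mono perturbed_integral_1[OF w b Q \<tau>]) (use \<theta> in auto)
  finally have "(\<tau> * measure lebesgue Q)\<^sup>2 \<le> (T * measure lebesgue Q) * ((10 * (\<tau> * exp (- \<theta> * m))) * measure lebesgue Q)"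
    unfolding \<tau>(2) QL(5) using \<tau> T by (simp add: ennreal_power flip: ennreal_mult')
  also have "(T * measure lebesgue Q) * ((10 * (\<tau> * exp (- \<theta> * m))) * measure lebesgue Q) = (\<tau> * (measure lebesgue Q)\<^sup>2) * (10 * T * exp (- \<theta> * m))"
    by (simp add: power2_eq_square)
  also have "(\<tau> * measure lebesgue Q)\<^sup>2 = (\<tau> * (measure lebesgue Q)\<^sup>2) * \<tau>" by (simp add: power2_eq_square)
  finally have "\<tau> \<le> 10 * T * exp (- \<theta> * m)" using \<tau> QL by (subst (asm) mult_le_cancel_left_pos) auto
  then have "\<tau> * exp (\<theta> * m) \<le> 10 * T * exp (- \<theta> * m) * exp (\<theta> * m)" by (intro mult_right_mono) auto
  also have "\<dots> = 10 * T" by (simp add: exp_add[symmetric] mult.assoc)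
  finally show ?thesis by (simp add: m_def)
qed

text \<open>\<open>2 * 36^d\<close> comes from the maximal function estimate; 24000 is
  \<open>12 * 1000 * 2\<close>, the 2 because only the gain \<open>1 / (2 H)\<close> is left, and
  24001 also absorbs the summand 1; the last factor is \<open>H / A\<close>.\<close>

definition Ainf_const :: "'a::euclidean_space itself \<Rightarrow> real" where
  "Ainf_const _ = 2 * 36 ^ DIM('a) * 24001 * (4 * Suc DIM('a) * 2 ^ Suc DIM('a))"

lemma Ainf_char_perturbed:
  fixes w b :: "'a::euclidean_space \<Rightarrow> real"
  assumes w: "A2 w" and b: "bmo_le b \<beta>" "0 < \<beta>"
    and \<theta>: "small_tilt w \<beta> \<theta>"
  shows "Ainf_char (tilt w b \<theta>) \<le> ennreal (Ainf_const TYPE('a) * enn2real (Ainf_char w))"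
proof -
  define A where "A = enn2real (Ainf_char w)"
  have A: "1 \<le> A" unfolding A_def by (rule Ainf_ennreal(2)[OF w])
  define H where "H = 4 * real (Suc DIM('a)) * 2 ^ Suc DIM('a) * A"
  have H: "1 \<le> H" unfolding H_def by (rule RH_exponent_ge_1[OF A])
  \<comment> \<open>Half of the reverse Hoelder gain \<open>1 / H\<close> of \<open>w\<close>; the
    other half is spent on the exponential.\<close>
  define s where "s = 1 + 1 / (2 * H)"
  have s: "1 < s" "s \<le> 2" using H by (auto simp: s_def)
  have "Ainf_char (tilt w b \<theta>) \<le> 2 * 36 ^ DIM('a) * (1 + ennreal (12 * 1000 / (s - 1)))"
  proof (rule Ainf_char_le_RH[OF perturbed_weight[OF w b \<theta>] s])
    fix Q :: "'a set" and T :: real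
    assume Q: "cube Q" and T: "0 < T" "mass (tilt w b \<theta>) Q = ennreal T * vol Q"
    obtain \<tau> where \<tau>: "0 < \<tau>" "mass w Q = ennreal \<tau> * vol Q"
      using weight_avg[OF _ Q] w unfolding A2_def by metis
    have "mass (\<lambda>x. (w x * exp (\<theta> * b x)) powr s) Q \<le> ennreal (10 * (\<tau> * exp (\<theta> * cube_mean Q b)) powr s) * vol Q"
      by (rule perturbed_integral[OF w b Q \<tau> refl \<theta>]) (use s in \<open>auto simp: s_def H_def A_def\<close>)
    \<comment> \<open>Passing to the average \<open>T\<close> of the tilted weight itself costs
      \<open>10 powr s\<close>, at most 100, on top of the 10.\<close>
    also have "\<dots> \<le> ennreal (1000 * T powr s) * vol Q"
    proof (intro mult_right_mono ennreal_leI)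
      have "(\<tau> * exp (\<theta> * cube_mean Q b)) powr s \<le> (10 * T) powr s"
        using perturbed_avg_lower[OF w b Q \<tau> T \<theta>] \<tau> s by (intro powr_mono2) auto
      also have "\<dots> = 10 powr s * T powr s" using T by (simp add: powr_mult)
      also have "\<dots> \<le> 10 powr 2 * T powr s" using s by (intro mult_right_mono powr_mono) auto
      finally show "10 * (\<tau> * exp (\<theta> * cube_mean Q b)) powr s \<le> 1000 * T powr s" by simp
    qed auto
    finally show "mass (\<lambda>x. (w x * exp (\<theta> * b x)) powr s) Q \<le> ennreal (1000 * T powr s) * vol Q" .
  qed auto
  also have "12 * 1000 / (s - 1) = 24000 * H" using H by (simp add: s_def)
  also have "2 * 36 ^ DIM('a) * (1 + ennreal (24000 * H)) = ennreal (2 * 36 ^ DIM('a) * (1 + 24000 * H))"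
  proof -
    have "ennreal (2 * 36 ^ DIM('a)) = 2 * 36 ^ DIM('a)"
      by (subst ennreal_mult') (simp, metis ennreal_numeral ennreal_power zero_le_numeral)
    moreover have "ennreal (1 + 24000 * H) = 1 + ennreal (24000 * H)" using H by (subst ennreal_plus) auto
    ultimately show ?thesis by (subst ennreal_mult') auto
  qed
  also have "\<dots> \<le> ennreal (2 * 36 ^ DIM('a) * (24001 * H))"
    using H by (intro ennreal_leI mult_left_mono) auto
  also have "2 * 36 ^ DIM('a) * (24001 * H) = Ainf_const TYPE('a) * A"
    by (simp add: Ainf_const_def H_def mult_ac)
  finally show ?thesis by (simp add: A_def)
qed

lemma dual_perturbed: "dual_weight (tilt w b \<theta>) = (tilt (dual_weight w) b (- \<theta>))"
  by (simp add: dual_weight_def exp_minus field_simps fun_eq_iff)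

text \<open>The averages of the tilt and of its dual each lose a factor 10, and the exponentials of
  the mean of \<open>b\<close> cancel in the product.\<close>

lemma A2_perturbed:
  fixes w b :: "'a::euclidean_space \<Rightarrow> real"
  assumes w: "A2 w" and b: "bmo_le b \<beta>" "0 < \<beta>"
    and \<theta>: "small_tilt w \<beta> \<theta>"
      "small_tilt (dual_weight w) \<beta> \<theta>"
  shows "A2 (tilt w b \<theta>)" "A2_char (tilt w b \<theta>) \<le> 100 * A2_char w"
proof -
  show le: "A2_char (tilt w b \<theta>) \<le> 100 * A2_char w"
    unfolding A2_char_def[of "\<lambda>x. w x * exp (\<theta> * b x)"]
  proof (rule SUP_least)
    fix Q :: "'a set" assume "Q \<in> {Q. cube Q}"
    then have Q: "cube Q" by simp
    note QL = cube_lebesgue[OF Q]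
    have sw: "weight w" "weight (dual_weight w)" using w A2_dual[OF w] by (auto simp: A2_def)
    obtain \<tau> where \<tau>: "0 < \<tau>" "mass w Q = ennreal \<tau> * vol Q" "avg Q w = ennreal \<tau>"
      by (rule weight_avg[OF sw(1) Q])
    obtain \<sigma> where \<sigma>: "0 < \<sigma>" "mass (dual_weight w) Q = ennreal \<sigma> * vol Q" "avg Q (dual_weight w) = ennreal \<sigma>"
      by (rule weight_avg[OF sw(2) Q])
    let ?e = "exp (\<theta> * cube_mean Q b)"
    have 1: "avg Q (tilt w b \<theta>) \<le> ennreal (10 * (\<tau> * ?e))"
      unfolding avg_def using perturbed_integral_1[OF w b Q \<tau>(1,2) \<theta>(1)] QL
      by (intro divide_le_posI_ennreal) (auto simp: mult.commute)
    have 2: "avg Q (tilt (dual_weight w) b (- \<theta>)) \<le> ennreal (10 * (\<sigma> * exp (- \<theta> * cube_mean Q b)))"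
      unfolding avg_def using perturbed_integral_1[OF A2_dual[OF w] b Q \<sigma>(1,2), of "- \<theta>"] \<theta>(2) QL
      by (intro divide_le_posI_ennreal) (auto simp: mult.commute)
    have "avg Q (tilt w b \<theta>) * avg Q (dual_weight (tilt w b \<theta>)) \<le>
      ennreal (10 * (\<tau> * ?e)) * ennreal (10 * (\<sigma> * exp (- \<theta> * cube_mean Q b)))"
      unfolding dual_perturbed by (rule mult_mono[OF 1 2]) auto
    also have "\<dots> = ennreal (100 * (\<tau> * \<sigma>))"
      using \<tau> \<sigma> by (simp add: exp_minus flip: ennreal_mult')
    also have "\<dots> = 100 * (avg Q w * avg Q (dual_weight w))"
      unfolding \<tau> \<sigma> using \<tau> \<sigma> by (simp add: ennreal_mult')
    also have "\<dots> \<le> 100 * A2_char w" by (intro mult_left_mono avg_mult_le_A2_char[OF Q]) auto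
    finally show "avg Q (tilt w b \<theta>) * avg Q (dual_weight (tilt w b \<theta>)) \<le> 100 * A2_char w" .
  qed
  have "100 * A2_char w < \<infinity>" using w by (simp add: A2_def ennreal_mult_less_top)
  then show "A2 (tilt w b \<theta>)"
    unfolding A2_def using le perturbed_weight[OF w b \<theta>(1)] by auto
qed

text \<open>The values of \<open>|b|\<close> oscillate about \<open>|cube_mean Q b|\<close> no more
  than \<open>b\<close> about its mean; replacing that constant by the mean of \<open>|b|\<close> at
  most doubles the bound. This makes the tilt by \<open>|b|\<close> available as auxiliary
  weight.\<close>

lemma bmo_le_abs:
  assumes "bmo_le b \<beta>" "0 < \<beta>" shows "bmo_le (\<lambda>x. \<bar>b x\<bar>) (2 * \<beta>)"
  unfolding bmo_le_def
proof (intro conjI allI impI)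
  have bm[measurable]: "b \<in> borel_measurable lebesgue" using assms by (simp add: bmo_le_def)
  show "(\<lambda>x. \<bar>b x\<bar>) \<in> borel_measurable lebesgue" by measurable
  fix Q :: "'a set" assume Q: "cube Q"
  note QL = cube_lebesgue[OF Q]
  have [measurable]: "Q \<in> sets lebesgue" by (rule QL)
  have bi: "set_integrable lebesgue Q b" using assms Q by (simp add: bmo_le_def)
  then show ai: "set_integrable lebesgue Q (\<lambda>x. \<bar>b x\<bar>)" by (rule set_integrable_abs)
  define c where "c = \<bar>cube_mean Q b\<bar>"
  let ?m = "cube_mean Q (\<lambda>x. \<bar>b x\<bar>)"
  let ?I = "\<integral>\<^sup>+x\<in>Q. ennreal \<bar>\<bar>b x\<bar> - c\<bar> \<partial>lebesgue"
  have "?I \<le> mass (\<lambda>x. \<bar>b x - cube_mean Q b\<bar>) Q"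
    unfolding c_def by (intro nn_integral_mono mult_right_mono ennreal_leI) auto
  also have "\<dots> \<le> ennreal \<beta> * vol Q" using assms Q by (simp add: bmo_le_def)
  finally have I: "?I \<le> ennreal \<beta> * vol Q" .
  have "mass (\<lambda>x. \<bar>\<bar>b x\<bar> - ?m\<bar>) Q \<le> (\<integral>\<^sup>+x. ennreal \<bar>\<bar>b x\<bar> - c\<bar> * indicator Q x + ennreal \<bar>?m - c\<bar> * indicator Q x \<partial>lebesgue)"
  proof (rule nn_integral_mono)
    fix x
    have tri: "\<bar>u - v\<bar> \<le> \<bar>u - z\<bar> + \<bar>v - z\<bar>" for u v z :: real by linarith
    have "ennreal \<bar>\<bar>b x\<bar> - ?m\<bar> \<le> ennreal (\<bar>\<bar>b x\<bar> - c\<bar> + \<bar>?m - c\<bar>)"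
      by (rule ennreal_leI[OF tri])
    also have "\<dots> = ennreal \<bar>\<bar>b x\<bar> - c\<bar> + ennreal \<bar>?m - c\<bar>"
      by (rule ennreal_plus[OF abs_ge_zero abs_ge_zero])
    finally show "ennreal \<bar>\<bar>b x\<bar> - ?m\<bar> * indicator Q x \<le> ennreal \<bar>\<bar>b x\<bar> - c\<bar> * indicator Q x + ennreal \<bar>?m - c\<bar> * indicator Q x"
      by (cases "x \<in> Q") auto
  qed
  also have "\<dots> = ?I + ennreal \<bar>?m - c\<bar> * vol Q"
    by (subst nn_integral_add) (auto simp: nn_integral_cmult)
  also have "\<dots> \<le> ?I + ?I" by (intro add_left_mono cube_mean_dev[OF Q ai])
  also have "\<dots> \<le> ennreal \<beta> * vol Q + ennreal \<beta> * vol Q" by (intro add_mono I)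
  also have "\<dots> = (ennreal \<beta> + ennreal \<beta>) * vol Q" by (simp only: distrib_right)
  also have "ennreal \<beta> + ennreal \<beta> = ennreal (2 * \<beta>)" using assms(2) by (simp flip: ennreal_plus)
  finally show "mass (\<lambda>x. \<bar>\<bar>b x\<bar> - ?m\<bar>) Q \<le> ennreal (2 * \<beta>) * vol Q" .
qed

section \<open>Cauchy estimates for iterated commutators\<close>

abbreviation bounded_on :: "(('a::euclidean_space \<Rightarrow> complex) \<Rightarrow> 'a \<Rightarrow> complex) \<Rightarrow> ('a \<Rightarrow> real) \<Rightarrow> real \<Rightarrow> bool" where
  "bounded_on T w C \<equiv> \<forall>g\<in>L2w w. T g \<in> borel_measurable lebesgue \<and> L2w_norm2 w (T g) \<le> ennreal (C\<^sup>2) * L2w_norm2 w g"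

text \<open>Pascal's rule. The sum is, up to \<open>k!\<close>, the coefficient of
  \<open>z^k\<close> in the product of the two exponential series.\<close>

lemma iter_comm_expand:
  "iter_comm k b T f x =
    (\<Sum>n\<le>k. of_nat (k choose n) * ((-1) ^ n * of_real (b x) ^ (k - n) * T (\<lambda>y. of_real (b y) ^ n * f y) x))"
proof (induction k arbitrary: f)
  case (Suc k)
  define t where "t n = (-1) ^ n * of_real (b x) ^ (Suc k - n) * T (\<lambda>y. of_real (b y) ^ n * f y) x" for n
  have "of_real (b x) * iter_comm k b T f x = (\<Sum>n\<le>k. of_nat (k choose n) * t n)"
    unfolding Suc.IH sum_distrib_left
    by (intro sum.cong refl) (auto simp: t_def Suc_diff_le mult_ac)
  also have "\<dots> = (\<Sum>n\<le>Suc k. of_nat (k choose n) * t n)" by simp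
  also have "\<dots> = t 0 + (\<Sum>n\<le>k. of_nat (k choose Suc n) * t (Suc n))"
    by (subst sum.atMost_Suc_shift) simp
  finally have 1: "of_real (b x) * iter_comm k b T f x = t 0 + (\<Sum>n\<le>k. of_nat (k choose Suc n) * t (Suc n))" .
  have 2: "iter_comm k b T (\<lambda>y. of_real (b y) * f y) x = - (\<Sum>n\<le>k. of_nat (k choose n) * t (Suc n))"
    unfolding Suc.IH sum_negf[symmetric] by (intro sum.cong refl) (auto simp: t_def mult_ac)
  have "iter_comm (Suc k) b T f x = of_real (b x) * iter_comm k b T f x - iter_comm k b T (\<lambda>y. of_real (b y) * f y) x"
    by (simp add: commutator_def)
  also have "\<dots> = t 0 + (\<Sum>n\<le>k. of_nat (Suc k choose Suc n) * t (Suc n))"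
    unfolding 1 2 by (simp add: sum.distrib algebra_simps)
  also have "\<dots> = (\<Sum>n\<le>Suc k. of_nat (Suc k choose n) * t n)"
    by (subst sum.atMost_Suc_shift) simp
  finally show ?case unfolding t_def .
qed simp

text \<open>
  No joint measurability of \<open>T (e\<^sup>-\<^sup>z\<^sup>b f)\<close> in \<open>(x, z)\<close> is available, so Cauchy integrals are replaced by averages over
  roots of unity, which extract coefficients of polynomials exactly.
\<close>

definition circ_pt :: "real \<Rightarrow> nat \<Rightarrow> nat \<Rightarrow> complex" where
  "circ_pt r N j = of_real r * exp (2 * of_real pi * \<i> * of_nat j / of_nat N)"

lemma norm_circ_pt [simp]: "0 < r \<Longrightarrow> cmod (circ_pt r N j) = r"
proof -
  have "2 * of_real pi * \<i> * of_nat j / of_nat N = \<i> * of_real (2 * pi * real j / real N)" by simp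
  then have "cmod (exp (2 * of_real pi * \<i> * of_nat j / of_nat N)) = 1"
    by (metis norm_exp_i_times)
  then show "0 < r \<Longrightarrow> cmod (circ_pt r N j) = r" by (simp add: circ_pt_def norm_mult)
qed

text \<open>Orthogonality of characters on the roots of unity; \<open>i\<close> and \<open>k\<close>
  below \<open>N\<close> exclude aliasing.\<close>

lemma circ_pt_extract:
  assumes r: "0 < r" and N: "i < N" "k < N"
  shows "(\<Sum>j<N. circ_pt r N j ^ i / circ_pt r N j ^ k) = (if i = k then of_nat N else 0)"
proof (cases "i = k")
  case True
  have "circ_pt r N j \<noteq> 0" for j using r by (simp add: circ_pt_def)
  then show ?thesis using True by simp
next
  case False
  define q where "q = exp (2 * of_real pi * \<i> * of_nat i / of_nat N) / exp (2 * of_real pi * \<i> * of_nat k / of_nat N)"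
  have "q \<noteq> 1"
    using complex_root_unity_eq[of N i k] False N by (auto simp: q_def cong_def)
  have "exp (2 * of_real pi * \<i> * of_nat m / of_nat N) ^ N = 1" for m
    using complex_root_unity[of N m] N by auto
  then have qN: "q ^ N = 1" by (simp add: q_def power_divide)
  have "circ_pt r N j ^ i / circ_pt r N j ^ k = of_real r ^ i / of_real r ^ k * q ^ j" for j
    by (simp add: circ_pt_def q_def power_mult_distrib power_divide mult_ac flip: exp_of_nat_mult)
  then have "(\<Sum>j<N. circ_pt r N j ^ i / circ_pt r N j ^ k) = of_real r ^ i / of_real r ^ k * (\<Sum>j<N. q ^ j)"
    by (simp add: sum_distrib_left)
  also have "(\<Sum>j<N. q ^ j) = 0" using \<open>q \<noteq> 1\<close> qN by (simp add: sum_gp_strict)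
  finally show ?thesis using False by simp
qed

section \<open>Truncated exponentials and an exact discrete Cauchy formula\<close>

definition exp_poly :: "nat \<Rightarrow> 'a::{real_normed_field,banach} \<Rightarrow> 'a" where
  "exp_poly n x = (\<Sum>m<n. x ^ m / fact m)"

definition exp_tail :: "nat \<Rightarrow> real \<Rightarrow> real" where
  "exp_tail n y = exp y - exp_poly n y"

lemma exp_sums: "(\<lambda>m. x ^ m / fact m) sums exp (x::'a::{real_normed_field,banach})"
  using exp_converges[of x] by (simp add: scaleR_conv_of_real divide_inverse mult.commute)

lemma norm_exp_poly_le: "norm (exp_poly n (x::complex)) \<le> exp_poly n (norm x)"
  unfolding exp_poly_def by (rule order_trans[OF norm_sum]) (simp add: norm_divide norm_power)

lemma exp_poly_le_exp: "0 \<le> y \<Longrightarrow> exp_poly n y \<le> exp (y::real)"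
  unfolding exp_poly_def using exp_sums[of y] by (intro sum_le_suminf[of "\<lambda>m. y ^ m / fact m" "{..<n}", THEN order_trans])
   (auto simp: sums_iff)

lemma exp_poly_nonneg: "0 \<le> y \<Longrightarrow> 0 \<le> exp_poly n (y::real)"
  unfolding exp_poly_def by (intro sum_nonneg) auto

lemma exp_tail_bounds: "0 \<le> y \<Longrightarrow> 0 \<le> exp_tail n y" "0 \<le> y \<Longrightarrow> exp_tail n y \<le> exp y"
  using exp_poly_le_exp[of y n] exp_poly_nonneg[of y n] by (auto simp: exp_tail_def)

lemma exp_tail_tendsto: "(\<lambda>n. exp_tail n y) \<longlonglongrightarrow> 0"
proof -
  have "(\<lambda>n. exp_poly n y) \<longlonglongrightarrow> exp y" using exp_sums[of y] by (simp add: sums_def exp_poly_def)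
  then have "(\<lambda>n. exp y - exp_poly n y) \<longlonglongrightarrow> exp y - exp y" by (intro tendsto_intros)
  then show ?thesis by (simp add: exp_tail_def)
qed

lemma exp_tail_mono: "0 \<le> x \<Longrightarrow> x \<le> y \<Longrightarrow> exp_tail n x \<le> exp_tail n y"
proof (rule LIMSEQ_le)
  have lim: "(\<lambda>M. exp_poly M y - exp_poly n y) \<longlonglongrightarrow> exp_tail n y" for y :: real
    using exp_sums[of y] unfolding sums_def exp_tail_def by (intro tendsto_intros) (simp add: exp_poly_def)
  show "(\<lambda>M. exp_poly M x - exp_poly n x) \<longlonglongrightarrow> exp_tail n x"
    "(\<lambda>M. exp_poly M y - exp_poly n y) \<longlonglongrightarrow> exp_tail n y" by (rule lim)+
  assume xy: "0 \<le> x" "x \<le> y"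
  have "exp_poly M x - exp_poly n x \<le> exp_poly M y - exp_poly n y" if "n \<le> M" for M
  proof -
    have *: "exp_poly M z - exp_poly n z = (\<Sum>m\<in>{n..<M}. z ^ m / fact m)" for z :: real
      unfolding exp_poly_def using that by (simp add: lessThan_atLeast0 sum_diff_nat_ivl)
    show ?thesis unfolding * using xy by (intro sum_mono divide_right_mono power_mono) auto
  qed
  then show "\<exists>N. \<forall>M\<ge>N. exp_poly M x - exp_poly n x \<le> exp_poly M y - exp_poly n y" by blast
qed

text \<open>The coefficients of the series are positive, so the triangle inequality for finite
  segments passes to the limit.\<close>

lemma norm_exp_tail: "norm (exp x - exp_poly n (x::complex)) \<le> exp_tail n (norm x)"
proof (rule LIMSEQ_le)
  show "(\<lambda>M. norm (exp_poly M x - exp_poly n x)) \<longlonglongrightarrow> norm (exp x - exp_poly n x)"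
    using exp_sums[of x] unfolding sums_def by (intro tendsto_intros) (simp add: exp_poly_def)
  show "(\<lambda>M. exp_poly M (norm x) - exp_poly n (norm x)) \<longlonglongrightarrow> exp_tail n (norm x)"
    using exp_sums[of "norm x"] unfolding sums_def exp_tail_def by (intro tendsto_intros) (simp add: exp_poly_def)
  have "norm (exp_poly M x - exp_poly n x) \<le> exp_poly M (norm x) - exp_poly n (norm x)" if "n \<le> M" for M
  proof -
    have *: "exp_poly M y - exp_poly n y = (\<Sum>m\<in>{n..<M}. y ^ m / fact m)" for y :: "'b::{real_normed_field,banach}"
      unfolding exp_poly_def using that by (simp add: lessThan_atLeast0 sum_diff_nat_ivl)
    show ?thesis unfolding * by (rule order_trans[OF norm_sum]) (simp add: norm_divide norm_power)
  qed
  then show "\<exists>N. \<forall>M\<ge>N. norm (exp_poly M x - exp_poly n x) \<le> exp_poly M (norm x) - exp_poly n (norm x)" by blast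
qed

text \<open>The product of two polynomials of degree below \<open>n\<close> has degree below
  \<open>2 n\<close>, so averaging over \<open>2 n\<close> points isolates the coefficient of
  \<open>z^k\<close>; \<open>k < n\<close> ensures that it is untouched by the truncation.\<close>

lemma Cauchy_product_coeff:
  fixes y :: complex and S :: "nat \<Rightarrow> complex"
  assumes n: "k < n" and r: "0 < r"
  shows "(\<Sum>j<2 * n. exp_poly n (circ_pt r (2 * n) j * y) * (\<Sum>m<n. (- circ_pt r (2 * n) j) ^ m / fact m * S m) / circ_pt r (2 * n) j ^ k)
    = of_nat (2 * n) / fact k * (\<Sum>m\<le>k. of_nat (k choose m) * ((-1) ^ m * y ^ (k - m) * S m))"
proof -
  let ?z = "circ_pt r (2 * n)"
  let ?c = "\<lambda>i m. y ^ i / fact i * ((-1) ^ m / fact m * S m)"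
  have "(\<Sum>j<2 * n. exp_poly n (?z j * y) * (\<Sum>m<n. (- ?z j) ^ m / fact m * S m) / ?z j ^ k) =
    (\<Sum>j<2 * n. \<Sum>m<n. \<Sum>i<n. ?c i m * (?z j ^ (i + m) / ?z j ^ k))"
  proof (rule sum.cong[OF refl])
    fix j
    have "exp_poly n (?z j * y) * (\<Sum>m<n. (- ?z j) ^ m / fact m * S m) / ?z j ^ k
      = (\<Sum>m<n. \<Sum>i<n. (?z j * y) ^ i / fact i * ((- ?z j) ^ m / fact m * S m) / ?z j ^ k)"
      unfolding exp_poly_def sum_product sum_divide_distrib by (rule sum.swap)
    also have "\<dots> = (\<Sum>m<n. \<Sum>i<n. ?c i m * (?z j ^ (i + m) / ?z j ^ k))"
      by (intro sum.cong refl, subst power_minus) (simp add: power_mult_distrib power_add mult_ac)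
    finally show "exp_poly n (?z j * y) * (\<Sum>m<n. (- ?z j) ^ m / fact m * S m) / ?z j ^ k = \<dots>" .
  qed
  also have "\<dots> = (\<Sum>m<n. \<Sum>i<n. \<Sum>j<2 * n. ?c i m * (?z j ^ (i + m) / ?z j ^ k))"
    by (subst sum.swap) (intro sum.cong refl sum.swap)
  also have "\<dots> = (\<Sum>m<n. \<Sum>i<n. if i + m = k then of_nat (2 * n) * ?c i m else 0)"
  proof (intro sum.cong refl)
    fix m i assume "m \<in> {..<n}" "i \<in> {..<n}"
    then show "(\<Sum>j<2 * n. ?c i m * (?z j ^ (i + m) / ?z j ^ k)) =
      (if i + m = k then of_nat (2 * n) * ?c i m else 0)"
      unfolding sum_distrib_left[symmetric] using n by (subst circ_pt_extract[OF r]) auto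
  qed
  also have "\<dots> = (\<Sum>m\<le>k. of_nat (2 * n) * (y ^ (k - m) / fact (k - m) * ((-1) ^ m / fact m * S m)))"
  proof (rule sum.mono_neutral_cong_right)
    show "\<forall>m\<in>{..<n} - {..k}. (\<Sum>i<n. if i + m = k then of_nat (2 * n) * ?c i m else 0) = 0"
      by (auto intro!: sum.neutral)
    fix m assume m: "m \<in> {..k}"
    have "(\<Sum>i<n. if i + m = k then of_nat (2 * n) * ?c i m else 0)
      = (\<Sum>i<n. if i = k - m then of_nat (2 * n) * ?c i m else 0)"
      using m by (intro sum.cong refl) auto
    also have "\<dots> = of_nat (2 * n) * (y ^ (k - m) / fact (k - m) * ((-1) ^ m / fact m * S m))"
      using n by (subst sum.delta) auto
    finally show "(\<Sum>i<n. if i + m = k then of_nat (2 * n) * ?c i m else 0) = \<dots>" .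
  qed (use n in auto)
  also have "\<dots> = of_nat (2 * n) / fact k * (\<Sum>m\<le>k. of_nat (k choose m) * ((-1) ^ m * y ^ (k - m) * S m))"
    unfolding sum_distrib_left by (intro sum.cong refl) (simp add: binomial_fact field_simps)
  finally show ?thesis .
qed

section \<open>Square inequalities, linearity and the operator norm\<close>

lemma norm_sum_sq_le:
  fixes h :: "nat \<Rightarrow> complex"
  shows "(cmod (\<Sum>j<N. h j))\<^sup>2 \<le> real N * (\<Sum>j<N. (cmod (h j))\<^sup>2)"
proof -
  have "(cmod (\<Sum>j<N. h j))\<^sup>2 \<le> (\<Sum>j<N. cmod (h j))\<^sup>2" by (intro power_mono norm_sum) auto
  also have "\<dots> \<le> real (card {..<N}) * (\<Sum>j<N. (cmod (h j))\<^sup>2)" using sum_squared_le_sum_of_squares[of "\<lambda>j. cmod (h j)" "{..<N}"] by (simp add: mult.commute)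
  finally show ?thesis by simp
qed

text \<open>The free parameter keeps the main term at a factor \<open>1 + \<tau>\<close> that can be
  sent to 1, at the expense of an error term that vanishes anyway.\<close>

lemma norm_add_sq_le:
  fixes a b :: complex
  assumes "0 < \<tau>"
  shows "(cmod (a + b))\<^sup>2 \<le> (1 + \<tau>) * (cmod a)\<^sup>2 + (1 + 1 / \<tau>) * (cmod b)\<^sup>2"
proof -
  have "(cmod (a + b))\<^sup>2 \<le> (cmod a + cmod b)\<^sup>2" by (intro power_mono norm_triangle_ineq) auto
  also have "\<dots> = (cmod a)\<^sup>2 + (cmod b)\<^sup>2 + 2 * (cmod a * cmod b)" by (simp add: power2_eq_square algebra_simps)
  also have "2 * (cmod a * cmod b) \<le> \<tau> * (cmod a)\<^sup>2 + (1 / \<tau>) * (cmod b)\<^sup>2"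
  proof -
    have "0 \<le> (\<tau> * cmod a - cmod b)\<^sup>2 / \<tau>" using assms by simp
    also have "\<dots> = \<tau> * (cmod a)\<^sup>2 + (1 / \<tau>) * (cmod b)\<^sup>2 - 2 * (cmod a * cmod b)"
      using assms by (simp add: power2_eq_square field_simps)
    finally show ?thesis by simp
  qed
  finally show ?thesis by (simp add: algebra_simps)
qed

lemma linear_op_sum:
  assumes "linear_op T" "finite I"
  shows "T (\<lambda>y. \<Sum>i\<in>I. c i * g i y) = (\<lambda>x. \<Sum>i\<in>I. c i * T (g i) x)"
  using assms(2)
proof (induction I rule: finite_induct)
  case empty
  have "T (\<lambda>y. 0 * undefined y) = (\<lambda>x. 0 * T undefined x)" using assms(1) unfolding linear_op_def by blast
  then show ?case by simp
next
  case (insert i I)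
  have "T (\<lambda>y. c i * g i y + (\<Sum>i\<in>I. c i * g i y)) = (\<lambda>x. T (\<lambda>y. c i * g i y) x + T (\<lambda>y. \<Sum>i\<in>I. c i * g i y) x)"
    using assms(1) by (simp add: linear_op_def)
  also have "T (\<lambda>y. c i * g i y) = (\<lambda>x. c i * T (g i) x)" using assms(1) unfolding linear_op_def by blast
  finally show ?case using insert by simp
qed

text \<open>The infimum defining \<open>opnorm\<close> is approached by admissible \<open>K\<close>
  below \<open>\<Phi> + 1 / (i + 1)\<close>; finiteness of the norm of \<open>f\<close> permits the
  limit.\<close>

lemma opnorm_bound:
  assumes "opnorm w T \<le> ennreal \<Phi>" "0 \<le> \<Phi>" "f \<in> L2w w"
  shows "L2w_norm2 w (T f) \<le> ennreal (\<Phi>\<^sup>2) * L2w_norm2 w f"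
proof -
  have "L2w_norm2 w f < \<infinity>" using assms by (simp add: L2w_def)
  then obtain n where n: "L2w_norm2 w f = ennreal n" "0 \<le> n" by (cases "L2w_norm2 w f") auto
  have "L2w_norm2 w (T f) \<le> ennreal ((\<Phi> + 1 / real (Suc i))\<^sup>2 * n)" for i
  proof -
    have "ennreal \<Phi> < ennreal (\<Phi> + 1 / real (Suc i))" using assms(2) by (intro ennreal_lessI) (auto simp: add_nonneg_pos)
    then have "opnorm w T < ennreal (\<Phi> + 1 / real (Suc i))" using assms(1) by (rule le_less_trans[rotated])
    then obtain K where K: "L2w_norm2 w (T f) \<le> K\<^sup>2 * L2w_norm2 w f" "K < ennreal (\<Phi> + 1 / real (Suc i))"
      unfolding opnorm_def Inf_less_iff using assms(3) by blast
    have "K\<^sup>2 * L2w_norm2 w f \<le> (ennreal (\<Phi> + 1 / real (Suc i)))\<^sup>2 * L2w_norm2 w f"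
      using K(2) by (intro mult_right_mono power_mono) auto
    also have "\<dots> = ennreal ((\<Phi> + 1 / real (Suc i))\<^sup>2 * n)"
    proof -
      have "(ennreal q)\<^sup>2 * ennreal n = ennreal (q\<^sup>2 * n)" if "0 \<le> q" for q
        using that n(2) by (simp add: ennreal_power flip: ennreal_mult)
      then show ?thesis unfolding n(1) using assms(2) by (simp del: ennreal_plus)
    qed
    finally show ?thesis using K(1) by (rule order_trans[rotated])
  qed
  moreover have "(\<lambda>i. ennreal ((\<Phi> + 1 / real (Suc i))\<^sup>2 * n)) \<longlonglongrightarrow> ennreal ((\<Phi> + 0)\<^sup>2 * n)"
    by (intro tendsto_intros LIMSEQ_Suc[OF lim_inverse_n'] tendsto_ennrealI)
  ultimately have "L2w_norm2 w (T f) \<le> ennreal ((\<Phi> + 0)\<^sup>2 * n)" by (intro LIMSEQ_le_const) auto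
  then show ?thesis unfolding n using n(2) by (simp flip: ennreal_mult)
qed

lemma L2w_norm2_mono:
  assumes "AE x in lebesgue. (cmod (f x))\<^sup>2 * w x \<le> C * ((cmod (g x))\<^sup>2 * v x)" "0 \<le> C" "g \<in> borel_measurable lebesgue" "v \<in> borel_measurable lebesgue"
  shows "L2w_norm2 w f \<le> ennreal C * L2w_norm2 v g"
proof -
  have "L2w_norm2 w f \<le> (\<integral>\<^sup>+x. ennreal C * ennreal ((cmod (g x))\<^sup>2 * v x) \<partial>lebesgue)"
    unfolding L2w_norm2_def
    by (rule nn_integral_mono_AE, use assms(1) in eventually_elim) (use assms(2) in \<open>simp add: ennreal_leI flip: ennreal_mult'\<close>)
  also have "\<dots> = ennreal C * L2w_norm2 v g"
    unfolding L2w_norm2_def using assms(3,4) by (intro nn_integral_cmult) measurable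
  finally show ?thesis .
qed

lemma norm_exp_of_real_mult: "cmod (exp (z * of_real y)) = exp (Re z * y)"
  by (simp add: norm_exp_eq_Re)

text \<open>
  Truncating both exponentials to Taylor polynomials of degree below \<open>n\<close> makes the average over \<open>2 n\<close> roots of
  unity exact. All functions involved lie in \<open>L\<^sup>2\<close> of the smaller weight \<open>w e\<^sup>-\<^sup>2\<^sup>r\<^sup>|\<^sup>b\<^sup>|\<close>, where the truncation error
  tends to \<open>0\<close>; this weight is comparable to \<open>w\<close> where \<open>|b| \<le> L\<close>.
\<close>

lemma iter_comm_local_bound:
  fixes w b :: "'a::euclidean_space \<Rightarrow> real" and T :: "('a \<Rightarrow> complex) \<Rightarrow> 'a \<Rightarrow> complex"
  assumes w[measurable]: "w \<in> borel_measurable lebesgue" and pos: "AE x in lebesgue. 0 < w x"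
    and b[measurable]: "b \<in> borel_measurable lebesgue" and T: "linear_op T" and r: "0 < r"
    and H1: "\<And>z. cmod z = r \<Longrightarrow> bounded_on T (tilt w b (2 * Re z)) \<Phi>"
    and H2: "bounded_on T (tilt w (\<lambda>x. \<bar>b x\<bar>) (- 2 * r)) \<Phi>'"
    and f: "f \<in> borel_measurable lebesgue" "L2w_norm2 w f = ennreal F" "0 \<le> F" and \<tau>: "0 < \<tau>" and L: "0 \<le> L"
  shows "(\<integral>\<^sup>+x\<in>{x. \<bar>b x\<bar> \<le> L}. ennreal ((cmod (iter_comm k b T f x))\<^sup>2 * w x) \<partial>lebesgue) \<le> ennreal ((1 + \<tau>) * ((fact k / r ^ k * \<Phi>)\<^sup>2 * F))"
proof -
  note f(1)[measurable]
  let ?C = "iter_comm k b T f" and ?fw = "\<lambda>x. (cmod (f x))\<^sup>2 * w x" and ?d = "\<lambda>x. exp (- 2 * r * \<bar>b x\<bar>)"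
  let ?t = "\<lambda>n x. (exp_tail n (r * \<bar>b x\<bar>))\<^sup>2" and ?v = "\<lambda>z x. - z * complex_of_real (b x)"
  define w' where "w' x = w x * ?d x" for x
  have w'm[measurable]: "w' \<in> borel_measurable lebesgue" unfolding w'_def by measurable
  have w'0: "AE x in lebesgue. 0 < w' x" using pos unfolding w'_def by eventually_elim simp
  define E where "E z y = exp (- z * of_real (b y)) * f y" for z :: complex and y
  define P where "P n z y = exp_poly n (- z * of_real (b y)) * f y" for n and z :: complex and y
  define R where "R n z y = E z y - P n z y" for n and z :: complex and y
  have [measurable]: "E z \<in> borel_measurable lebesgue" "P n z \<in> borel_measurable lebesgue" "R n z \<in> borel_measurable lebesgue" for z n
    unfolding E_def P_def R_def exp_poly_def by measurable
  \<comment> \<open>Bounds the squared truncation error in \<open>L2w w'\<close> for all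
    \<open>z\<close> on the circle at once. The integrand is dominated by that of the norm of
    \<open>f\<close> and tends to 0 pointwise, hence \<open>\<rho>lim\<close>.\<close>
  define \<rho> where "\<rho> n = (\<integral>\<^sup>+x. ennreal (?t n x * ?d x * ?fw x) \<partial>lebesgue)" for n
  have [measurable]: "(\<lambda>x. exp_tail n (r * \<bar>b x\<bar>)) \<in> borel_measurable lebesgue" for n
    unfolding exp_tail_def exp_poly_def by measurable
  have expsq: "(exp (r * \<bar>b x\<bar>))\<^sup>2 * ?d x = 1" for x
    by (simp add: power2_eq_square flip: exp_add)
  have \<rho>le: "?t n x * ?d x \<le> 1" for n x
  proof -
    have "?t n x * ?d x \<le> (exp (r * \<bar>b x\<bar>))\<^sup>2 * ?d x"
      using r by (intro mult_right_mono power_mono exp_tail_bounds) auto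
    then show ?thesis unfolding expsq .
  qed
  have \<rho>dom: "AE x in lebesgue. ennreal (?t n x * ?d x * ?fw x) \<le> ennreal (?fw x)" for n
    using pos
  proof eventually_elim
    fix x assume "0 < w x"
    then have "?t n x * ?d x * ?fw x \<le> 1 * ?fw x"
      by (intro mult_right_mono \<rho>le) auto
    then show "ennreal (?t n x * ?d x * ?fw x) \<le> ennreal (?fw x)"
      by (simp add: ennreal_leI)
  qed
  have \<rho>fin: "\<rho> n \<le> ennreal F" for n
    unfolding \<rho>_def f(2)[symmetric] L2w_norm2_def by (rule nn_integral_mono_AE[OF \<rho>dom])
  have \<rho>lim: "\<rho> \<longlonglongrightarrow> 0"
  proof -
    have "\<rho> \<longlonglongrightarrow> (\<integral>\<^sup>+(x::'a). 0 \<partial>lebesgue)"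
      unfolding \<rho>_def
    proof (rule nn_integral_dominated_convergence[where w = "\<lambda>x. ennreal (?fw x)"])
      show "(\<integral>\<^sup>+x. ennreal (?fw x) \<partial>lebesgue) < \<infinity>" using f(2) by (simp add: L2w_norm2_def)
      show "AE x in lebesgue. (\<lambda>n. ennreal (?t n x * ?d x * ?fw x)) \<longlonglongrightarrow> 0"
      proof (rule AE_I2)
        fix x
        have "(\<lambda>n. ennreal (?t n x * ?d x * ?fw x)) \<longlonglongrightarrow> ennreal (0\<^sup>2 * ?d x * ?fw x)"
          by (intro tendsto_ennrealI tendsto_intros exp_tail_tendsto)
        then show "(\<lambda>n. ennreal (?t n x * ?d x * ?fw x)) \<longlonglongrightarrow> 0" by simp
      qed
    qed (use \<rho>dom in auto)
    then show ?thesis by simp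
  qed
  define \<rho>r where "\<rho>r n = enn2real (\<rho> n)" for n
  have \<rho>r: "\<rho> n = ennreal (\<rho>r n)" "0 \<le> \<rho>r n" for n
    using \<rho>fin[of n] unfolding \<rho>r_def by (auto simp: less_top[symmetric] top_unique intro!: ennreal_enn2real[symmetric])
  have \<rho>rlim: "\<rho>r \<longlonglongrightarrow> 0" using \<rho>lim unfolding \<rho>r(1) using ennreal_tendsto_0_iff[of \<rho>r] \<rho>r(2) by simp
  define S where "S m = T (\<lambda>y. of_real (b y) ^ m * f y)" for m
  have TP: "T (P n z) x = (\<Sum>m<n. (- z) ^ m / fact m * S m x)" for n z x
  proof -
    have "P n z = (\<lambda>y. \<Sum>m<n. (- z) ^ m / fact m * (of_real (b y) ^ m * f y))"
      unfolding P_def exp_poly_def sum_distrib_right power_mult_distrib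
      by (rule ext, intro sum.cong refl) simp
    then show ?thesis using linear_op_sum[OF T, of "{..<n}" "\<lambda>m. (- z) ^ m / fact m" "\<lambda>m y. of_real (b y) ^ m * f y"]
      by (simp add: S_def)
  qed
  have TE: "T (E z) x = T (P n z) x + T (R n z) x" for n z x
  proof -
    have "E z = (\<lambda>y. P n z y + R n z y)" by (simp add: R_def)
    then show ?thesis using T unfolding linear_op_def by metis
  qed
  have abs_zb: "cmod (?v z x) = r * \<bar>b x\<bar>" if "cmod z = r" for z x
    using that by (simp add: norm_mult)
  \<comment> \<open>Multiplication by \<open>e^(-zb)\<close> is an isometry from
    \<open>L2w w\<close> onto the tilted space; this is what makes the bound by
    \<open>\<Phi>\<close> free of further constants.\<close>
  have nE: "L2w_norm2 (tilt w b (2 * Re z)) (E z) = ennreal F" for z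
    unfolding f(2)[symmetric] L2w_norm2_def
  proof (rule nn_integral_cong)
    fix x
    have "(cmod (exp (?v z x)))\<^sup>2 * exp (2 * Re z * b x) = 1"
      unfolding norm_exp_of_real_mult by (simp add: power2_eq_square flip: exp_add)
    moreover have "(cmod (E z x))\<^sup>2 * (w x * exp (2 * Re z * b x)) = ((cmod (exp (?v z x)))\<^sup>2 * exp (2 * Re z * b x)) * ?fw x"
      by (simp add: E_def norm_mult power_mult_distrib)
    ultimately show "ennreal ((cmod (E z x))\<^sup>2 * (w x * exp (2 * Re z * b x))) = ennreal (?fw x)"
      by (simp only: mult_1_left)
  qed
  have nP: "L2w_norm2 w' (P n z) \<le> ennreal F" if z: "cmod z = r" for n z
    unfolding f(2)[symmetric] L2w_norm2_def
  proof (rule nn_integral_mono_AE, use pos in eventually_elim)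
    fix x assume w0: "0 < w x"
    have "cmod (exp_poly n (?v z x)) \<le> exp (r * \<bar>b x\<bar>)"
      using norm_exp_poly_le[of n "- z * of_real (b x)"] exp_poly_le_exp[of "r * \<bar>b x\<bar>" n] r unfolding abs_zb[OF z] by simp
    then have "(cmod (exp_poly n (?v z x)))\<^sup>2 * ?d x \<le> (exp (r * \<bar>b x\<bar>))\<^sup>2 * ?d x"
      by (intro mult_right_mono power_mono) auto
    then have "(cmod (exp_poly n (?v z x)))\<^sup>2 * ?d x * ?fw x \<le> 1 * ?fw x"
      unfolding expsq using w0 by (intro mult_right_mono) auto
    then show "ennreal ((cmod (P n z x))\<^sup>2 * w' x) \<le> ennreal (?fw x)"
      by (intro ennreal_leI) (simp add: P_def w'_def norm_mult power_mult_distrib mult_ac)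
  qed
  have nR: "L2w_norm2 w' (R n z) \<le> \<rho> n" if z: "cmod z = r" for n z
    unfolding \<rho>_def L2w_norm2_def
  proof (rule nn_integral_mono_AE, use pos in eventually_elim)
    fix x assume w0: "0 < w x"
    have "cmod (exp (?v z x) - exp_poly n (?v z x)) \<le> exp_tail n (r * \<bar>b x\<bar>)"
      using norm_exp_tail[of "- z * of_real (b x)" n] unfolding abs_zb[OF z] .
    then have "(cmod (exp (?v z x) - exp_poly n (?v z x)))\<^sup>2 * (?d x * ?fw x) \<le> ?t n x * (?d x * ?fw x)"
      using w0 by (intro mult_right_mono power_mono) auto
    moreover have "R n z x = (exp (?v z x) - exp_poly n (?v z x)) * f x"
      by (simp add: R_def E_def P_def left_diff_distrib)
    ultimately show "ennreal ((cmod (R n z x))\<^sup>2 * w' x) \<le> ennreal (?t n x * ?d x * ?fw x)"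
      by (intro ennreal_leI) (simp only: w'_def norm_mult power_mult_distrib mult_ac)
  qed
  have mE: "T (E z) \<in> borel_measurable lebesgue" "L2w_norm2 (tilt w b (2 * Re z)) (T (E z)) \<le> ennreal (\<Phi>\<^sup>2 * F)" if z: "cmod z = r" for z
  proof -
    have "E z \<in> L2w (tilt w b (2 * Re z))" by (simp add: L2w_def nE)
    from bspec[OF H1[OF z] this] show "T (E z) \<in> borel_measurable lebesgue" "L2w_norm2 (tilt w b (2 * Re z)) (T (E z)) \<le> ennreal (\<Phi>\<^sup>2 * F)"
      using f(3) unfolding nE by (auto simp: ennreal_mult)
  qed
  have mP: "T (P n z) \<in> borel_measurable lebesgue" "L2w_norm2 w' (T (P n z)) \<le> ennreal (\<Phi>'\<^sup>2 * F)" if z: "cmod z = r" for n z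
  proof -
    have "P n z \<in> L2w w'" using le_less_trans[OF nP[OF z]] by (simp add: L2w_def)
    from bspec[OF H2[folded w'_def] this] show "T (P n z) \<in> borel_measurable lebesgue" "L2w_norm2 w' (T (P n z)) \<le> ennreal (\<Phi>'\<^sup>2 * F)"
      using f(3) order_trans[OF _ mult_left_mono[OF nP[OF z]]] by (auto simp: ennreal_mult)
  qed
  have mR: "T (R n z) \<in> borel_measurable lebesgue" "L2w_norm2 w' (T (R n z)) \<le> ennreal (\<Phi>'\<^sup>2 * \<rho>r n)" if z: "cmod z = r" for n z
  proof -
    have "R n z \<in> L2w w'" using le_less_trans[OF nR[OF z]] \<rho>r by (simp add: L2w_def)
    from bspec[OF H2[folded w'_def] this] show "T (R n z) \<in> borel_measurable lebesgue" "L2w_norm2 w' (T (R n z)) \<le> ennreal (\<Phi>'\<^sup>2 * \<rho>r n)"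
      using order_trans[OF _ mult_left_mono[OF nR[OF z]]] \<rho>r by (auto simp: ennreal_mult)
  qed
  define c1 where "c1 = (fact k / r ^ k)\<^sup>2"
  define e where "e n = exp_tail n (r * L)" for n
  \<comment> \<open>Where \<open>|b| \<le> L\<close>, this number bounds both the squared modulus of
    \<open>e^(zb)\<close> and the quotient of \<open>w\<close> by \<open>w'\<close>.\<close>
  define c2 where "c2 = exp (2 * r * L)"
  have c0: "0 \<le> c1" "0 \<le> e n" "0 < c2" "0 < 1 + \<tau>" "0 < 1 + 1 / \<tau>" for n
    using r L \<tau> by (auto simp: c1_def e_def c2_def intro: exp_tail_bounds add_pos_pos)
  have bound: "(\<integral>\<^sup>+x\<in>{x. \<bar>b x\<bar> \<le> L}. ennreal ((cmod (?C x))\<^sup>2 * w x) \<partial>lebesgue) \<le>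
     ennreal ((1 + \<tau>) * c1 * (\<Phi>\<^sup>2 * F) + (1 + 1 / \<tau>) * c1 * 2 * c2 * ((e n)\<^sup>2 * (\<Phi>'\<^sup>2 * F) + c2 * (\<Phi>'\<^sup>2 * \<rho>r n)))" if n: "k < n" for n
  proof -
    define z where "z = circ_pt r (2 * n)"
    define N where "N = 2 * n"
    let ?u = "\<lambda>j x. z j * complex_of_real (b x)"
    have zr: "cmod (z j) = r" for j unfolding z_def using r by (rule norm_circ_pt)
    have N0: "0 < N" using n by (simp add: N_def)
    define G where "G j x = exp (?u j x) * T (E (z j)) x" for j x
    \<comment> \<open>The first summand comes from truncating the outer exponential, the second from
      truncating the inner one.\<close>
    define err where "err j x = (exp (?u j x) - exp_poly n (?u j x)) * T (P n (z j)) x + exp (?u j x) * T (R n (z j)) x" for j x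
    have Geq: "G j x = exp_poly n (?u j x) * (\<Sum>m<n. (- z j) ^ m / fact m * S m x) + err j x" for j x
      unfolding G_def err_def TE[where n = n] TP[symmetric] by (simp add: algebra_simps)
    have main: "of_nat N / fact k * ?C x = (\<Sum>j<N. G j x / z j ^ k) + (\<Sum>j<N. - err j x / z j ^ k)" for x
    proof -
      have "(\<Sum>j<N. G j x / z j ^ k) = (\<Sum>j<N. exp_poly n (?u j x) * (\<Sum>m<n. (- z j) ^ m / fact m * S m x) / z j ^ k) + (\<Sum>j<N. err j x / z j ^ k)"
        unfolding Geq add_divide_distrib by (rule sum.distrib)
      also have "(\<Sum>j<N. exp_poly n (?u j x) * (\<Sum>m<n. (- z j) ^ m / fact m * S m x) / z j ^ k) = of_nat N / fact k * ?C x"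
        unfolding z_def N_def Cauchy_product_coeff[OF n r] iter_comm_expand S_def ..
      finally show ?thesis by (simp add: sum_negf)
    qed
    \<comment> \<open>Cauchy-Schwarz over the \<open>N\<close> points replaces the average by an
      average of squares; nothing is lost afterwards, since all points share the bound
      \<open>\<Phi>\<close>.\<close>
    have main2: "(cmod (?C x))\<^sup>2 \<le> (1 + \<tau>) * c1 / N * (\<Sum>j<N. (cmod (G j x))\<^sup>2) + (1 + 1 / \<tau>) * c1 / N * (\<Sum>j<N. (cmod (err j x))\<^sup>2)" for x
    proof -
      have sq: "(cmod (\<Sum>j<N. h j / z j ^ k))\<^sup>2 \<le> real N * (\<Sum>j<N. (cmod (h j))\<^sup>2) / (r ^ k)\<^sup>2" for h
      proof -
        have "(cmod (\<Sum>j<N. h j / z j ^ k))\<^sup>2 \<le> real N * (\<Sum>j<N. (cmod (h j / z j ^ k))\<^sup>2)" by (rule norm_sum_sq_le)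
        also have "\<dots> = real N * (\<Sum>j<N. (cmod (h j))\<^sup>2) / (r ^ k)\<^sup>2"
          by (simp add: norm_divide norm_power zr power_divide flip: sum_divide_distrib)
        finally show ?thesis .
      qed
      have "(real N / fact k)\<^sup>2 * (cmod (?C x))\<^sup>2 = (cmod (of_nat N / fact k * ?C x))\<^sup>2"
        by (simp add: norm_mult norm_divide power_mult_distrib power_divide)
      also have "\<dots> \<le> (1 + \<tau>) * (cmod (\<Sum>j<N. G j x / z j ^ k))\<^sup>2 + (1 + 1 / \<tau>) * (cmod (\<Sum>j<N. - err j x / z j ^ k))\<^sup>2"
        unfolding main by (rule norm_add_sq_le[OF \<tau>])
      also have "\<dots> \<le> (1 + \<tau>) * (real N * (\<Sum>j<N. (cmod (G j x))\<^sup>2) / (r ^ k)\<^sup>2) + (1 + 1 / \<tau>) * (real N * (\<Sum>j<N. (cmod (- err j x))\<^sup>2) / (r ^ k)\<^sup>2)"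
        using c0 by (intro add_mono mult_left_mono sq) auto
      finally have "(cmod (?C x))\<^sup>2 \<le> ((1 + \<tau>) * (real N * (\<Sum>j<N. (cmod (G j x))\<^sup>2) / (r ^ k)\<^sup>2) + (1 + 1 / \<tau>) * (real N * (\<Sum>j<N. (cmod (- err j x))\<^sup>2) / (r ^ k)\<^sup>2)) / (real N / fact k)\<^sup>2"
        using N0 by (simp add: field_simps)
      also have "\<dots> = (1 + \<tau>) * c1 / N * (\<Sum>j<N. (cmod (G j x))\<^sup>2) + (1 + 1 / \<tau>) * c1 / N * (\<Sum>j<N. (cmod (err j x))\<^sup>2)"
      proof -
        have gen: "(u * (n * a / s) + v * (n * d / s)) / (n / h)\<^sup>2 = u * (h\<^sup>2 / s) / n * a + v * (h\<^sup>2 / s) / n * d"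
          if "n \<noteq> 0" "s \<noteq> 0" "h \<noteq> 0" for u v n a s d h :: real
          using that by (simp add: field_simps power2_eq_square)
        show ?thesis unfolding c1_def power_divide[of "fact k" "r ^ k"] norm_minus_cancel
          using N0 r by (intro gen) auto
      qed
      finally show ?thesis .
    qed
    have errb: "(cmod (err j x))\<^sup>2 \<le> 2 * ((e n)\<^sup>2 * (cmod (T (P n (z j)) x))\<^sup>2 + c2 * (cmod (T (R n (z j)) x))\<^sup>2)" if x: "\<bar>b x\<bar> \<le> L" for j x
    proof -
      have "cmod (?u j x) = r * \<bar>b x\<bar>" by (simp add: norm_mult zr)
      then have 1: "cmod (exp (?u j x) - exp_poly n (?u j x)) \<le> e n"
        using norm_exp_tail[of "z j * of_real (b x)" n] exp_tail_mono[of "r * \<bar>b x\<bar>" "r * L" n] x r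
        unfolding e_def by simp
      have "Re (z j) * b x \<le> \<bar>Re (z j)\<bar> * \<bar>b x\<bar>" by (metis abs_ge_self abs_mult)
      also have "\<dots> \<le> r * L" using abs_Re_le_cmod[of "z j"] x r unfolding zr by (intro mult_mono) auto
      finally have "cmod (exp (?u j x)) \<le> exp (r * L)" unfolding norm_exp_of_real_mult by simp
      then have "(cmod (exp (?u j x)))\<^sup>2 \<le> (exp (r * L))\<^sup>2" by (intro power_mono) auto
      also have "\<dots> = c2" by (simp add: c2_def power2_eq_square flip: exp_add)
      finally have 2: "(cmod (exp (?u j x)))\<^sup>2 \<le> c2" .
      have 3: "(cmod (exp (?u j x) - exp_poly n (?u j x)))\<^sup>2 \<le> (e n)\<^sup>2"
        using 1 by (intro power_mono) auto
      have "(cmod (err j x))\<^sup>2 \<le> (1 + 1) * (cmod ((exp (?u j x) - exp_poly n (?u j x)) * T (P n (z j)) x))\<^sup>2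
         + (1 + 1 / 1) * (cmod (exp (?u j x) * T (R n (z j)) x))\<^sup>2"
        unfolding err_def by (rule norm_add_sq_le) simp
      also have "\<dots> = 2 * ((cmod (exp (?u j x) - exp_poly n (?u j x)))\<^sup>2 * (cmod (T (P n (z j)) x))\<^sup>2 + (cmod (exp (?u j x)))\<^sup>2 * (cmod (T (R n (z j)) x))\<^sup>2)"
        by (simp only: norm_mult power_mult_distrib) simp
      also have "\<dots> \<le> 2 * ((e n)\<^sup>2 * (cmod (T (P n (z j)) x))\<^sup>2 + c2 * (cmod (T (R n (z j)) x))\<^sup>2)"
        using 2 3 by (intro mult_left_mono add_mono mult_right_mono) auto
      finally show ?thesis .
    qed
    define \<alpha> where "\<alpha> = (1 + \<tau>) * c1 / N"
    define \<gamma> where "\<gamma> = (1 + 1 / \<tau>) * c1 / N * 2 * c2"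
    have \<alpha>\<gamma>: "0 \<le> \<alpha>" "0 \<le> \<gamma>" using c0 by (auto simp: \<alpha>_def \<gamma>_def)
    let ?a = "\<lambda>j x. (cmod (T (E (z j)) x))\<^sup>2 * (w x * exp (2 * Re (z j) * b x))"
    let ?p = "\<lambda>j x. (cmod (T (P n (z j)) x))\<^sup>2 * w' x"
    let ?q = "\<lambda>j x. (cmod (T (R n (z j)) x))\<^sup>2 * w' x"
    have pw: "(cmod (?C x))\<^sup>2 * w x \<le>
        (\<Sum>j<N. \<alpha> * ?a j x + \<gamma> * (e n)\<^sup>2 * ?p j x
          + \<gamma> * c2 * ?q j x)"
      if x: "\<bar>b x\<bar> \<le> L" and w0: "0 < w x" for x
    proof -
      have ww: "w x \<le> c2 * w' x"
      proof -
        have "1 \<le> exp (2 * r * (L - \<bar>b x\<bar>))" using x r by simp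
        also have "\<dots> = c2 * ?d x" by (simp add: c2_def algebra_simps flip: exp_add)
        finally show ?thesis using mult_left_mono[of 1 _ "w x"] w0 by (simp add: w'_def mult_ac)
      qed
      have Gw: "(cmod (G j x))\<^sup>2 * w x = (cmod (T (E (z j)) x))\<^sup>2 * (w x * exp (2 * Re (z j) * b x))" for j
      proof -
        have "(cmod (exp (?u j x)))\<^sup>2 = exp (2 * Re (z j) * b x)"
          unfolding norm_exp_of_real_mult by (simp add: power2_eq_square flip: exp_add)
        then show ?thesis by (simp add: G_def norm_mult power_mult_distrib mult_ac)
      qed
      have ew: "(1 + 1 / \<tau>) * c1 / N * ((cmod (err j x))\<^sup>2 * w x) \<le> \<gamma> * (e n)\<^sup>2 * ?p j x
          + \<gamma> * c2 * ?q j x" for j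
      proof -
        have "(cmod (err j x))\<^sup>2 * w x \<le> 2 * ((e n)\<^sup>2 * (cmod (T (P n (z j)) x))\<^sup>2 + c2 * (cmod (T (R n (z j)) x))\<^sup>2) * (c2 * w' x)"
          using errb[OF x] ww w0 c0 by (intro mult_mono) auto
        then have "(1 + 1 / \<tau>) * c1 / N * ((cmod (err j x))\<^sup>2 * w x) \<le> (1 + 1 / \<tau>) * c1 / N * (2 * ((e n)\<^sup>2 * (cmod (T (P n (z j)) x))\<^sup>2 + c2 * (cmod (T (R n (z j)) x))\<^sup>2) * (c2 * w' x))"
          using c0 by (intro mult_left_mono) auto
        also have "\<dots> = \<gamma> * (e n)\<^sup>2 * ?p j x
          + \<gamma> * c2 * ?q j x" unfolding \<gamma>_def by (simp add: algebra_simps)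
        finally show ?thesis .
      qed
      have "(cmod (?C x))\<^sup>2 * w x \<le> (\<alpha> * (\<Sum>j<N. (cmod (G j x))\<^sup>2) + (1 + 1 / \<tau>) * c1 / N * (\<Sum>j<N. (cmod (err j x))\<^sup>2)) * w x"
        unfolding \<alpha>_def using w0 by (intro mult_right_mono main2) auto
      also have "\<dots> = (\<Sum>j<N. \<alpha> * ((cmod (G j x))\<^sup>2 * w x) + (1 + 1 / \<tau>) * c1 / N * ((cmod (err j x))\<^sup>2 * w x))"
        by (simp add: distrib_right sum.distrib sum_distrib_left sum_distrib_right mult.assoc)
      also have "\<dots> \<le> (\<Sum>j<N. \<alpha> * ?a j x + (\<gamma> * (e n)\<^sup>2 * ?p j x
          + \<gamma> * c2 * ?q j x))"
        unfolding Gw by (intro sum_mono add_left_mono ew)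
      finally show ?thesis by (simp add: add.assoc)
    qed
    note [measurable] = mE(1)[OF zr] mP(1)[OF zr] mR(1)[OF zr]
    have "(\<integral>\<^sup>+x\<in>{x. \<bar>b x\<bar> \<le> L}. ennreal ((cmod (?C x))\<^sup>2 * w x) \<partial>lebesgue) \<le>
      (\<integral>\<^sup>+x. (\<Sum>j<N. ennreal \<alpha> * ennreal (?a j x) + ennreal (\<gamma> * (e n)\<^sup>2) * ennreal (?p j x)
          + ennreal (\<gamma> * c2) * ennreal (?q j x)) \<partial>lebesgue)"
    proof (rule nn_integral_mono_AE, use pos w'0 in eventually_elim)
      fix x assume w0: "0 < w x" "0 < w' x"
      show "ennreal ((cmod (?C x))\<^sup>2 * w x) * indicator {x. \<bar>b x\<bar> \<le> L} x \<le> (\<Sum>j<N. ennreal \<alpha> * ennreal (?a j x) + ennreal (\<gamma> * (e n)\<^sup>2) * ennreal (?p j x)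
          + ennreal (\<gamma> * c2) * ennreal (?q j x))"
      proof (cases "\<bar>b x\<bar> \<le> L")
        case True
        have nn: "0 \<le> \<alpha> * ?a j x"
          "0 \<le> \<gamma> * (e n)\<^sup>2 * ?p j x" "0 \<le> \<gamma> * c2 * ?q j x" for j
          using \<alpha>\<gamma> c0 w0 by auto
        have "(\<Sum>j<N. ennreal \<alpha> * ennreal (?a j x) + ennreal (\<gamma> * (e n)\<^sup>2) * ennreal (?p j x)
          + ennreal (\<gamma> * c2) * ennreal (?q j x)) =
          (\<Sum>j<N. ennreal (\<alpha> * ?a j x + \<gamma> * (e n)\<^sup>2 * ?p j x
          + \<gamma> * c2 * ?q j x))"
        proof (rule sum.cong[OF refl])
          fix j
          show "ennreal \<alpha> * ennreal (?a j x) + ennreal (\<gamma> * (e n)\<^sup>2) * ennreal (?p j x)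
          + ennreal (\<gamma> * c2) * ennreal (?q j x) =
           ennreal (\<alpha> * ?a j x + \<gamma> * (e n)\<^sup>2 * ?p j x
          + \<gamma> * c2 * ?q j x)"
            using nn[of j] \<alpha>\<gamma> c0 by (simp only: ennreal_plus add_nonneg_nonneg ennreal_mult' mult_nonneg_nonneg zero_le_power2 less_imp_le)
        qed
        also have "\<dots> = ennreal (\<Sum>j<N. \<alpha> * ?a j x + \<gamma> * (e n)\<^sup>2 * ?p j x
          + \<gamma> * c2 * ?q j x)"
          by (rule sum_ennreal) (intro add_nonneg_nonneg nn)
        finally show ?thesis using True pw[OF True w0(1)] by (simp add: ennreal_leI)
      qed simp
    qed
    also have "\<dots> = (\<Sum>j<N. ennreal \<alpha> * L2w_norm2 (\<lambda>x. w x * exp (2 * Re (z j) * b x)) (T (E (z j))) + ennreal (\<gamma> * (e n)\<^sup>2) * L2w_norm2 w' (T (P n (z j)))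
          + ennreal (\<gamma> * c2) * L2w_norm2 w' (T (R n (z j))))"
      unfolding L2w_norm2_def by (simp add: nn_integral_sum nn_integral_add nn_integral_cmult)
    also have "\<dots> \<le> (\<Sum>j<N. ennreal \<alpha> * ennreal (\<Phi>\<^sup>2 * F) + ennreal (\<gamma> * (e n)\<^sup>2) * ennreal (\<Phi>'\<^sup>2 * F) + ennreal (\<gamma> * c2) * ennreal (\<Phi>'\<^sup>2 * \<rho>r n))"
      by (intro sum_mono add_mono mult_left_mono mE(2)[OF zr] mP(2)[OF zr] mR(2)[OF zr]) auto
    also have "\<dots> = (\<Sum>j<N. ennreal (\<alpha> * (\<Phi>\<^sup>2 * F) + \<gamma> * (e n)\<^sup>2 * (\<Phi>'\<^sup>2 * F) + \<gamma> * c2 * (\<Phi>'\<^sup>2 * \<rho>r n)))"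
      using \<alpha>\<gamma> c0 f(3) \<rho>r(2)[of n]
      by (intro sum.cong refl) (simp only: ennreal_plus add_nonneg_nonneg ennreal_mult' mult_nonneg_nonneg zero_le_power2 less_imp_le)
    also have "\<dots> = ennreal (\<Sum>j<N. \<alpha> * (\<Phi>\<^sup>2 * F) + \<gamma> * (e n)\<^sup>2 * (\<Phi>'\<^sup>2 * F) + \<gamma> * c2 * (\<Phi>'\<^sup>2 * \<rho>r n))"
      using \<alpha>\<gamma> c0 f(3) \<rho>r(2)[of n] by (intro sum_ennreal) (auto simp: less_imp_le)
    also have "(\<Sum>j<N. \<alpha> * (\<Phi>\<^sup>2 * F) + \<gamma> * (e n)\<^sup>2 * (\<Phi>'\<^sup>2 * F) + \<gamma> * c2 * (\<Phi>'\<^sup>2 * \<rho>r n)) =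
       (1 + \<tau>) * c1 * (\<Phi>\<^sup>2 * F) + (1 + 1 / \<tau>) * c1 * 2 * c2 * ((e n)\<^sup>2 * (\<Phi>'\<^sup>2 * F) + c2 * (\<Phi>'\<^sup>2 * \<rho>r n))"
    proof -
      have "real N * \<alpha> = (1 + \<tau>) * c1" "real N * \<gamma> = (1 + 1 / \<tau>) * c1 * 2 * c2" using N0 by (auto simp: \<alpha>_def \<gamma>_def)
      then show ?thesis by (simp add: sum_constant distrib_left flip: mult.assoc)
    qed
    finally show ?thesis .
  qed
  \<comment> \<open>With \<open>L\<close> and \<open>\<tau>\<close> fixed, \<open>n\<close> tends to
    infinity; both errors vanish and \<open>\<Phi>'\<close> drops out.\<close>
  have "(\<lambda>n. ennreal ((1 + \<tau>) * c1 * (\<Phi>\<^sup>2 * F) + (1 + 1 / \<tau>) * c1 * 2 * c2 * ((e n)\<^sup>2 * (\<Phi>'\<^sup>2 * F) + c2 * (\<Phi>'\<^sup>2 * \<rho>r n))))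
    \<longlonglongrightarrow> ennreal ((1 + \<tau>) * c1 * (\<Phi>\<^sup>2 * F) + (1 + 1 / \<tau>) * c1 * 2 * c2 * (0\<^sup>2 * (\<Phi>'\<^sup>2 * F) + c2 * (\<Phi>'\<^sup>2 * 0)))"
    unfolding e_def by (intro tendsto_ennrealI tendsto_intros exp_tail_tendsto \<rho>rlim)
  then have "(\<integral>\<^sup>+x\<in>{x. \<bar>b x\<bar> \<le> L}. ennreal ((cmod (?C x))\<^sup>2 * w x) \<partial>lebesgue) \<le> ennreal ((1 + \<tau>) * c1 * (\<Phi>\<^sup>2 * F) + (1 + 1 / \<tau>) * c1 * 2 * c2 * (0\<^sup>2 * (\<Phi>'\<^sup>2 * F) + c2 * (\<Phi>'\<^sup>2 * 0)))"
    by (rule LIMSEQ_le_const) (use bound in \<open>auto intro!: exI[of _ "Suc k"]\<close>)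
  also have "(1 + \<tau>) * c1 * (\<Phi>\<^sup>2 * F) + (1 + 1 / \<tau>) * c1 * 2 * c2 * (0\<^sup>2 * (\<Phi>'\<^sup>2 * F) + c2 * (\<Phi>'\<^sup>2 * 0)) = (1 + \<tau>) * ((fact k / r ^ k * \<Phi>)\<^sup>2 * F)"
    by (simp add: c1_def power_mult_distrib power_divide)
  finally show ?thesis .
qed

lemma power_le_exp:
  assumes "0 \<le> (y::real)" shows "y ^ m \<le> fact m * exp y"
proof -
  have "y ^ m / fact m \<le> exp_poly (Suc m) y"
    using exp_poly_nonneg[OF assms, of m] by (simp add: exp_poly_def)
  also have "\<dots> \<le> exp y" by (rule exp_poly_le_exp[OF assms])
  finally show ?thesis by (simp add: field_simps)
qed

text \<open>The local bound does not depend on \<open>L\<close>, so monotone convergence removes the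
  restriction \<open>|b| \<le> L\<close>; the factor \<open>1 + \<tau>\<close> disappears by letting
  \<open>\<tau>\<close> tend to 0.\<close>

lemma iter_comm_bound:
  fixes w b :: "'a::euclidean_space \<Rightarrow> real" and T :: "('a \<Rightarrow> complex) \<Rightarrow> 'a \<Rightarrow> complex"
  assumes w[measurable]: "w \<in> borel_measurable lebesgue" and pos: "AE x in lebesgue. 0 < w x"
    and b[measurable]: "b \<in> borel_measurable lebesgue" and T: "linear_op T" and r: "0 < r"
    and H1: "\<And>z. cmod z = r \<Longrightarrow> bounded_on T (tilt w b (2 * Re z)) \<Phi>"
    and H2: "bounded_on T (tilt w (\<lambda>x. \<bar>b x\<bar>) (- 2 * r)) \<Phi>'"
    and f: "f \<in> L2w w"
  shows "L2w_norm2 w (iter_comm k b T f) \<le> ennreal ((fact k / r ^ k * \<Phi>)\<^sup>2) * L2w_norm2 w f"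
proof -
  have fm[measurable]: "f \<in> borel_measurable lebesgue" using f by (simp add: L2w_def)
  obtain F where F: "L2w_norm2 w f = ennreal F" "0 \<le> F"
    using f by (cases "L2w_norm2 w f") (auto simp: L2w_def)
  define A where "A = (fact k / r ^ k * \<Phi>)\<^sup>2 * F"
  have A: "0 \<le> A" using F by (simp add: A_def)
  \<comment> \<open>The polynomial \<open>|b|^m\<close> is dominated by
    \<open>m! / r^m * e^(r|b|)\<close>, so \<open>b^m f\<close> lies in the auxiliary space, where
    \<open>T\<close> produces measurable functions.\<close>
  have S: "T (\<lambda>y. of_real (b y) ^ m * f y) \<in> borel_measurable lebesgue" for m
  proof -
    let ?g = "\<lambda>y. of_real (b y) ^ m * f y"
    have "L2w_norm2 (tilt w (\<lambda>x. \<bar>b x\<bar>) (- 2 * r)) ?g \<le> ennreal ((fact m / r ^ m)\<^sup>2) * L2w_norm2 w f"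
    proof (rule L2w_norm2_mono)
      show "AE x in lebesgue. (cmod (?g x))\<^sup>2 * (w x * exp (- 2 * r * \<bar>b x\<bar>)) \<le> (fact m / r ^ m)\<^sup>2 * ((cmod (f x))\<^sup>2 * w x)"
        using pos
      proof eventually_elim
        fix x assume w0: "0 < w x"
        have "\<bar>b x\<bar> ^ m \<le> fact m / r ^ m * exp (r * \<bar>b x\<bar>)"
          using power_le_exp[of "r * \<bar>b x\<bar>" m] r by (simp add: power_mult_distrib field_simps)
        then have "(\<bar>b x\<bar> ^ m)\<^sup>2 \<le> (fact m / r ^ m * exp (r * \<bar>b x\<bar>))\<^sup>2" by (intro power_mono) auto
        then have "(\<bar>b x\<bar> ^ m)\<^sup>2 * exp (- 2 * r * \<bar>b x\<bar>) \<le> (fact m / r ^ m * exp (r * \<bar>b x\<bar>))\<^sup>2 * exp (- 2 * r * \<bar>b x\<bar>)"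
          by (intro mult_right_mono) auto
        also have "\<dots> = (fact m / r ^ m)\<^sup>2 * (exp (r * \<bar>b x\<bar>) * exp (r * \<bar>b x\<bar>) * exp (- 2 * r * \<bar>b x\<bar>))"
          by (simp add: power2_eq_square)
        also have "exp (r * \<bar>b x\<bar>) * exp (r * \<bar>b x\<bar>) * exp (- 2 * r * \<bar>b x\<bar>) = 1"
          by (simp flip: exp_add)
        finally have "(\<bar>b x\<bar> ^ m)\<^sup>2 * exp (- 2 * r * \<bar>b x\<bar>) * ((cmod (f x))\<^sup>2 * w x) \<le> (fact m / r ^ m)\<^sup>2 * 1 * ((cmod (f x))\<^sup>2 * w x)"
          using w0 by (intro mult_right_mono) auto
        moreover have "(cmod (?g x))\<^sup>2 * (w x * exp (- 2 * r * \<bar>b x\<bar>)) = (\<bar>b x\<bar> ^ m)\<^sup>2 * exp (- 2 * r * \<bar>b x\<bar>) * ((cmod (f x))\<^sup>2 * w x)"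
          by (simp add: norm_mult norm_power power_mult_distrib)
        ultimately show "(cmod (?g x))\<^sup>2 * (w x * exp (- 2 * r * \<bar>b x\<bar>)) \<le> (fact m / r ^ m)\<^sup>2 * ((cmod (f x))\<^sup>2 * w x)"
          by (simp only: mult_1_right)
      qed
    qed auto
    also have "\<dots> < \<infinity>" unfolding F by (simp add: ennreal_mult_less_top)
    finally have "?g \<in> L2w (tilt w (\<lambda>x. \<bar>b x\<bar>) (- 2 * r))" by (simp add: L2w_def)
    then show ?thesis using H2 by blast
  qed
  have [measurable]: "iter_comm k b T f \<in> borel_measurable lebesgue"
  proof -
    note S[measurable]
    have "iter_comm k b T f = (\<lambda>x. \<Sum>n\<le>k. of_nat (k choose n) * ((-1) ^ n * of_real (b x) ^ (k - n) * T (\<lambda>y. of_real (b y) ^ n * f y) x))"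
      by (rule ext) (rule iter_comm_expand)
    also have "\<dots> \<in> borel_measurable lebesgue" by measurable
    finally show ?thesis .
  qed
  have loc: "(\<integral>\<^sup>+x\<in>{x. \<bar>b x\<bar> \<le> L}. ennreal ((cmod (iter_comm k b T f x))\<^sup>2 * w x) \<partial>lebesgue) \<le> ennreal A" if L: "0 \<le> L" for L
  proof -
    have "(\<lambda>i. ennreal ((1 + 1 / real (Suc i)) * A)) \<longlonglongrightarrow> ennreal ((1 + 0) * A)"
      by (intro tendsto_intros LIMSEQ_Suc[OF lim_inverse_n'] tendsto_ennrealI)
    moreover have "(\<integral>\<^sup>+x\<in>{x. \<bar>b x\<bar> \<le> L}. ennreal ((cmod (iter_comm k b T f x))\<^sup>2 * w x) \<partial>lebesgue) \<le> ennreal ((1 + 1 / real (Suc i)) * A)" for i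
      unfolding A_def by (rule iter_comm_local_bound[OF w pos b T r H1 H2 fm F _ L]) auto
    ultimately show ?thesis by (intro LIMSEQ_le_const[of _ "ennreal A"]) auto
  qed
  define h where "h i x = ennreal ((cmod (iter_comm k b T f x))\<^sup>2 * w x) * indicator {x. \<bar>b x\<bar> \<le> real i} x" for i :: nat and x
  have bL: "{x. \<bar>b x\<bar> \<le> L} \<in> sets lebesgue" for L
  proof -
    have "{x. \<bar>b x\<bar> \<le> L} = {x \<in> space lebesgue. \<bar>b x\<bar> \<le> L}" by simp
    also have "\<dots> \<in> sets lebesgue" by measurable
    finally show ?thesis .
  qed
  have "L2w_norm2 w (iter_comm k b T f) = (\<integral>\<^sup>+x. (SUP i. h i x) \<partial>lebesgue)"
    unfolding L2w_norm2_def
  proof (rule nn_integral_cong)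
    fix x
    obtain i where i: "\<bar>b x\<bar> \<le> real i" using real_arch_simple by blast
    show "ennreal ((cmod (iter_comm k b T f x))\<^sup>2 * w x) = (SUP i. h i x)"
    proof (rule antisym)
      have "ennreal ((cmod (iter_comm k b T f x))\<^sup>2 * w x) = h i x" using i by (simp add: h_def)
      also have "\<dots> \<le> (SUP i. h i x)" by (rule SUP_upper) simp
      finally show "ennreal ((cmod (iter_comm k b T f x))\<^sup>2 * w x) \<le> (SUP i. h i x)" .
      show "(SUP i. h i x) \<le> ennreal ((cmod (iter_comm k b T f x))\<^sup>2 * w x)"
        by (rule SUP_least) (auto simp: h_def indicator_def)
    qed
  qed
  also have "\<dots> = (SUP i. \<integral>\<^sup>+x. h i x \<partial>lebesgue)"
  proof (rule nn_integral_monotone_convergence_SUP)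
    show "incseq h" unfolding h_def by (intro monoI le_funI mult_left_mono) (auto simp: indicator_def)
    note bL[measurable]
    show "h i \<in> borel_measurable lebesgue" for i unfolding h_def by measurable
  qed
  also have "\<dots> \<le> ennreal A" by (rule SUP_least) (use loc in \<open>simp add: h_def\<close>)
  finally show ?thesis unfolding A_def F using F(2) by (simp add: ennreal_mult)
qed

section \<open>Choice of the radius and of the constant\<close>

lemma BMO_bmo_le:
  assumes "BMO b" "enn2real (bmo_norm b) \<le> \<beta>"
  shows "bmo_le b \<beta>"
proof -
  have fin: "bmo_norm b < \<infinity>" using assms by (simp add: BMO_def)
  have "mass (\<lambda>x. \<bar>b x - cube_mean Q b\<bar>) Q \<le> ennreal \<beta> * vol Q" if Q: "cube Q" for Q
  proof -
    note QL = cube_lebesgue[OF Q]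
    let ?I = "\<integral>\<^sup>+x\<in>Q. ennreal \<bar>b x - cube_mean Q b\<bar> \<partial>lebesgue"
    have "?I / vol Q \<le> bmo_norm b"
      unfolding bmo_norm_def avg_def[symmetric] by (rule SUP_upper) (use Q in simp)
    also have "\<dots> = ennreal (enn2real (bmo_norm b))" using fin by (simp add: less_top)
    also have "\<dots> \<le> ennreal \<beta>" using assms(2) by (rule ennreal_leI)
    finally have "?I / vol Q * vol Q \<le> ennreal \<beta> * vol Q"
      by (rule mult_right_mono) simp
    moreover have "?I / vol Q * vol Q = ?I"
      using QL by (simp add: ennreal_divide_times less_top)
    ultimately show ?thesis by simp
  qed
  then show ?thesis using assms by (auto simp: bmo_le_def BMO_def)
qed

lemma opnorm_leI:
  assumes "0 \<le> C" "\<And>f. f \<in> L2w w \<Longrightarrow> L2w_norm2 w (T f) \<le> ennreal (C\<^sup>2) * L2w_norm2 w f"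
  shows "opnorm w T \<le> ennreal C"
  unfolding opnorm_def using assms by (intro Inf_lower) (simp add: ennreal_power)

lemma enn2real_le: "x \<le> ennreal y \<Longrightarrow> 0 \<le> y \<Longrightarrow> enn2real x \<le> y"
  using enn2real_mono[of x "ennreal y"] by simp

lemma pert_const_pos: "0 < pert_const TYPE('a::euclidean_space)"
  unfolding pert_const_def of_nat_0_less_iff by simp

lemma opnorm_iter_comm_le:
  fixes T :: "('a::euclidean_space \<Rightarrow> complex) \<Rightarrow> ('a \<Rightarrow> complex)" and b w :: "'a \<Rightarrow> real"
  assumes \<phi>: "admissible_phi \<phi>" and T: "linear_op T"
    and bound: "\<And>w. A2 w \<Longrightarrow> (\<forall>f\<in>L2w w. T f \<in> borel_measurable lebesgue) \<and>
         opnorm w T \<le> ennreal (\<phi> (enn2real (A2_char w)) (enn2real (Ainf_char w)) (enn2real (Ainf_char (dual_weight w))))"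
    and w: "A2 w" and b: "bmo_le b \<beta>" "0 < \<beta>"
    and c: "100 \<le> c" "Ainf_const TYPE('a) \<le> c" "fact k * (4 * pert_const TYPE('a)) ^ k \<le> c"
  shows "opnorm w (iter_comm k b T) \<le> ennreal (c * \<phi> (c * enn2real (A2_char w)) (c * enn2real (Ainf_char w)) (c * enn2real (Ainf_char (dual_weight w)))
                   * (enn2real (Ainf_char w) + enn2real (Ainf_char (dual_weight w))) ^ k * \<beta> ^ k)"
proof -
  note dw = A2_dual[OF w]
  define p where "p = pert_const TYPE('a)"
  have p: "0 < p" unfolding p_def by (rule pert_const_pos)
  define A where "A = enn2real (Ainf_char w)"
  define A' where "A' = enn2real (Ainf_char (dual_weight w))"
  define X where "X = enn2real (A2_char w)"
  have A: "1 \<le> A" "1 \<le> A'" "1 \<le> X" unfolding A_def A'_def X_def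
    by (rule Ainf_ennreal[OF w] Ainf_ennreal[OF dw] A2_ennreal[OF w])+
  \<comment> \<open>The points of the circle give \<open>|\<theta>| \<le> 2 r\<close> with BMO bound
    \<open>\<beta>\<close>, the auxiliary weight \<open>|\<theta>| = 2 r\<close> with bound
    \<open>2 \<beta>\<close> for \<open>|b|\<close>; the factor 4 serves both. The sum
    \<open>A + A'\<close> makes the tilt small for \<open>w\<close> and for its dual.\<close>
  define r where "r = 1 / (4 * \<beta> * p * (A + A'))"
  have den: "0 < 4 * \<beta> * p * (A + A')" using b(2) p A by (intro mult_pos_pos) auto
  have r: "0 < r" unfolding r_def using den by simp
  have r4: "4 * r * \<beta> * p * (A + A') = 1" unfolding r_def using den by (simp add: field_simps)
  have small: "\<bar>\<theta>\<bar> * \<gamma> * p * A \<le> 1" "\<bar>\<theta>\<bar> * \<gamma> * p * A' \<le> 1" if "\<bar>\<theta>\<bar> * \<gamma> \<le> 4 * r * \<beta>" for \<theta> \<gamma>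
  proof -
    have "\<bar>\<theta>\<bar> * \<gamma> * p * Y \<le> 4 * r * \<beta> * p * (A + A')" if "0 \<le> Y" "Y \<le> A + A'" for Y
    proof (rule mult_mono)
      show "\<bar>\<theta>\<bar> * \<gamma> * p \<le> 4 * r * \<beta> * p"
        using \<open>\<bar>\<theta>\<bar> * \<gamma> \<le> 4 * r * \<beta>\<close> p by (intro mult_right_mono) auto
    qed (use that p r b(2) in auto)
    from this[of A] this[of A'] show "\<bar>\<theta>\<bar> * \<gamma> * p * A \<le> 1" "\<bar>\<theta>\<bar> * \<gamma> * p * A' \<le> 1"
      unfolding r4 using A by auto
  qed
  have \<phi>0: "0 \<le> \<phi> x y z" if "1 \<le> x" "1 \<le> y" "1 \<le> z" for x y z using \<phi> that by (simp add: admissible_phi_def)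
  define \<Phi> where "\<Phi> = \<phi> (c * X) (c * A) (c * A')"
  have c1: "1 \<le> c * Y" if "1 \<le> Y" for Y using mult_mono[of 1 c 1 Y] that c(1) by simp
  have \<Phi>: "0 \<le> \<Phi>" unfolding \<Phi>_def by (intro \<phi>0 c1 A)
  define w' where "w' = (tilt w (\<lambda>x. \<bar>b x\<bar>) (- 2 * r))"
  have "\<bar>- 2 * r\<bar> * (2 * \<beta>) \<le> 4 * r * \<beta>" using r b(2) by simp
  note small' = small[OF this, unfolded p_def A_def A'_def]
  have w': "A2 w'"
    unfolding w'_def by (rule A2_perturbed[OF w bmo_le_abs[OF b] _ small']) (use b(2) in simp)
  \<comment> \<open>Only a finite nonnegative number is required here; it does not enter the
    conclusion of \<open>iter_comm_bound\<close>.\<close>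
  define \<Phi>' where "\<Phi>' = \<phi> (enn2real (A2_char w')) (enn2real (Ainf_char w')) (enn2real (Ainf_char (dual_weight w')))"
  have \<Phi>': "0 \<le> \<Phi>'" unfolding \<Phi>'_def
    by (intro \<phi>0 A2_ennreal[OF w'] Ainf_ennreal[OF w'] Ainf_ennreal[OF A2_dual[OF w']])
  have main: "L2w_norm2 w (iter_comm k b T f) \<le> ennreal ((fact k / r ^ k * \<Phi>)\<^sup>2) * L2w_norm2 w f" if f: "f \<in> L2w w" for f
  proof (rule iter_comm_bound[OF _ _ _ T r _ _ f])
    show "w \<in> borel_measurable lebesgue" "AE x in lebesgue. 0 < w x" using w by (auto simp: A2_def weight_def)
    show "b \<in> borel_measurable lebesgue" using b by (simp add: bmo_le_def)
    show "bounded_on T (tilt w (\<lambda>x. \<bar>b x\<bar>) (- 2 * r)) \<Phi>'"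
      using bound[OF w'] opnorm_bound[OF _ \<Phi>', of w' T] unfolding \<Phi>'_def w'_def by blast
  next
    fix z :: complex
    define \<theta> where "\<theta> = 2 * Re z"
    define u where "u = (tilt w b \<theta>)"
    assume z: "cmod z = r"
    have "\<bar>\<theta>\<bar> * \<beta> \<le> (4 * r) * \<beta>"
      using abs_Re_le_cmod[of z] z r b(2) unfolding \<theta>_def by (intro mult_right_mono) auto
    note small' = small[OF this, unfolded p_def A_def A'_def]
    have u: "A2 u" "A2_char u \<le> 100 * A2_char w"
      unfolding u_def by (rule A2_perturbed[OF w b small'])+
    have "Ainf_char u \<le> ennreal (Ainf_const TYPE('a) * A)"
      unfolding u_def A_def by (rule Ainf_char_perturbed[OF w b small'(1)])
    also have "\<dots> \<le> ennreal (c * A)" using c A by (intro ennreal_leI mult_right_mono) auto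
    finally have uA: "enn2real (Ainf_char u) \<le> c * A" using c A by (intro enn2real_le) auto
    have "Ainf_char (dual_weight u) \<le> ennreal (Ainf_const TYPE('a) * A')"
      unfolding u_def A'_def dual_perturbed by (rule Ainf_char_perturbed[OF dw b]) (use small'(2) in simp)
    also have "\<dots> \<le> ennreal (c * A')" using c A by (intro ennreal_leI mult_right_mono) auto
    finally have uA': "enn2real (Ainf_char (dual_weight u)) \<le> c * A'" using c A by (intro enn2real_le) auto
    have "A2_char u \<le> 100 * ennreal X" using u(2) A2_ennreal(1)[OF w] by (simp add: X_def)
    also have "\<dots> = ennreal (100 * X)" by (simp add: ennreal_mult')
    also have "\<dots> \<le> ennreal (c * X)" using c A by (intro ennreal_leI mult_right_mono) auto
    finally have uX: "enn2real (A2_char u) \<le> c * X" using c A by (intro enn2real_le) auto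
    have "\<phi> (enn2real (A2_char u)) (enn2real (Ainf_char u)) (enn2real (Ainf_char (dual_weight u))) \<le> \<Phi>"
      using \<phi> uX uA uA' A2_ennreal(2)[OF u(1)] Ainf_ennreal(2)[OF u(1)] Ainf_ennreal(2)[OF A2_dual[OF u(1)]]
      unfolding admissible_phi_def \<Phi>_def by blast
    then have "opnorm u T \<le> ennreal \<Phi>" using bound[OF u(1)] ennreal_leI order_trans by blast
    then show "bounded_on T (tilt w b (2 * Re z)) \<Phi>"
      using bound[OF u(1)] opnorm_bound[OF _ \<Phi>, of u T] unfolding u_def \<theta>_def by blast
  qed
  have "opnorm w (iter_comm k b T) \<le> ennreal (fact k / r ^ k * \<Phi>)"
    by (rule opnorm_leI[OF _ main]) (use r \<Phi> in auto)
  \<comment> \<open>Inserting \<open>r\<close> splits the Cauchy factor into the part absorbed by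
    \<open>c\<close> and the powers of \<open>A + A'\<close> and \<open>\<beta>\<close>.\<close>
  also have "fact k / r ^ k * \<Phi> = (fact k * (4 * p) ^ k) * (\<Phi> * (A + A') ^ k * \<beta> ^ k)"
    unfolding r_def by (simp add: power_divide power_mult_distrib)
  also have "ennreal \<dots> \<le> ennreal (c * (\<Phi> * (A + A') ^ k * \<beta> ^ k))"
    using c(3) \<Phi> A b(2) by (intro ennreal_leI mult_right_mono) (auto simp: p_def)
  finally show ?thesis by (simp add: \<Phi>_def A_def A'_def X_def mult.assoc)
qed

theorem theorem1p10:
  fixes k :: nat
  assumes "1 \<le> k"
  shows "\<exists>c::real. 1 \<le> c \<and>
    (\<forall>(\<phi>::real \<Rightarrow> real \<Rightarrow> real \<Rightarrow> real)
       (T::('a::euclidean_space \<Rightarrow> complex) \<Rightarrow> ('a \<Rightarrow> complex)) (b::'a \<Rightarrow> real).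
      admissible_phi \<phi> \<and> linear_op T \<and> BMO b \<and>
      (\<forall>w. A2 w \<longrightarrow>
         (\<forall>f\<in>L2w w. T f \<in> borel_measurable lebesgue) \<and>
         opnorm w T \<le> ennreal (\<phi> (enn2real (A2_char w)) (enn2real (Ainf_char w))
                                  (enn2real (Ainf_char (dual_weight w)))))
      \<longrightarrow>
      (\<forall>w. A2 w \<longrightarrow>
         opnorm w (iter_comm k b T) \<le>
           ennreal (c * \<phi> (c * enn2real (A2_char w)) (c * enn2real (Ainf_char w))
                             (c * enn2real (Ainf_char (dual_weight w)))
                   * (enn2real (Ainf_char w) + enn2real (Ainf_char (dual_weight w))) ^ k
                   * enn2real (bmo_norm b) ^ k)))"
proof -
  \<comment> \<open>The entries bound the growth of the \<open>A2_char\<close> and of the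
    Fujii-Wilson constants under tilting and the Cauchy factor; they depend only on the dimension
    and on \<open>k\<close>.\<close>
  define c where "c = Max {100, Ainf_const TYPE('a), fact k * (4 * pert_const TYPE('a)) ^ k}"
  have c: "100 \<le> c" "Ainf_const TYPE('a) \<le> c" "fact k * (4 * pert_const TYPE('a)) ^ k \<le> c"
    by (simp_all add: c_def)
  show ?thesis
  proof (intro exI[of _ c] conjI allI impI, goal_cases)
    case 1
    show ?case using c(1) by simp
  next
    case (2 \<phi> T b w)
    let ?C = "c * \<phi> (c * enn2real (A2_char w)) (c * enn2real (Ainf_char w)) (c * enn2real (Ainf_char (dual_weight w)))
                   * (enn2real (Ainf_char w) + enn2real (Ainf_char (dual_weight w))) ^ k"
    (* perturbing the norm keeps it positive when b is constant almost everywhere *)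
    let ?\<beta> = "\<lambda>i. enn2real (bmo_norm b) + 1 / real (Suc i)"
    have "opnorm w (iter_comm k b T) \<le> ennreal (?C * ?\<beta> i ^ k)" for i
    proof (rule opnorm_iter_comm_le[OF _ _ _ 2(2) _ _ c])
      show "bmo_le b (?\<beta> i)" by (rule BMO_bmo_le) (use 2 in auto)
      show "0 < ?\<beta> i" by (intro add_nonneg_pos) auto
    qed (use 2 in auto)
    moreover have "(\<lambda>i. ennreal (?C * ?\<beta> i ^ k)) \<longlonglongrightarrow> ennreal (?C * (enn2real (bmo_norm b) + 0) ^ k)"
      by (intro tendsto_intros LIMSEQ_Suc[OF lim_inverse_n'] tendsto_ennrealI)
    ultimately have "opnorm w (iter_comm k b T) \<le> ennreal (?C * (enn2real (bmo_norm b) + 0) ^ k)"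
      by (intro LIMSEQ_le_const) auto
    then show ?case by simp
  qed
qed

end
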